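(* For every integer $n\ge1$, every $c>1$ and every $\epsilon>0$ there are numbers $a(c,\epsilon,n)$ and $d(c,\epsilon,n)$ such that for every $c$-bounded Riemannian metric $g$ on $\mathbb{S}^n$ the metric $\mathcal{T}_{a,d}\,g$ is $(B_a,\epsilon)$-close to hyperbolic whenever $$a>a(c,\epsilon,n)\qquad\text{and}\qquad d>d(c,\epsilon,n).$$
   Context: $B_r\subset\mathbb{R}^{n+1}$ is the ball of radius $r$ centered at the origin; $\mathbb{R}^{n+1}\setminus\{0\}$ is identified with $\mathbb{S}^n\times(0,\infty)$ by polar coordinates; $\sigma_{\mathbb{S}^n}$ is the canonical round metric. "Outside $B_r$" means on $\mathbb{R}^{n+1}\setminus B_r$. Two variable warping deformation: fix a smooth function $\rho:\mathbb{R}\to[0,1]$ with $\rho(t)=0$ for $t\le0$, $\rho(t)=1$ for $t\ge1$, $|\rho'|<3$ and $|\rho''|<12$. For $a,d>0$ put $\rho_{a,d}(t)=\rho\big(2\frac{t-a}{d}\big)$, $(g_{a,d})_t=\sigma_{\mathbb{S}^n}+\rho_{a,d}(t)(g-\sigma_{\mathbb{S}^n})$ and $$\mathcal{T}_{a,d}\,g=\sinh^2(t)\,(g_{a,d})_t+dt^2,$$ a Riemannian metric on $\mathbb{R}^{n+1}$. $c$-bounded ($c>1$): for each $n$ fix a finite atlas of $\mathbb{S}^n$ whose charts $\psi:U\to\mathbb{S}^n$, $U\subset\mathbb{R}^n$, extend to the compact closure of their domains and such that for every $p\in\mathbb{S}^n$ some chart satisfies $d_{\mathbb{R}^n}(\psi^{-1}(p),\mathbb{R}^n\setminus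 U)\ge1$. A metric $g$ on $\mathbb{S}^n$ is $c$-bounded if in every chart of this atlas its matrix satisfies $|g|_{C^2}<c$ and $|\det g|>1/c$ at every point. Here $|\cdot|_{C^2}$ is the uniform $C^2$ norm: the maximum of the sup norms of all partial derivatives of order $\le 2$ of the entries. Radially $\epsilon$-close to hyperbolic: let $\mathbb{B}\subset\mathbb{R}^n$ be the unit ball and $\mathbb{T}=\mathbb{B}\times(-1,1)$ with metric $\sigma=e^{2t}\sigma_{\mathbb{R}^n}+dt^2$, $\sigma_{\mathbb{R}^n}$ flat. A metric $h$ on $\mathbb{S}^n\times(0,\infty)$ of the form $\tilde g_t+dt^2$ is radially $\epsilon$-close to hyperbolic on a subset $S$ if for every $p\in S$ there is a chart (diffeomorphism onto an open subset) $\phi:\mathbb{T}\to\mathbb{S}^n\times(0,\infty)$ with $\phi(0,0)=p$, of the form $\phi(x,t)=(\phi_1(x),t+t_0)$ for some number $t_0$ and chart $\phi_1$ of $\mathbb{S}^n$, such that $|\phi^*h-\sigma|_{C^2}<\epsilon$. $(B_a,\epsilon)$-close to hyperbolic: a metric $h$ on $\mathbb{R}^{n+1}$ such that (1) on $B_a\setminus\{0\}=\mathbb{S}^n\times(0,a)$ one has $h=\sinh^2(t)\sigma_{\mathbb{S}^n}+dt^2$ (so $h$ is hyperbolic on $B_a$), and (2) $h$ is radially $\epsilon$-close to hyperbolic outside $B_{a-1}$. *)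

theory Defs
  imports "HOL-Analysis.Analysis"
begin

text \<open>
  Manifolds here are subsets of Euclidean spaces: \<open>S\<^sup>n\<close> is \<^term>\<open>sphere 0 1\<close> in
  \<open>\<real>\<^sup>n\<^sup>+\<^sup>1\<close>, and \<open>S\<^sup>n \<times> (0,\<infinity>)\<close> is the set \<open>cylinder\<close> below.  The space \<open>\<real>\<^sup>n\<close> is
  \<open>real^'n\<close> and \<open>\<real>\<^sup>n\<^sup>+\<^sup>1\<close> is \<open>real^('n option)\<close>.  A field of bilinear forms is a function
  \<open>g :: 'a \<Rightarrow> 'a \<Rightarrow> 'a \<Rightarrow> real\<close>, where \<open>g p v w\<close> is meaningful only for \<open>p\<close> in the
  manifold and \<open>v, w\<close> tangent to it at \<open>p\<close>.
\<close>

section \<open>Smooth maps and charts\<close>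

primrec Ck_on :: "nat \<Rightarrow> ('a::real_normed_vector \<Rightarrow> 'b::real_normed_vector) \<Rightarrow> 'a set \<Rightarrow> bool"
  where
    "Ck_on 0 f U \<longleftrightarrow> continuous_on U f"
  | "Ck_on (Suc k) f U \<longleftrightarrow>
       (\<forall>x\<in>U. f differentiable (at x)) \<and>
       (\<forall>v. Ck_on k (\<lambda>x. frechet_derivative f (at x) v) U)"

text \<open>On a set that need not be open, smooth means: locally the restriction of a smooth map
  defined on an open set.  For open sets this is the usual notion.\<close>

definition smooth_on :: "'a::real_normed_vector set \<Rightarrow> ('a \<Rightarrow> 'b::real_normed_vector) \<Rightarrow> bool"
  where "smooth_on S f \<longleftrightarrow>
    (\<forall>p\<in>S. \<exists>W F. open W \<and> p \<in> W \<and> (\<forall>k. Ck_on k F W) \<and> (\<forall>x\<in>S \<inter> W. F x = f x))"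

text \<open>Charts go from an open set \<open>U\<close> of the model space into the manifold \<open>M\<close>; they are
  diffeomorphisms onto a relatively open subset of \<open>M\<close>.\<close>

definition is_chart ::
    "'b::real_normed_vector set \<Rightarrow> 'a::real_normed_vector set \<Rightarrow> ('a \<Rightarrow> 'b) \<Rightarrow> bool"
  where "is_chart M U \<psi> \<longleftrightarrow>
    open U \<and> inj_on \<psi> U \<and> openin (top_of_set M) (\<psi> ` U) \<and>
    smooth_on U \<psi> \<and> smooth_on (\<psi> ` U) (inv_into U \<psi>)"

section \<open>Riemannian metrics\<close>

definition inner_product_on :: "'a::real_vector set \<Rightarrow> ('a \<Rightarrow> 'a \<Rightarrow> real) \<Rightarrow> bool"
  where "inner_product_on V B \<longleftrightarrow>
    (\<forall>u\<in>V. \<forall>v\<in>V. \<forall>w\<in>V. \<forall>r s. B (r *\<^sub>R u + s *\<^sub>R v) w = r * B u w + s * B v w) \<and>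
    (\<forall>v\<in>V. \<forall>w\<in>V. B v w = B w v) \<and>
    (\<forall>v\<in>V. v \<noteq> 0 \<longrightarrow> B v v > 0)"

text \<open>\<open>T p\<close> is the tangent space of \<open>M\<close> at \<open>p\<close>.  Smoothness of the metric: \<open>g(X,Y)\<close> is a
  smooth function for all smooth vector fields \<open>X\<close>, \<open>Y\<close> on \<open>M\<close>.\<close>

definition riemannian_metric ::
    "'a::real_normed_vector set \<Rightarrow> ('a \<Rightarrow> 'a set) \<Rightarrow> ('a \<Rightarrow> 'a \<Rightarrow> 'a \<Rightarrow> real) \<Rightarrow> bool"
  where "riemannian_metric M T g \<longleftrightarrow>
    (\<forall>p\<in>M. inner_product_on (T p) (g p)) \<and>
    (\<forall>X Y. smooth_on M X \<and> smooth_on M Y \<and> (\<forall>p\<in>M. X p \<in> T p \<and> Y p \<in> T p) \<longrightarrow>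
       smooth_on M (\<lambda>p. g p (X p) (Y p)))"

definition sphere_tangent :: "'a::real_inner \<Rightarrow> 'a set"
  where "sphere_tangent p = {v. p \<bullet> v = 0}"

definition sphere_metric :: "('a::euclidean_space \<Rightarrow> 'a \<Rightarrow> 'a \<Rightarrow> real) \<Rightarrow> bool"
  where "sphere_metric g \<longleftrightarrow> riemannian_metric (sphere 0 1) sphere_tangent g"

definition round_metric :: "'a::real_inner \<Rightarrow> 'a \<Rightarrow> 'a \<Rightarrow> real"
  where "round_metric p v w = v \<bullet> w"

definition pullback ::
    "('a::real_normed_vector \<Rightarrow> 'b::real_normed_vector) \<Rightarrow> ('b \<Rightarrow> 'b \<Rightarrow> 'b \<Rightarrow> real)
      \<Rightarrow> 'a \<Rightarrow> 'a \<Rightarrow> 'a \<Rightarrow> real"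
  where "pullback f h x v w =
    h (f x) (frechet_derivative f (at x) v) (frechet_derivative f (at x) w)"

section \<open>The uniform \<open>C\<^sup>2\<close> norm\<close>

primrec iter_partial ::
    "'a::real_normed_vector list \<Rightarrow> ('a \<Rightarrow> real) \<Rightarrow> 'a \<Rightarrow> real"
  where
    "iter_partial [] f = f"
  | "iter_partial (b # bs) f = (\<lambda>x. frechet_derivative (iter_partial bs f) (at x) b)"

text \<open>The supremum is taken in the extended reals, so that unbounded entries have norm
  \<open>\<infinity>\<close>; the lists \<open>bs\<close> run over the multi-indices of order at most 2.\<close>

definition C2_norm ::
    "'a::euclidean_space set \<Rightarrow> ('a \<Rightarrow> 'a \<Rightarrow> 'a \<Rightarrow> real) \<Rightarrow> ereal"
  where "C2_norm U h =
    (SUP (i, j, bs, x) \<in> Basis \<times> Basis \<times> {bs. set bs \<subseteq> Basis \<and> length bs \<le> 2} \<times> U.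
       ereal \<bar>iter_partial bs (\<lambda>y. h y i j) x\<bar>)"

section \<open>\<open>c\<close>-bounded metrics on the sphere\<close>

type_synonym 'n sphere_chart = "(real^'n) set \<times> (real^'n \<Rightarrow> real^('n option))"

definition admissible_atlas :: "'n::finite sphere_chart set \<Rightarrow> bool"
  where "admissible_atlas A \<longleftrightarrow>
    finite A \<and>
    (\<forall>(U, \<psi>)\<in>A. is_chart (sphere 0 1) U \<psi> \<and> compact (closure U) \<and>
       (\<exists>\<Psi>. smooth_on (closure U) \<Psi> \<and> \<Psi> ` closure U \<subseteq> sphere 0 1 \<and> (\<forall>x\<in>U. \<Psi> x = \<psi> x))) \<and>
    (\<forall>p\<in>sphere 0 1. \<exists>(U, \<psi>)\<in>A. \<exists>x\<in>U. \<psi> x = p \<and> infdist x (- U) \<ge> 1)"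

definition c_bounded ::
    "'n::finite sphere_chart set \<Rightarrow> real \<Rightarrow>
      (real^('n option) \<Rightarrow> real^('n option) \<Rightarrow> real^('n option) \<Rightarrow> real) \<Rightarrow> bool"
  where "c_bounded A c g \<longleftrightarrow>
    (\<forall>(U, \<psi>)\<in>A.
       C2_norm U (pullback \<psi> g) < ereal c \<and>
       (\<forall>x\<in>U. \<bar>det (\<chi> i j. pullback \<psi> g x (axis i 1) (axis j 1))\<bar> > 1 / c))"

section \<open>Polar coordinates\<close>

definition cylinder :: "('a::real_normed_vector \<times> real) set"
  where "cylinder = sphere 0 1 \<times> {0<..}"

definition cylinder_tangent :: "'a::real_inner \<times> real \<Rightarrow> ('a \<times> real) set"
  where "cylinder_tangent q = sphere_tangent (fst q) \<times> UNIV"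

definition from_polar :: "'a::real_normed_vector \<times> real \<Rightarrow> 'a"
  where "from_polar q = snd q *\<^sub>R fst q"

definition to_polar :: "'a::real_normed_vector \<Rightarrow> 'a \<times> real"
  where "to_polar x = (x /\<^sub>R norm x, norm x)"

text \<open>The metric \<open>g\<^sub>t + dt\<^sup>2\<close> at the point \<open>(p,t)\<close>.\<close>

definition radial_metric ::
    "(real \<Rightarrow> 'a \<Rightarrow> 'a \<Rightarrow> 'a \<Rightarrow> real) \<Rightarrow> 'a \<times> real \<Rightarrow> 'a \<times> real \<Rightarrow> 'a \<times> real \<Rightarrow> real"
  where "radial_metric g q X Y = g (snd q) (fst q) (fst X) (fst Y) + snd X * snd Y"

section \<open>Two variable warping deformation\<close>

definition cutoff_function :: "(real \<Rightarrow> real) \<Rightarrow> bool"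
  where "cutoff_function \<rho> \<longleftrightarrow>
    smooth_on UNIV \<rho> \<and> (\<forall>t. \<rho> t \<in> {0..1}) \<and>
    (\<forall>t\<le>0. \<rho> t = 0) \<and> (\<forall>t\<ge>1. \<rho> t = 1) \<and>
    (\<forall>t. \<bar>deriv \<rho> t\<bar> < 3) \<and> (\<forall>t. \<bar>deriv (deriv \<rho>) t\<bar> < 12)"

definition interpolated_metric ::
    "(real \<Rightarrow> real) \<Rightarrow> real \<Rightarrow> real \<Rightarrow> ('a::real_inner \<Rightarrow> 'a \<Rightarrow> 'a \<Rightarrow> real)
      \<Rightarrow> real \<Rightarrow> 'a \<Rightarrow> 'a \<Rightarrow> 'a \<Rightarrow> real"
  where "interpolated_metric \<rho> a d g t p v w =
    round_metric p v w + \<rho> (2 * ((t - a) / d)) * (g p v w - round_metric p v w)"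

text \<open>Off the origin this is \<open>sinh\<^sup>2(t) (g\<^bsub>a,d\<^esub>)\<^sub>t + dt\<^sup>2\<close> transported by polar coordinates.  The
  Euclidean inner product at the origin is the continuous extension, since the metric is
  \<open>sinh\<^sup>2(t) \<sigma> + dt\<^sup>2\<close> for \<open>t \<le> a\<close>.\<close>

definition warp_deform ::
    "(real \<Rightarrow> real) \<Rightarrow> real \<Rightarrow> real \<Rightarrow> ('a::euclidean_space \<Rightarrow> 'a \<Rightarrow> 'a \<Rightarrow> real)
      \<Rightarrow> 'a \<Rightarrow> 'a \<Rightarrow> 'a \<Rightarrow> real"
  where "warp_deform \<rho> a d g x v w =
    (if x = 0 then v \<bullet> w
     else pullback to_polar
       (radial_metric (\<lambda>t p v w. (sinh t)\<^sup>2 * interpolated_metric \<rho> a d g t p v w)) x v w)"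

section \<open>Closeness to hyperbolic space\<close>

definition model_domain :: "((real^'n) \<times> real) set"
  where "model_domain = ball 0 1 \<times> {-1<..<1}"

definition model_metric ::
    "(real^'n) \<times> real \<Rightarrow> (real^'n) \<times> real \<Rightarrow> (real^'n) \<times> real \<Rightarrow> real"
  where "model_metric = radial_metric (\<lambda>t x v w. exp (2 * t) * (v \<bullet> w))"

text \<open>The first conjunct says that \<open>h\<close> has the form \<open>g\<^sub>t + dt\<^sup>2\<close>.\<close>

definition radially_close_to_hyperbolic ::
    "((real^('n::finite option)) \<times> real) set \<Rightarrow> real \<Rightarrow>
      ((real^('n option)) \<times> real \<Rightarrow> (real^('n option)) \<times> real \<Rightarrow> (real^('n option)) \<times> real \<Rightarrow> real)
      \<Rightarrow> bool"
  where "radially_close_to_hyperbolic S \<epsilon> h \<longleftrightarrow>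
    (\<exists>g. \<forall>q\<in>cylinder. \<forall>X\<in>cylinder_tangent q. \<forall>Y\<in>cylinder_tangent q.
       h q X Y = radial_metric g q X Y) \<and>
    (\<forall>q\<in>S. \<exists>(\<phi> :: (real^'n) \<times> real \<Rightarrow> (real^('n option)) \<times> real) \<phi>\<^sub>1 t\<^sub>0.
       is_chart cylinder model_domain \<phi> \<and> \<phi> (0, 0) = q \<and>
       is_chart (sphere 0 1) (ball 0 1) \<phi>\<^sub>1 \<and>
       (\<forall>(x, t)\<in>model_domain. \<phi> (x, t) = (\<phi>\<^sub>1 x, t + t\<^sub>0)) \<and>
       C2_norm model_domain (\<lambda>y v w. pullback \<phi> h y v w - model_metric y v w) < ereal \<epsilon>)"

definition close_to_hyperbolic ::
    "real \<Rightarrow> real \<Rightarrow>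
      (real^('n::finite option) \<Rightarrow> real^('n option) \<Rightarrow> real^('n option) \<Rightarrow> real) \<Rightarrow> bool"
  where "close_to_hyperbolic a \<epsilon> h \<longleftrightarrow>
    riemannian_metric UNIV (\<lambda>_. UNIV) h \<and>
    (\<forall>q\<in>cylinder. from_polar q \<in> ball 0 a \<longrightarrow>
       (\<forall>X\<in>cylinder_tangent q. \<forall>Y\<in>cylinder_tangent q.
          pullback from_polar h q X Y =
          radial_metric (\<lambda>t p v w. (sinh t)\<^sup>2 * round_metric p v w) q X Y)) \<and>
    radially_close_to_hyperbolic {q\<in>cylinder. from_polar q \<notin> ball 0 (a - 1)} \<epsilon>
      (pullback from_polar h)"

end

theory Submission
  imports Defs
begin

text \<open>
  Around a point at distance \<open>t\<^sub>0\<close> from the origin we use the chart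
  \<open>(x, t) \<mapsto> (\<psi> (p + 2 * exp (- t\<^sub>0) * L x), t + t\<^sub>0)\<close>, where \<open>\<psi>\<close> is a chart of the atlas with \<open>p\<close> deep
  inside its domain, and \<open>L\<close> is an isometry from the flat metric to \<open>\<psi>\<^sup>*(g\<^bsub>a,d\<^esub>)\<close> at height \<open>t\<^sub>0\<close> and at \<open>p\<close>.
  The factor \<open>4 * exp (- 2 * t\<^sub>0) * (sinh (t + t\<^sub>0))\<^sup>2\<close> is \<open>C\<^sup>2\<close>-close to \<open>exp (2 * t)\<close>; derivatives in \<open>x\<close> gain the small factor
  \<open>exp (- t\<^sub>0)\<close>, and derivatives in \<open>t\<close> of the cutoff gain \<open>1 / d\<close>.  The constants do not depend on \<open>g\<close>:
  a bound on the entries and a lower bound on the determinant bound a positive matrix, and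
  hence \<open>L\<close>, uniformly.
\<close>

section \<open>Calculus of smooth maps\<close>

text \<open>In the chart the pulled back metric has the form \<open>F * (Q + e) + dt^2\<close>:
  \<open>F\<close> is the rescaled \<open>sinh\<close> factor, \<open>e\<close> the flat form, and
  \<open>Q\<close> the deviation of the interpolated metric from its value at the centre, which is
  exactly \<open>e\<close> by the choice of \<open>L\<close>. Subtracting the model leaves
  \<open>F * Q + (F - exp (2 * t)) * e\<close>. Here \<open>Q\<close> is the change of the cutoff
  with height, multiplied by \<open>g - round_metric\<close>, plus the changes of the two metrics
  between the centre and \<open>x\<close>. Nothing makes \<open>g - round_metric\<close> small, so
  in the transition zone the metric to be flattened is a genuine mixture and \<open>L\<close> has to
  be adapted to it. The scale \<open>2 * exp (- t\<^sub>0)\<close> compensates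
  \<open>sinh (t + t\<^sub>0)\<close>, which is close to \<open>exp (t + t\<^sub>0) / 2\<close>.
  Boundedness by \<open>c\<close> controls \<open>g\<close> only. The constants of the round metric
  come from compactness in each of the finitely many charts, away from the boundary of the domain. A
  separate obstacle is the origin, where polar coordinates break down and smoothness of the deformed
  metric needs its own argument.\<close>

lemma Ck_on_cong:
  assumes "Ck_on k f U" "open U" "\<And>x. x \<in> U \<Longrightarrow> f x = g x"
  shows "Ck_on k g U"
  using assms
proof (induction k arbitrary: f g)
  case 0
  then show ?case by (simp cong: continuous_on_cong)
next
  case (Suc k)
  have d: "f differentiable (at x)" if "x \<in> U" for x using Suc.prems that by simp
  have e: "frechet_derivative f (at x) = frechet_derivative g (at x)" if "x \<in> U" for x
    using frechet_derivative_transform_within_open[OF d[OF that] Suc.prems(2) that] Suc.prems(3) by blast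
  have "g differentiable (at x)" if "x \<in> U" for x
    using d[OF that] Suc.prems(2,3) that
    by (metis differentiable_def has_derivative_transform_within_open)
  moreover have "Ck_on k (\<lambda>x. frechet_derivative g (at x) v) U" for v
    by (rule Suc.IH[of "\<lambda>x. frechet_derivative f (at x) v"]) (use Suc.prems e in auto)
  ultimately show ?case by simp
qed

lemma Ck_on_subset: "Ck_on k f U \<Longrightarrow> V \<subseteq> U \<Longrightarrow> Ck_on k f V"
  by (induction k arbitrary: f) (auto intro: continuous_on_subset)

lemma Ck_on_SucD: "Ck_on (Suc k) f U \<Longrightarrow> Ck_on k f U"
proof (induction k arbitrary: f)
  case 0
  then show ?case
    by (auto intro!: continuous_at_imp_continuous_on differentiable_imp_continuous_within)
next
  case (Suc k)
  then show ?case by (metis Ck_on.simps(2))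
qed

text \<open>Derivatives are unique, so an explicit formula may replace the one chosen by
  \<open>frechet_derivative\<close>; openness lets the replacement persist in higher derivatives.
  The regularity proofs below can thus work with product and chain rule formulas.\<close>

lemma Ck_on_SucI:
  assumes "open U" "\<And>x. x \<in> U \<Longrightarrow> (f has_derivative f' x) (at x)"
    and "\<And>v. Ck_on k (\<lambda>x. f' x v) U"
  shows "Ck_on (Suc k) f U"
proof -
  have "Ck_on k (\<lambda>x. frechet_derivative f (at x) v) U" for v
    by (rule Ck_on_cong[OF assms(3)[of v] assms(1)]) (metis assms(2) frechet_derivative_at)
  then show ?thesis using assms(2) by (auto simp: differentiable_def)
qed

lemma Ck_on_has_derivative:
  assumes "Ck_on (Suc k) f U" "x \<in> U"
  shows "(f has_derivative frechet_derivative f (at x)) (at x)"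
  using assms by (simp add: frechet_derivative_works)

lemma Ck_on_local:
  assumes "\<And>x. x \<in> U \<Longrightarrow> \<exists>W. open W \<and> x \<in> W \<and> Ck_on k f W"
  shows "Ck_on k f U"
  using assms
proof (induction k arbitrary: f)
  case 0
  have "isCont f x" if "x \<in> U" for x
    using 0[OF that] by (auto simp: continuous_on_eq_continuous_at)
  then show ?case by (simp add: continuous_at_imp_continuous_on)
next
  case (Suc k)
  have "Ck_on k (\<lambda>x. frechet_derivative f (at x) v) U" for v
    by (rule Suc.IH) (use Suc.prems in fastforce)
  then show ?case using Suc.prems by fastforce
qed

lemma Ck_on_const: "open U \<Longrightarrow> Ck_on k (\<lambda>x. c) U"
proof (induction k arbitrary: c)
  case (Suc k)
  show ?case by (rule Ck_on_SucI[where f'="\<lambda>_ _. 0"]) (use Suc in auto)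
qed auto

lemma Ck_on_bounded_linear:
  assumes "open U" "bounded_linear f"
  shows "Ck_on k f U"
proof (cases k)
  case 0
  then show ?thesis using assms(2) by (simp add: linear_continuous_on)
next
  case (Suc m)
  show ?thesis unfolding Suc
    by (rule Ck_on_SucI[where f'="\<lambda>_. f"])
       (use assms in \<open>auto intro: bounded_linear_imp_has_derivative Ck_on_const\<close>)
qed

lemma Ck_on_add:
  "open U \<Longrightarrow> Ck_on k f U \<Longrightarrow> Ck_on k g U \<Longrightarrow> Ck_on k (\<lambda>x. f x + g x) U"
proof (induction k arbitrary: f g)
  case 0
  then show ?case by (auto intro: continuous_intros)
next
  case (Suc k)
  show ?case
    by (rule Ck_on_SucI[where f'="\<lambda>x v. frechet_derivative f (at x) v + frechet_derivative g (at x) v"])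
       (use Suc in \<open>auto intro!: has_derivative_add Ck_on_has_derivative Suc.IH\<close>)
qed

lemma (in bounded_bilinear) Ck_on:
  "open U \<Longrightarrow> Ck_on k f U \<Longrightarrow> Ck_on k g U \<Longrightarrow> Ck_on k (\<lambda>x. prod (f x) (g x)) U"
proof (induction k arbitrary: f g)
  case 0
  then show ?case by (auto intro: continuous_on)
next
  case (Suc k)
  have fg: "Ck_on k f U" "Ck_on k g U" using Suc.prems Ck_on_SucD by blast+
  show ?case
  proof (rule Ck_on_SucI[OF Suc.prems(1)])
    show "((\<lambda>x. prod (f x) (g x)) has_derivative
        (\<lambda>v. prod (f x) (frechet_derivative g (at x) v) + prod (frechet_derivative f (at x) v) (g x))) (at x)"
      if "x \<in> U" for x
      by (rule FDERIV) (use Suc.prems that in \<open>auto intro!: Ck_on_has_derivative\<close>)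
    show "Ck_on k (\<lambda>x. prod (f x) (frechet_derivative g (at x) v) + prod (frechet_derivative f (at x) v) (g x)) U" for v
      by (intro Ck_on_add Suc.IH) (use Suc.prems fg in auto)
  qed
qed

lemma Ck_on_sum:
  "open U \<Longrightarrow> (\<And>i. i \<in> I \<Longrightarrow> Ck_on k (f i) U) \<Longrightarrow> Ck_on k (\<lambda>x. \<Sum>i\<in>I. f i x) U"
  by (induction I rule: infinite_finite_induct) (auto intro: Ck_on_add Ck_on_const)

text \<open>The induction hypothesis applies to derivatives of \<open>f\<close> in a fixed
  direction, while the chain rule produces the moving direction \<open>g'(x) v\<close>. Expanding
  that direction in a basis gives a sum of products of scalar components of \<open>g'\<close> with
  fixed directional derivatives of \<open>f\<close> composed with \<open>g\<close>. This is why the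
  middle space is Euclidean.\<close>

lemma Ck_on_compose:
  fixes f :: "'b::euclidean_space \<Rightarrow> 'c::real_normed_vector"
  assumes "open U" "open V" "Ck_on k f V" "Ck_on k g U" "g ` U \<subseteq> V"
  shows "Ck_on k (\<lambda>x. f (g x)) U"
  using assms
proof (induction k arbitrary: f)
  case 0
  then show ?case by (auto intro: continuous_on_compose2)
next
  case (Suc k)
  have df: "(f has_derivative frechet_derivative f (at (g x))) (at (g x))" if "x \<in> U" for x
    using Suc.prems that by (blast intro: Ck_on_has_derivative)
  have dg: "(g has_derivative frechet_derivative g (at x)) (at x)" if "x \<in> U" for x
    using Suc.prems that by (blast intro: Ck_on_has_derivative)
  have gk: "Ck_on k g U" using Suc.prems Ck_on_SucD by blast
  have eq: "frechet_derivative f (at (g x)) w = (\<Sum>b\<in>Basis. (w \<bullet> b) *\<^sub>R frechet_derivative f (at (g x)) b)"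
    if "x \<in> U" for x w
  proof -
    interpret linear "frechet_derivative f (at (g x))"
      using df[OF that] by (rule has_derivative_linear)
    have "frechet_derivative f (at (g x)) w = frechet_derivative f (at (g x)) (\<Sum>b\<in>Basis. (w \<bullet> b) *\<^sub>R b)"
      by (simp add: euclidean_representation)
    then show ?thesis by (simp add: sum scaleR)
  qed
  show ?case
  proof (rule Ck_on_SucI[OF Suc.prems(1)])
    show "((\<lambda>x. f (g x)) has_derivative (\<lambda>v. \<Sum>b\<in>Basis. (frechet_derivative g (at x) v \<bullet> b) *\<^sub>R frechet_derivative f (at (g x)) b)) (at x)"
      if "x \<in> U" for x
    proof -
      have "frechet_derivative f (at (g x)) \<circ> frechet_derivative g (at x)
          = (\<lambda>v. \<Sum>b\<in>Basis. (frechet_derivative g (at x) v \<bullet> b) *\<^sub>R frechet_derivative f (at (g x)) b)"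
        by (rule ext, unfold o_apply) (rule eq[OF that])
      then show ?thesis
        using diff_chain_at[OF dg[OF that] df[OF that]] by (simp add: o_def)
    qed
    have "Ck_on k (\<lambda>x. frechet_derivative f (at (g x)) b) U" for b
      by (rule Suc.IH[where f="\<lambda>y. frechet_derivative f (at y) b"]) (use Suc.prems gk in auto)
    moreover have "Ck_on k (\<lambda>x. frechet_derivative g (at x) v \<bullet> b) U" for v b
      by (rule bounded_bilinear.Ck_on[OF bounded_bilinear_inner])
         (use Suc.prems in \<open>auto intro: Ck_on_const\<close>)
    ultimately show "Ck_on k (\<lambda>x. \<Sum>b\<in>Basis. (frechet_derivative g (at x) v \<bullet> b) *\<^sub>R frechet_derivative f (at (g x)) b) U" for v
      using Suc.prems(1)
      by (intro Ck_on_sum bounded_bilinear.Ck_on[OF bounded_bilinear_scaleR]) auto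
  qed
qed

section \<open>Smooth maps on arbitrary subsets\<close>

lemma smooth_onE:
  assumes "smooth_on S f" "p \<in> S"
  obtains W F where "open W" "p \<in> W" "\<And>k. Ck_on k F W" "\<And>x. x \<in> S \<Longrightarrow> x \<in> W \<Longrightarrow> F x = f x"
proof -
  from assms obtain W F where "open W \<and> p \<in> W \<and> (\<forall>k. Ck_on k F W) \<and> (\<forall>x\<in>S \<inter> W. F x = f x)"
    unfolding smooth_on_def by meson
  then show ?thesis by (intro that[of W F]) auto
qed

lemma smooth_onI:
  assumes "\<And>p. p \<in> S \<Longrightarrow> \<exists>W F. open W \<and> p \<in> W \<and> (\<forall>k. Ck_on k F W) \<and> (\<forall>x\<in>S \<inter> W. F x = f x)"
  shows "smooth_on S f"
  using assms unfolding smooth_on_def by simp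

lemma smooth_on_open_iff:
  assumes "open S"
  shows "smooth_on S f \<longleftrightarrow> (\<forall>k. Ck_on k f S)"
proof
  assume L: "smooth_on S f"
  show "\<forall>k. Ck_on k f S"
  proof (intro allI Ck_on_local)
    fix k x assume "x \<in> S"
    obtain W F where W: "open W" "x \<in> W" "\<And>k. Ck_on k F W" "\<And>x. x \<in> S \<Longrightarrow> x \<in> W \<Longrightarrow> F x = f x"
      by (rule smooth_onE[OF L \<open>x \<in> S\<close>]) blast
    have "Ck_on k f (S \<inter> W)"
      by (rule Ck_on_cong[of _ F]) (use W assms in \<open>auto intro: Ck_on_subset\<close>)
    then show "\<exists>W. open W \<and> x \<in> W \<and> Ck_on k f W"
      using W assms \<open>x \<in> S\<close> by (intro exI[of _ "S \<inter> W"]) auto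
  qed
next
  assume "\<forall>k. Ck_on k f S"
  then show "smooth_on S f"
    unfolding smooth_on_def using assms by (intro ballI exI[of _ S] exI[of _ f]) simp
qed

lemma smooth_on_cong:
  "smooth_on S f \<Longrightarrow> (\<And>x. x \<in> S \<Longrightarrow> f x = g x) \<Longrightarrow> smooth_on S g"
  unfolding smooth_on_def by (metis IntD1)

lemma smooth_on_subset: "smooth_on S f \<Longrightarrow> T \<subseteq> S \<Longrightarrow> smooth_on T f"
proof (rule smooth_onI)
  fix p assume *: "smooth_on S f" "T \<subseteq> S" "p \<in> T"
  obtain W F where "open W" "p \<in> W" "\<And>k. Ck_on k F W" "\<And>x. x \<in> S \<Longrightarrow> x \<in> W \<Longrightarrow> F x = f x"
    by (rule smooth_onE[of S f p]) (use * in auto)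
  then show "\<exists>W F. open W \<and> p \<in> W \<and> (\<forall>k. Ck_on k F W) \<and> (\<forall>x\<in>T \<inter> W. F x = f x)"
    using * by (intro exI[of _ W] exI[of _ F]) auto
qed

lemma smooth_on_local:
  assumes "\<And>p. p \<in> S \<Longrightarrow> \<exists>W. open W \<and> p \<in> W \<and> smooth_on (S \<inter> W) f"
  shows "smooth_on S f"
  unfolding smooth_on_def
proof
  fix p assume p: "p \<in> S"
  then obtain W where W: "open W" "p \<in> W" "smooth_on (S \<inter> W) f" using assms by blast
  obtain W' F where W': "open W'" "p \<in> W'" "\<And>k. Ck_on k F W'"
      "\<And>x. x \<in> S \<inter> W \<Longrightarrow> x \<in> W' \<Longrightarrow> F x = f x"
    by (rule smooth_onE[OF W(3), of p]) (use p W in auto)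
  then show "\<exists>W F. open W \<and> p \<in> W \<and> (\<forall>k. Ck_on k F W) \<and> (\<forall>x\<in>S \<inter> W. F x = f x)"
    using W W' by (intro exI[of _ "W \<inter> W'"] exI[of _ F]) (auto intro: Ck_on_subset)
qed

lemma smooth_on_const: "smooth_on S (\<lambda>x. c)"
  by (rule smooth_on_subset[of UNIV]) (auto simp: smooth_on_open_iff intro: Ck_on_const)

lemma smooth_on_bounded_linear: "bounded_linear f \<Longrightarrow> smooth_on S f"
  by (rule smooth_on_subset[of UNIV]) (auto simp: smooth_on_open_iff intro: Ck_on_bounded_linear)

lemma smooth_on_id: "smooth_on S (\<lambda>x. x)"
  by (rule smooth_on_bounded_linear) (rule bounded_linear_ident)

lemma smooth_on_binop:
  \<comment> \<open>The local extensions of \<open>f\<close> and \<open>g\<close> live on different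
    neighbourhoods, and the operation is applied on their intersection. Sums, bilinear products and
    pairs are all instances.\<close>
  fixes f :: "'a::real_normed_vector \<Rightarrow> 'b::real_normed_vector" and g :: "'a \<Rightarrow> 'c::real_normed_vector"
    and h :: "'b \<Rightarrow> 'c \<Rightarrow> 'd::real_normed_vector"
  assumes "smooth_on S f" "smooth_on S g"
    and "\<And>k (U :: 'a set) F G. open U \<Longrightarrow> Ck_on k F U \<Longrightarrow> Ck_on k G U \<Longrightarrow> Ck_on k (\<lambda>x. h (F x) (G x)) U"
  shows "smooth_on S (\<lambda>x. h (f x) (g x))"
  unfolding smooth_on_def
proof
  fix p assume p: "p \<in> S"
  obtain W F where W: "open W" "p \<in> W" "\<And>k. Ck_on k F W" "\<And>x. x \<in> S \<Longrightarrow> x \<in> W \<Longrightarrow> F x = f x"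
    by (rule smooth_onE[OF assms(1) p]) blast
  obtain V G where V: "open V" "p \<in> V" "\<And>k. Ck_on k G V" "\<And>x. x \<in> S \<Longrightarrow> x \<in> V \<Longrightarrow> G x = g x"
    by (rule smooth_onE[OF assms(2) p]) blast
  have "Ck_on k (\<lambda>x. h (F x) (G x)) (W \<inter> V)" for k
    by (rule assms(3)) (use W V in \<open>auto intro: Ck_on_subset\<close>)
  then show "\<exists>W H. open W \<and> p \<in> W \<and> (\<forall>k. Ck_on k H W) \<and> (\<forall>x\<in>S \<inter> W. H x = h (f x) (g x))"
    using W V by (intro exI[of _ "W \<inter> V"] exI[of _ "\<lambda>x. h (F x) (G x)"]) auto
qed

lemma smooth_on_add: "smooth_on S f \<Longrightarrow> smooth_on S g \<Longrightarrow> smooth_on S (\<lambda>x. f x + g x)"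
  by (rule smooth_on_binop) (auto intro: Ck_on_add)

lemma (in bounded_bilinear) smooth_on:
  "smooth_on S f \<Longrightarrow> smooth_on S g \<Longrightarrow> smooth_on S (\<lambda>x. prod (f x) (g x))"
  by (rule smooth_on_binop) (auto intro: Ck_on)

lemmas smooth_on_mult = bounded_bilinear.smooth_on[OF bounded_bilinear_mult]
lemmas smooth_on_scaleR = bounded_bilinear.smooth_on[OF bounded_bilinear_scaleR]
lemmas smooth_on_inner = bounded_bilinear.smooth_on[OF bounded_bilinear_inner]

lemma smooth_on_sum:
  "(\<And>i. i \<in> I \<Longrightarrow> smooth_on S (f i)) \<Longrightarrow> smooth_on S (\<lambda>x. \<Sum>i\<in>I. f i x)"
  by (induction I rule: infinite_finite_induct) (auto intro: smooth_on_add smooth_on_const)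

lemma smooth_on_compose:
  fixes f :: "'b::euclidean_space \<Rightarrow> 'c::real_normed_vector"
  assumes "smooth_on T f" "smooth_on S g" "g ` S \<subseteq> T"
  shows "smooth_on S (\<lambda>x. f (g x))"
  unfolding smooth_on_def
proof
  fix p assume p: "p \<in> S"
  obtain W G where W: "open W" "p \<in> W" "\<And>k. Ck_on k G W" "\<And>x. x \<in> S \<Longrightarrow> x \<in> W \<Longrightarrow> G x = g x"
    by (rule smooth_onE[OF assms(2) p]) blast
  obtain V F where V: "open V" "g p \<in> V" "\<And>k. Ck_on k F V" "\<And>x. x \<in> T \<Longrightarrow> x \<in> V \<Longrightarrow> F x = f x"
    by (rule smooth_onE[OF assms(1), of "g p"]) (use p assms(3) in auto)
  have "continuous_on W G" using W(3)[of 0] by simp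
  then have o: "open (G -` V \<inter> W)" using V(1) W(1) by (metis continuous_on_open_vimage)
  have "Ck_on k (\<lambda>x. F (G x)) (G -` V \<inter> W)" for k
    by (rule Ck_on_compose[where V=V]) (use o V W in \<open>auto intro: Ck_on_subset\<close>)
  moreover have "F (G x) = f (g x)" if "x \<in> S \<inter> (G -` V \<inter> W)" for x
  proof -
    have "G x = g x" "g x \<in> T \<inter> V" using that W(4) assms(3) by auto
    then show ?thesis using V(4) by simp
  qed
  moreover have "p \<in> G -` V \<inter> W" using W V p by simp
  ultimately show "\<exists>W H. open W \<and> p \<in> W \<and> (\<forall>k. Ck_on k H W) \<and> (\<forall>x\<in>S \<inter> W. H x = f (g x))"
    using o by (intro exI[of _ "G -` V \<inter> W"] exI[of _ "\<lambda>x. F (G x)"]) simp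
qed

lemma smooth_on_minus: "smooth_on S f \<Longrightarrow> smooth_on S (\<lambda>x. - f x)"
  using smooth_on_scaleR[OF smooth_on_const[of _ "-1"], of S f] by simp

lemma smooth_on_diff: "smooth_on S f \<Longrightarrow> smooth_on S g \<Longrightarrow> smooth_on S (\<lambda>x. f x - g x)"
  using smooth_on_add[OF _ smooth_on_minus, of S f g] by simp

lemma smooth_on_Pair:
  assumes "smooth_on S f" "smooth_on S g" shows "smooth_on S (\<lambda>x. (f x, g x))"
proof (rule smooth_on_binop[OF assms])
  fix k U and F :: "'a \<Rightarrow> 'b" and G :: "'a \<Rightarrow> 'c"
  assume *: "open U" "Ck_on k F U" "Ck_on k G U"
  have "Ck_on k (\<lambda>x. (F x, 0) + (0, G x)) U"
    using *
  proof (induction k arbitrary: F G)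
    case 0
    then show ?case by (auto intro!: continuous_intros)
  next
    case (Suc k)
    show ?case
    proof (rule Ck_on_SucI[where f'="\<lambda>x v. (frechet_derivative F (at x) v, 0) + (0, frechet_derivative G (at x) v)"])
      fix x assume x: "x \<in> U"
      show "((\<lambda>x. (F x, 0) + (0, G x)) has_derivative
        (\<lambda>v. (frechet_derivative F (at x) v, 0) + (0, frechet_derivative G (at x) v))) (at x)"
        using has_derivative_Pair[OF Ck_on_has_derivative[OF Suc.prems(2) x] Ck_on_has_derivative[OF Suc.prems(3) x]]
        by simp
    qed (use Suc in auto)
  qed
  then show "Ck_on k (\<lambda>x. (F x, G x)) U" by simp
qed

section \<open>Smoothness of elementary functions and power series\<close>

lemma Ck_on_real_SucI:
  fixes f :: "real \<Rightarrow> real"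
  assumes "open U" "\<And>x. x \<in> U \<Longrightarrow> (f has_real_derivative f' x) (at x)" "Ck_on k f' U"
  shows "Ck_on (Suc k) f U"
proof (rule Ck_on_SucI[OF assms(1)])
  show "(f has_derivative (\<lambda>v. f' x * v)) (at x)" if "x \<in> U" for x
    using assms(2)[OF that] by (simp add: has_field_derivative_def)
  show "Ck_on k (\<lambda>x. f' x * v) U" for v
    by (rule bounded_bilinear.Ck_on[OF bounded_bilinear_mult]) (use assms in \<open>auto intro: Ck_on_const\<close>)
qed

lemmas Ck_on_mult = bounded_bilinear.Ck_on[OF bounded_bilinear_mult]

text \<open>The derivative is minus the square of the function itself, so the induction on the order
  closes with the product rule.\<close>

lemma smooth_on_inverse: "smooth_on (- {0}) (inverse :: real \<Rightarrow> real)"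
proof -
  have o: "open (- {0::real})" by auto
  have "Ck_on k (inverse :: real \<Rightarrow> real) (- {0})" for k
  proof (induction k)
    case 0
    then show ?case by (auto intro!: continuous_intros)
  next
    case (Suc k)
    show ?case
    proof (rule Ck_on_real_SucI[OF o])
      show "(inverse has_real_derivative (-1) * (inverse x * inverse x)) (at x)" if "x \<in> - {0}" for x :: real
        using that by (auto intro!: derivative_eq_intros)
      show "Ck_on k (\<lambda>x::real. (-1) * (inverse x * inverse x)) (- {0})"
        by (intro Ck_on_mult Ck_on_const o Suc)
    qed
  qed
  then show ?thesis using smooth_on_open_iff[OF o] by blast
qed

text \<open>The derivative is half of \<open>inverse\<close> composed with \<open>sqrt\<close>, so
  order \<open>k + 1\<close> follows from order \<open>k\<close> by composition; positivity keeps
  the inner function in the domain of \<open>inverse\<close>.\<close>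

lemma smooth_on_sqrt: "smooth_on {0<..} sqrt"
proof -
  have o: "open {0::real<..}" by auto
  have i: "Ck_on k inverse (- {0::real})" for k
    using smooth_on_inverse smooth_on_open_iff[of "- {0::real}" inverse] by (simp add: open_Compl)
  have "Ck_on k sqrt {0<..}" for k
  proof (induction k)
    case 0
    then show ?case by (auto intro!: continuous_intros)
  next
    case (Suc k)
    have "Ck_on k (\<lambda>x. inverse (sqrt x)) {0<..}"
      by (rule Ck_on_compose[OF o _ i Suc]) auto
    then have "Ck_on k (\<lambda>x. inverse (sqrt x) * (1/2)) {0<..}"
      by (intro Ck_on_mult Ck_on_const o)
    then show ?case
      by (rule Ck_on_real_SucI[OF o, rotated]) (auto intro!: derivative_eq_intros)
  qed
  then show ?thesis by (simp add: smooth_on_open_iff)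
qed

lemma smooth_on_exp: "smooth_on S (exp :: real \<Rightarrow> real)"
proof -
  have "Ck_on k (exp :: real \<Rightarrow> real) UNIV" for k
  proof (induction k)
    case 0
    then show ?case by (auto intro!: continuous_intros)
  next
    case (Suc k)
    show ?case
      by (rule Ck_on_real_SucI[where f'=exp]) (use Suc in \<open>auto intro!: derivative_eq_intros\<close>)
  qed
  then have "smooth_on UNIV (exp :: real \<Rightarrow> real)" by (simp add: smooth_on_open_iff)
  then show ?thesis by (rule smooth_on_subset) simp
qed

lemma smooth_on_sinh: "smooth_on S (sinh :: real \<Rightarrow> real)"
proof -
  have "smooth_on S (\<lambda>x::real. (1/2) * (exp x - exp (- x)))"
    by (intro smooth_on_mult smooth_on_diff smooth_on_const
        smooth_on_compose[OF smooth_on_exp[of UNIV]] smooth_on_minus smooth_on_id) auto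
  then show ?thesis by (rule smooth_on_cong) (simp add: sinh_def)
qed

lemma smooth_on_norm: "smooth_on (- {0}) (norm :: 'a::euclidean_space \<Rightarrow> real)"
proof -
  have "smooth_on (- {0}) (\<lambda>x::'a. sqrt (x \<bullet> x))"
    by (rule smooth_on_compose[OF smooth_on_sqrt]) (auto intro: smooth_on_inner smooth_on_id)
  then show ?thesis by (rule smooth_on_cong) (simp add: norm_eq_sqrt_inner)
qed

text \<open>Termwise differentiation gives another everywhere convergent series, with coefficients
  \<open>diffs a\<close>; the induction therefore ranges over all coefficient sequences. The result
  serves the expansion of the metric at the origin.\<close>

lemma smooth_on_power_series:
  fixes a :: "nat \<Rightarrow> real"
  assumes "\<And>x. summable (\<lambda>n. a n * x ^ n)"
  shows "smooth_on S (\<lambda>x. \<Sum>n. a n * x ^ n)"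
proof -
  have "Ck_on k (\<lambda>x. \<Sum>n. a n * x ^ n) UNIV" for k
    using assms
  proof (induction k arbitrary: a)
    case 0
    have "isCont (\<lambda>x. \<Sum>n. a n * x ^ n) x" for x
      by (rule isCont_powser_converges_everywhere) (rule 0)
    then show ?case by (simp add: continuous_at_imp_continuous_on)
  next
    case (Suc k)
    have s: "summable (\<lambda>n. diffs a n * x ^ n)" for x
      by (rule termdiff_converges_all) (rule Suc)
    show ?case
      by (rule Ck_on_real_SucI[OF _ termdiffs_strong_converges_everywhere Suc.IH[OF s]])
        (auto intro: Suc.prems)
  qed
  then have "smooth_on UNIV (\<lambda>x. \<Sum>n. a n * x ^ n)" by (simp add: smooth_on_open_iff)
  then show ?thesis by (rule smooth_on_subset) simp
qed

lemma smooth_on_continuous_on: "smooth_on S f \<Longrightarrow> continuous_on S f"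
  unfolding continuous_on_eq_continuous_within
proof
  fix p assume f: "smooth_on S f" and p: "p \<in> S"
  obtain W F where W: "open W" "p \<in> W" "\<And>k. Ck_on k F W" "\<And>x. x \<in> S \<Longrightarrow> x \<in> W \<Longrightarrow> F x = f x"
    by (rule smooth_onE[OF f p]) blast
  have "isCont F p" using W(3)[of 0] W(1,2) by (simp add: continuous_on_eq_continuous_at)
  then have "(F \<longlongrightarrow> f p) (at p within S)"
    using W(2,4) p by (metis continuous_at_imp_continuous_at_within continuous_within)
  moreover have "eventually (\<lambda>x. F x = f x) (at p within S)"
    using W by (auto simp: eventually_at_topological)
  ultimately show "continuous (at p within S) f"
    unfolding continuous_within by (rule Lim_transform_eventually)
qed

lemma smooth_on_frechet_derivative:
  "open S \<Longrightarrow> smooth_on S f \<Longrightarrow> smooth_on S (\<lambda>x. frechet_derivative f (at x) v)"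
  by (metis smooth_on_open_iff Ck_on.simps(2))

lemma smooth_on_has_derivative:
  "open S \<Longrightarrow> smooth_on S f \<Longrightarrow> x \<in> S \<Longrightarrow> (f has_derivative frechet_derivative f (at x)) (at x)"
  by (metis smooth_on_open_iff Ck_on_has_derivative)

section \<open>Metrics on the sphere and their warped deformations\<close>

lemma inner_product_onD:
  assumes "inner_product_on V B" "u \<in> V" "v \<in> V" "w \<in> V"
  shows "B (r *\<^sub>R u + s *\<^sub>R v) w = r * B u w + s * B v w"
    and "B v w = B w v"
    and "v \<noteq> 0 \<Longrightarrow> B v v > 0"
  using assms unfolding inner_product_on_def by simp_all

lemma inner_product_on_sum:
  fixes B :: "'a::real_vector \<Rightarrow> 'a \<Rightarrow> real"
  assumes B: "inner_product_on V B" and V: "subspace V" and w: "w \<in> V"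
    and "\<And>i. i \<in> I \<Longrightarrow> u i \<in> V"
  shows "B (\<Sum>i\<in>I. c i *\<^sub>R u i) w = (\<Sum>i\<in>I. c i * B (u i) w)"
  using assms(4)
proof (induction I rule: infinite_finite_induct)
  case (insert i I)
  have "(\<Sum>i\<in>I. c i *\<^sub>R u i) \<in> V"
    using insert.prems V by (intro subspace_sum subspace_scale) auto
  then have "B (c i *\<^sub>R u i + 1 *\<^sub>R (\<Sum>i\<in>I. c i *\<^sub>R u i)) w = c i * B (u i) w + 1 * B (\<Sum>i\<in>I. c i *\<^sub>R u i) w"
    using insert.prems w by (intro inner_product_onD(1)[OF B]) auto
  then show ?case using insert by simp
qed (use inner_product_onD(1)[OF B w w w, of 0 0] in auto)

lemma inner_product_on_convex:
  assumes "inner_product_on V B" "inner_product_on V B'" "0 \<le> r" "r \<le> 1"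
  shows "inner_product_on V (\<lambda>v w. (1 - r) * B v w + r * B' v w)"
  unfolding inner_product_on_def
proof (intro conjI ballI allI impI)
  fix u v w :: 'a and c e :: real assume *: "u \<in> V" "v \<in> V" "w \<in> V"
  show "(1 - r) * B (c *\<^sub>R u + e *\<^sub>R v) w + r * B' (c *\<^sub>R u + e *\<^sub>R v) w
      = c * ((1 - r) * B u w + r * B' u w) + e * ((1 - r) * B v w + r * B' v w)"
    unfolding inner_product_onD(1)[OF assms(1) *] inner_product_onD(1)[OF assms(2) *]
    by (simp add: algebra_simps)
next
  fix v w assume *: "v \<in> V" "w \<in> V"
  show "(1 - r) * B v w + r * B' v w = (1 - r) * B w v + r * B' w v"
    using inner_product_onD(2)[OF assms(1) *(1,1,2)] inner_product_onD(2)[OF assms(2) *(1,1,2)] by simp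
next
  fix v assume *: "v \<in> V" "v \<noteq> 0"
  have a: "B v v > 0" "B' v v > 0"
    using inner_product_onD(3)[OF assms(1) *(1,1,1,2)] inner_product_onD(3)[OF assms(2) *(1,1,1,2)] by auto
  show "(1 - r) * B v v + r * B' v v > 0"
  proof (cases "r = 0")
    case False
    then have "r * B' v v > 0" "(1 - r) * B v v \<ge> 0" using assms a by auto
    then show ?thesis by simp
  qed (use a in simp)
qed

section \<open>A global spanning family of tangent fields on the sphere\<close>

lemma subspace_sphere_tangent: "subspace (sphere_tangent p)"
  by (auto simp: subspace_def sphere_tangent_def inner_add_right)

text \<open>For a unit vector \<open>p\<close> this is the orthogonal projection onto the tangent
  space. Projecting the fixed basis vectors gives smooth global tangent fields that span every
  tangent space; in general the sphere has no global frame.\<close>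

definition tangent_part :: "'a::real_inner \<Rightarrow> 'a \<Rightarrow> 'a"
  where "tangent_part p v = v - (p \<bullet> v) *\<^sub>R p"

lemma tangent_part_in: "norm p = 1 \<Longrightarrow> tangent_part p v \<in> sphere_tangent p"
  by (simp add: tangent_part_def sphere_tangent_def inner_diff_right dot_square_norm)

lemma smooth_on_tangent_part:
  fixes f X :: "'a::real_normed_vector \<Rightarrow> 'b::real_inner"
  assumes "smooth_on S f" "smooth_on S X"
  shows "smooth_on S (\<lambda>x. tangent_part (f x) (X x))"
  unfolding tangent_part_def
  by (intro smooth_on_diff smooth_on_scaleR smooth_on_inner assms)

lemma sum_tangent_part:
  fixes p v :: "'a::euclidean_space"
  assumes "v \<in> sphere_tangent p"
  shows "(\<Sum>b\<in>Basis. (v \<bullet> b) *\<^sub>R tangent_part p b) = v"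
proof -
  have "(\<Sum>b\<in>Basis. (v \<bullet> b) * (p \<bullet> b)) = 0"
    using assms by (simp add: sphere_tangent_def euclidean_inner[of p v] mult.commute)
  then have "(\<Sum>b\<in>Basis. (v \<bullet> b) *\<^sub>R ((p \<bullet> b) *\<^sub>R p)) = 0"
    by (metis (no_types, lifting) scaleR_scaleR scaleR_sum_left scaleR_zero_left sum.cong)
  then show ?thesis
    by (simp add: tangent_part_def scaleR_diff_right sum_subtractf euclidean_representation)
qed

lemma sphere_metric_inner_product:
  "sphere_metric g \<Longrightarrow> norm p = 1 \<Longrightarrow> inner_product_on (sphere_tangent p) (g p)"
  by (simp add: sphere_metric_def riemannian_metric_def)

lemma sphere_metric_round: "sphere_metric (round_metric :: 'a::euclidean_space \<Rightarrow> _)"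
  unfolding sphere_metric_def riemannian_metric_def inner_product_on_def round_metric_def
  by (auto simp: inner_add_left inner_add_right inner_commute intro: smooth_on_inner)

text \<open>By bilinearity a metric is determined by its values on the projected basis vectors,
  which span although they are linearly dependent. These values are smooth functions on the whole
  sphere, so no local coordinates are needed.\<close>

lemma sphere_metric_frame:
  fixes g :: "'a::euclidean_space \<Rightarrow> 'a \<Rightarrow> 'a \<Rightarrow> real"
  assumes g: "sphere_metric g" and p: "norm p = 1"
    and v: "v \<in> sphere_tangent p" and w: "w \<in> sphere_tangent p"
  shows "g p v w = (\<Sum>b\<in>Basis. \<Sum>b'\<in>Basis.
    (v \<bullet> b) * ((w \<bullet> b') * g p (tangent_part p b) (tangent_part p b')))"
proof -
  note B = sphere_metric_inner_product[OF g p]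
  have *: "g p v w = (\<Sum>b\<in>Basis. (v \<bullet> b) * g p (tangent_part p b) w)"
    if "v \<in> sphere_tangent p" "w \<in> sphere_tangent p" for v w
    using inner_product_on_sum[OF B subspace_sphere_tangent that(2), of Basis "tangent_part p" "\<lambda>b. v \<bullet> b"]
    by (simp add: sum_tangent_part that tangent_part_in[OF p])
  have "g p (tangent_part p b) w = (\<Sum>b'\<in>Basis. (w \<bullet> b') * g p (tangent_part p b) (tangent_part p b'))" for b
  proof -
    have s: "g p x y = g p y x" if "x \<in> sphere_tangent p" "y \<in> sphere_tangent p" for x y
      using inner_product_onD(2)[OF B] that by blast
    have "g p (tangent_part p b) w = g p w (tangent_part p b)"
      by (intro s w tangent_part_in p)
    also have "\<dots> = (\<Sum>b'\<in>Basis. (w \<bullet> b') * g p (tangent_part p b') (tangent_part p b))"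
      by (intro * w tangent_part_in p)
    also have "\<dots> = (\<Sum>b'\<in>Basis. (w \<bullet> b') * g p (tangent_part p b) (tangent_part p b'))"
      by (intro sum.cong refl arg_cong2[where f="(*)"] s tangent_part_in p)
    finally show ?thesis .
  qed
  then show ?thesis using *[OF v w] by (simp add: sum_distrib_left)
qed

text \<open>The definition of a smooth metric only tests vector fields on the sphere, whereas charts
  and polar coordinates produce fields along a map \<open>f\<close>. The expansion in projected
  basis vectors separates the two: the coefficients depend smoothly on \<open>x\<close>, and the
  remaining factors are smooth functions on the sphere composed with \<open>f\<close>.\<close>

lemma smooth_on_sphere_metric:
  fixes f :: "'a::real_normed_vector \<Rightarrow> 'b::euclidean_space"
  assumes g: "sphere_metric g" and f: "smooth_on S f" and X: "smooth_on S X" and Y: "smooth_on S Y"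
    and "\<And>x. x \<in> S \<Longrightarrow> norm (f x) = 1"
    and "\<And>x. x \<in> S \<Longrightarrow> X x \<in> sphere_tangent (f x)" "\<And>x. x \<in> S \<Longrightarrow> Y x \<in> sphere_tangent (f x)"
  shows "smooth_on S (\<lambda>x. g (f x) (X x) (Y x))"
proof -
  have T: "smooth_on (sphere 0 1) (\<lambda>p::'b. tangent_part p b)" for b
    by (intro smooth_on_tangent_part smooth_on_id smooth_on_const)
  have "smooth_on (sphere 0 1) (\<lambda>p. g p (tangent_part p b) (tangent_part p b'))" for b b'
    using g T[of b] T[of b'] unfolding sphere_metric_def riemannian_metric_def
    by (auto simp: tangent_part_in)
  then have "smooth_on S (\<lambda>x. g (f x) (tangent_part (f x) b) (tangent_part (f x) b'))" for b b'
    by (rule smooth_on_compose[OF _ f]) (use assms in auto)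
  then have "smooth_on S (\<lambda>x. \<Sum>b\<in>Basis. \<Sum>b'\<in>Basis.
    (X x \<bullet> b) * ((Y x \<bullet> b') * g (f x) (tangent_part (f x) b) (tangent_part (f x) b')))"
    by (intro smooth_on_sum smooth_on_mult smooth_on_inner X Y smooth_on_const)
  then show ?thesis
    by (rule smooth_on_cong) (use assms sphere_metric_frame[OF g] in auto)
qed

section \<open>The deformed metric in polar coordinates\<close>

definition to_polar_deriv :: "'a::real_inner \<Rightarrow> 'a \<Rightarrow> 'a \<times> real"
  where "to_polar_deriv x v = (tangent_part (x /\<^sub>R norm x) v /\<^sub>R norm x, (x /\<^sub>R norm x) \<bullet> v)"

lemma has_derivative_to_polar:
  fixes x :: "'a::real_inner"
  assumes "x \<noteq> 0"
  shows "(to_polar has_derivative to_polar_deriv x) (at x)"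
proof -
  have n: "(norm has_derivative (\<lambda>v. x \<bullet> v / norm x)) (at x)"
    using has_derivative_norm[OF assms] by (simp add: sgn_div_norm inverse_eq_divide inner_commute)
  have "((\<lambda>x. (x /\<^sub>R norm x, norm x)) has_derivative
      (\<lambda>v. (inverse (norm x) *\<^sub>R v + (- (inverse (norm x) * (x \<bullet> v / norm x) * inverse (norm x))) *\<^sub>R x, x \<bullet> v / norm x))) (at x)"
    using assms by (auto intro!: derivative_eq_intros n)
  moreover have "(inverse (norm x) *\<^sub>R v + (- (inverse (norm x) * (x \<bullet> v / norm x) * inverse (norm x))) *\<^sub>R x, x \<bullet> v / norm x)
      = to_polar_deriv x v" for v
    using assms by (simp add: to_polar_deriv_def tangent_part_def scaleR_diff_right field_simps)
  ultimately show ?thesis by (simp add: to_polar_def[abs_def])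
qed

lemma frechet_derivative_to_polar:
  "x \<noteq> 0 \<Longrightarrow> frechet_derivative to_polar (at x) = to_polar_deriv x"
  by (rule frechet_derivative_at[OF has_derivative_to_polar, symmetric])

text \<open>The deformed metric on the cylinder, where its radial form is visible; off the origin
  \<open>warp_deform\<close> is its transport to Euclidean space.\<close>

definition warped_metric ::
    "(real \<Rightarrow> real) \<Rightarrow> real \<Rightarrow> real \<Rightarrow> ('a::real_inner \<Rightarrow> 'a \<Rightarrow> 'a \<Rightarrow> real)
      \<Rightarrow> 'a \<times> real \<Rightarrow> 'a \<times> real \<Rightarrow> 'a \<times> real \<Rightarrow> real"
  where "warped_metric \<rho> a d g =
    radial_metric (\<lambda>t p v w. (sinh t)\<^sup>2 * interpolated_metric \<rho> a d g t p v w)"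

lemma warp_deform_nonzero:
  "x \<noteq> 0 \<Longrightarrow> warp_deform \<rho> a d g x v w =
    warped_metric \<rho> a d g (to_polar x) (to_polar_deriv x v) (to_polar_deriv x w)"
  by (simp add: warp_deform_def warped_metric_def pullback_def frechet_derivative_to_polar)

lemma to_polar_deriv_tangent: "x \<noteq> 0 \<Longrightarrow> to_polar_deriv x v \<in> cylinder_tangent (to_polar x)"
  using subspace_scale[OF subspace_sphere_tangent tangent_part_in[of "x /\<^sub>R norm x" v]]
  by (simp add: to_polar_deriv_def to_polar_def cylinder_tangent_def)

lemma to_polar_in_cylinder: "x \<noteq> 0 \<Longrightarrow> to_polar x \<in> cylinder"
  by (simp add: to_polar_def cylinder_def)

lemma interpolated_metric_convex:
  "interpolated_metric \<rho> a d g t p v w =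
    (1 - \<rho> (2 * ((t - a) / d))) * (v \<bullet> w) + \<rho> (2 * ((t - a) / d)) * g p v w"
  by (simp add: interpolated_metric_def round_metric_def algebra_simps)

lemma inner_product_on_warped_metric:
  fixes g :: "'a::euclidean_space \<Rightarrow> 'a \<Rightarrow> 'a \<Rightarrow> real"
  assumes g: "sphere_metric g" and \<rho>: "\<And>t. \<rho> t \<in> {0..1}" and q: "q \<in> cylinder"
  shows "inner_product_on (cylinder_tangent q) (warped_metric \<rho> a d g q)"
proof -
  obtain p t where pt: "q = (p, t)" "norm p = 1" "t > 0" using q by (cases q) (auto simp: cylinder_def)
  define r where "r = \<rho> (2 * ((t - a) / d))"
  define C where "C = (\<lambda>v w. (1 - r) * round_metric p v w + r * g p v w)"
  have C: "inner_product_on (sphere_tangent p) C"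
    unfolding C_def using \<rho>[of "2 * ((t - a) / d)"]
    by (intro inner_product_on_convex sphere_metric_inner_product sphere_metric_round g pt(2))
       (auto simp: r_def)
  have W: "warped_metric \<rho> a d g q X Y = (sinh t)\<^sup>2 * C (fst X) (fst Y) + snd X * snd Y" for X Y
    by (simp add: warped_metric_def radial_metric_def pt interpolated_metric_convex r_def C_def round_metric_def)
  have T: "X \<in> cylinder_tangent q \<longleftrightarrow> fst X \<in> sphere_tangent p" for X
    by (cases X) (simp add: cylinder_tangent_def pt)
  show ?thesis
    unfolding inner_product_on_def
  proof (intro conjI ballI allI impI)
    fix X Y Z :: "'a \<times> real" and c e :: real
    assume "X \<in> cylinder_tangent q" "Y \<in> cylinder_tangent q" "Z \<in> cylinder_tangent q"
    then have "C (c *\<^sub>R fst X + e *\<^sub>R fst Y) (fst Z) = c * C (fst X) (fst Z) + e * C (fst Y) (fst Z)"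
      unfolding T by (rule inner_product_onD(1)[OF C])
    then show "warped_metric \<rho> a d g q (c *\<^sub>R X + e *\<^sub>R Y) Z
        = c * warped_metric \<rho> a d g q X Z + e * warped_metric \<rho> a d g q Y Z"
      by (simp add: W algebra_simps)
  next
    fix X Y assume "X \<in> cylinder_tangent q" "Y \<in> cylinder_tangent q"
    then have "C (fst X) (fst Y) = C (fst Y) (fst X)"
      unfolding T using inner_product_onD(2)[OF C] by blast
    then show "warped_metric \<rho> a d g q X Y = warped_metric \<rho> a d g q Y X"
      by (simp add: W mult.commute)
  next
    fix X assume X: "X \<in> cylinder_tangent q" "X \<noteq> 0"
    then have F: "fst X \<in> sphere_tangent p" by (simp add: T)
    show "warped_metric \<rho> a d g q X X > 0"
    proof (cases "fst X = 0")
      case True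
      then have "C (fst X) (fst X) = 0" using inner_product_onD(1)[OF C F F F, of 0 0] by simp
      moreover have "snd X \<noteq> 0" using True X by (metis prod.collapse zero_prod_def)
      ultimately show ?thesis by (auto simp: W zero_less_mult_iff linorder_neq_iff)
    next
      case False
      then have "C (fst X) (fst X) > 0" by (rule inner_product_onD(3)[OF C F F F])
      then have "(sinh t)\<^sup>2 * C (fst X) (fst X) > 0" using pt by simp
      then show ?thesis by (simp add: W add_pos_nonneg)
    qed
  qed
qed

lemma linear_to_polar_deriv: "linear (to_polar_deriv x)"
  unfolding to_polar_deriv_def tangent_part_def
  by (rule linearI) (auto simp: inner_add_right algebra_simps)

lemma to_polar_deriv_eq_0: "x \<noteq> 0 \<Longrightarrow> to_polar_deriv x v = 0 \<Longrightarrow> v = 0"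
  by (auto simp: to_polar_deriv_def tangent_part_def zero_prod_def)

text \<open>Off the origin the derivative of \<open>to_polar\<close> is linear, injective and takes
  values in the tangent spaces of the cylinder, so it carries positivity over.\<close>

lemma inner_product_on_warp_deform:
  fixes g :: "'a::euclidean_space \<Rightarrow> 'a \<Rightarrow> 'a \<Rightarrow> real"
  assumes g: "sphere_metric g" and \<rho>: "\<And>t. \<rho> t \<in> {0..1}"
  shows "inner_product_on UNIV (warp_deform \<rho> a d g x)"
proof (cases "x = 0")
  case True
  then show ?thesis by (auto simp: inner_product_on_def warp_deform_def inner_add_left inner_add_right inner_commute)
next
  case False
  note B = inner_product_on_warped_metric[OF g _ to_polar_in_cylinder[OF False], of \<rho> a d]
  note t = to_polar_deriv_tangent[OF False]
  interpret linear "to_polar_deriv x" by (rule linear_to_polar_deriv)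
  show ?thesis
    unfolding inner_product_on_def warp_deform_nonzero[OF False]
    using inner_product_onD[OF B[OF \<rho>] t t t] to_polar_deriv_eq_0[OF False]
    by (auto simp: add scaleR) blast
qed

text \<open>The two changes of coordinates cancel, but only on tangent vectors:
  \<open>from_polar\<close> is differentiated on the ambient product, and a component of
  \<open>fst X\<close> along \<open>p\<close> would be mistaken for radial motion.\<close>

lemma warp_deform_from_polar:
  fixes g :: "'a::euclidean_space \<Rightarrow> 'a \<Rightarrow> 'a \<Rightarrow> real"
  assumes q: "q \<in> cylinder" and X: "X \<in> cylinder_tangent q" and Y: "Y \<in> cylinder_tangent q"
  shows "pullback from_polar (warp_deform \<rho> a d g) q X Y = warped_metric \<rho> a d g q X Y"
proof -
  obtain p t where pt: "q = (p, t)" "norm p = 1" "t > 0" using q by (cases q) (auto simp: cylinder_def)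
  have "(from_polar has_derivative (\<lambda>X. t *\<^sub>R fst X + snd X *\<^sub>R p)) (at q)"
    unfolding from_polar_def[abs_def] pt by (auto intro!: derivative_eq_intros)
  then have D: "frechet_derivative from_polar (at q) = (\<lambda>X. t *\<^sub>R fst X + snd X *\<^sub>R p)"
    by (rule frechet_derivative_at[symmetric])
  have f: "from_polar q = t *\<^sub>R p" "t *\<^sub>R p \<noteq> 0" "to_polar (t *\<^sub>R p) = q"
    using pt by (auto simp: from_polar_def to_polar_def)
  have "to_polar_deriv (t *\<^sub>R p) (t *\<^sub>R fst X + snd X *\<^sub>R p) = X" if "X \<in> cylinder_tangent q" for X
  proof -
    have "p \<bullet> fst X = 0" "p \<bullet> p = 1"
      using that pt by (auto simp: cylinder_tangent_def sphere_tangent_def dot_square_norm)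
    then show ?thesis using pt
      by (cases X) (simp add: to_polar_deriv_def tangent_part_def inner_add_right algebra_simps)
  qed
  then show ?thesis
    using X Y by (simp only: pullback_def D f(1,3) warp_deform_nonzero[OF f(2)])
qed

text \<open>Near the origin the metric is a smooth combination of \<open>v \<bullet> w\<close> and \<open>(x \<bullet> v) * (x \<bullet> w)\<close>, because
  \<open>sinh\<^sup>2 t / t\<^sup>2\<close> and \<open>(1 - sinh\<^sup>2 t / t\<^sup>2) / t\<^sup>2\<close> are power series in \<open>t\<^sup>2\<close>.\<close>

lemma sinh_square_power_series:
  obtains F G :: "real \<Rightarrow> real" where "smooth_on UNIV F" "smooth_on UNIV G"
    "\<And>t. (sinh t)\<^sup>2 = t\<^sup>2 * F (t\<^sup>2)" "\<And>s. F s = 1 - s * G s"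
proof -
  \<comment> \<open>These are the coefficients of \<open>cosh (2 * t)\<close> in powers of
    \<open>t\<^sup>2\<close>; the square of \<open>sinh t\<close> is half of
    \<open>cosh (2 * t) - 1\<close>.\<close>
  define c :: "nat \<Rightarrow> real" where "c n = 4 ^ n / fact (2 * n)" for n
  have sums: "(\<lambda>n. c n * (t\<^sup>2) ^ n) sums cosh (2 * t)" for t :: real
  proof -
    have "(\<lambda>n. if even n then (2 * t) ^ n /\<^sub>R fact n else 0) sums cosh (2 * t)"
      by (rule cosh_converges)
    then have "(\<lambda>n. (\<lambda>n. if even n then (2 * t) ^ n /\<^sub>R fact n else 0) (2 * n)) sums cosh (2 * t)"
      by (subst sums_mono_reindex[of "\<lambda>n. 2 * n"]) (auto simp: strict_mono_def elim!: evenE)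
    moreover have "(2 * t) ^ (2 * n) /\<^sub>R fact (2 * n) = c n * (t\<^sup>2) ^ n" for n
      by (simp add: c_def power_mult power_mult_distrib divide_inverse)
    ultimately show ?thesis by simp
  qed
  \<comment> \<open>The expansion is known only at squares, that is, at nonnegative arguments. As
    the coefficients are positive, evaluating at \<open>\<bar>x\<bar>\<close> gives absolute
    convergence at every real \<open>x\<close>.\<close>
  have abs: "summable (\<lambda>n. \<bar>c n * x ^ n\<bar>)" for x
  proof -
    have "summable (\<lambda>n. c n * ((sqrt \<bar>x\<bar>)\<^sup>2) ^ n)" using sums sums_summable by blast
    then show ?thesis by (simp add: abs_mult power_abs c_def)
  qed
  have c1: "summable (\<lambda>n. c n * x ^ n)" for x
    using abs by (rule summable_rabs_cancel)
  have shift: "summable (\<lambda>n. f (Suc n) * x ^ n)" if "\<And>x. summable (\<lambda>n. f n * x ^ n)" for f :: "nat \<Rightarrow> real" and x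
  proof (cases "x = 0")
    case False
    have "summable (\<lambda>n. inverse x * (f (Suc n) * x ^ Suc n))"
      by (intro summable_mult) (use that[of x] in \<open>subst (asm) summable_Suc_iff[symmetric]\<close>)
    then show ?thesis using False by (simp add: field_simps)
  qed (auto intro: summable_comparison_test)
  \<comment> \<open>\<open>F\<close> drops the constant term of the series, divides by the variable
    and halves; \<open>F 0 = 1\<close> because \<open>c 1 = 2\<close>. \<open>G\<close> repeats the
    shift once more, with the sign that makes \<open>F s = 1 - s * G s\<close>.\<close>
  define F where "F s = (\<Sum>n. c (Suc n) * s ^ n) / 2" for s
  define G where "G s = - (\<Sum>n. c (Suc (Suc n)) * s ^ n) / 2" for s
  have c2: "summable (\<lambda>n. c (Suc n) * x ^ n)" for x using shift[of c] c1 by blast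
  have c3: "summable (\<lambda>n. c (Suc (Suc n)) * x ^ n)" for x using shift[of "\<lambda>n. c (Suc n)"] c2 by blast
  have split: "(\<Sum>n. f n * s ^ n) = f 0 + s * (\<Sum>n. f (Suc n) * s ^ n)"
    if "\<And>x. summable (\<lambda>n. f n * x ^ n)" for f :: "nat \<Rightarrow> real" and s
  proof -
    have "(\<Sum>n. f n * s ^ n) = f 0 + (\<Sum>n. f (Suc n) * s ^ Suc n)"
      using suminf_split_head[OF that[of s]] by simp
    also have "(\<Sum>n. f (Suc n) * s ^ Suc n) = s * (\<Sum>n. f (Suc n) * s ^ n)"
      by (subst suminf_mult[OF shift[OF that], symmetric]) (simp add: mult_ac)
    finally show ?thesis .
  qed
  show ?thesis
  proof
    have "smooth_on UNIV (\<lambda>s. (1/2) * (\<Sum>n. c (Suc n) * s ^ n))"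
      by (intro smooth_on_mult smooth_on_const smooth_on_power_series c2)
    then show "smooth_on UNIV F" by (simp add: F_def[abs_def])
    have "smooth_on UNIV (\<lambda>s. (- 1/2) * (\<Sum>n. c (Suc (Suc n)) * s ^ n))"
      by (intro smooth_on_mult smooth_on_const smooth_on_power_series c3)
    then show "smooth_on UNIV G" by (simp add: G_def[abs_def])
    show "F s = 1 - s * G s" for s
      unfolding F_def G_def by (subst split[OF c2]) (simp add: c_def field_simps)
    show "(sinh t)\<^sup>2 = t\<^sup>2 * F (t\<^sup>2)" for t
    proof -
      have "cosh (2 * t) = 1 + t\<^sup>2 * (\<Sum>n. c (Suc n) * (t\<^sup>2) ^ n)"
        using sums_unique[OF sums[of t]] split[OF c1, of "t\<^sup>2"] by (simp add: c_def)
      moreover have "cosh (2 * t) = 1 + 2 * (sinh t)\<^sup>2"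
        by (simp add: cosh_double cosh_square_eq)
      ultimately show ?thesis by (simp add: F_def)
    qed
  qed
qed

text \<open>Two open sets cover the space. Off the origin all ingredients of the polar formula are
  smooth. On the ball of radius \<open>a\<close> the cutoff vanishes, so that \<open>g\<close>
  disappears and the power series expression, which is smooth across the origin, is
  available.\<close>

lemma riemannian_metric_warp_deform:
  fixes g :: "'a::euclidean_space \<Rightarrow> 'a \<Rightarrow> 'a \<Rightarrow> real"
  assumes g: "sphere_metric g" and c: "cutoff_function \<rho>" and a: "a > 0" and d: "d > 0"
  shows "riemannian_metric UNIV (\<lambda>_. UNIV) (warp_deform \<rho> a d g)"
proof -
  have \<rho>: "\<rho> t \<in> {0..1}" "t \<le> 0 \<Longrightarrow> \<rho> t = 0" "smooth_on UNIV \<rho>" for t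
    using c by (auto simp: cutoff_function_def)
  have "smooth_on UNIV (\<lambda>x. warp_deform \<rho> a d g x (X x) (Y x))"
    if XY: "smooth_on UNIV X" "smooth_on UNIV Y" for X Y :: "'a \<Rightarrow> 'a"
  proof (rule smooth_on_local)
    have sX: "smooth_on S X" "smooth_on S Y" for S using XY smooth_on_subset by blast+
    fix p :: 'a
    show "\<exists>W. open W \<and> p \<in> W \<and> smooth_on (UNIV \<inter> W) (\<lambda>x. warp_deform \<rho> a d g x (X x) (Y x))"
    proof (cases "p = 0")
      case False
      have n: "smooth_on (- {0::'a}) norm" by (rule smooth_on_norm)
      have i: "smooth_on (- {0::'a}) (\<lambda>x. inverse (norm x))"
        by (rule smooth_on_compose[OF smooth_on_inverse n]) auto
      have u: "smooth_on (- {0::'a}) (\<lambda>x. x /\<^sub>R norm x)"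
        by (intro smooth_on_scaleR i smooth_on_id)
      have T: "smooth_on (- {0::'a}) (\<lambda>x. tangent_part (x /\<^sub>R norm x) (Z x) /\<^sub>R norm x)"
        if "smooth_on (- {0}) Z" for Z
        by (intro smooth_on_scaleR i smooth_on_tangent_part u that)
      have in_T: "tangent_part (x /\<^sub>R norm x) v /\<^sub>R norm x \<in> sphere_tangent (x /\<^sub>R norm x)" if "x \<in> - {0}" for x v :: 'a
        using that by (intro subspace_scale[OF subspace_sphere_tangent] tangent_part_in) auto
      have G: "smooth_on (- {0::'a}) (\<lambda>x. g (x /\<^sub>R norm x) (tangent_part (x /\<^sub>R norm x) (X x) /\<^sub>R norm x) (tangent_part (x /\<^sub>R norm x) (Y x) /\<^sub>R norm x))"
        by (rule smooth_on_sphere_metric[OF g u T[OF sX(1)] T[OF sX(2)]]) (use in_T in auto)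
      have R: "smooth_on (- {0::'a}) (\<lambda>x. \<rho> (2 * ((norm x - a) * inverse d)))"
        by (intro smooth_on_compose[OF \<rho>(3)] smooth_on_mult smooth_on_diff n smooth_on_const) auto
      have S: "smooth_on (- {0::'a}) (\<lambda>x. sinh (norm x))"
        by (rule smooth_on_compose[OF smooth_on_sinh[of UNIV] n]) auto
      have "smooth_on (- {0::'a}) (\<lambda>x. (sinh (norm x) * sinh (norm x)) *
         ((1 - \<rho> (2 * ((norm x - a) * inverse d))) * ((tangent_part (x /\<^sub>R norm x) (X x) /\<^sub>R norm x) \<bullet> (tangent_part (x /\<^sub>R norm x) (Y x) /\<^sub>R norm x))
          + \<rho> (2 * ((norm x - a) * inverse d)) * g (x /\<^sub>R norm x) (tangent_part (x /\<^sub>R norm x) (X x) /\<^sub>R norm x) (tangent_part (x /\<^sub>R norm x) (Y x) /\<^sub>R norm x))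
         + ((x /\<^sub>R norm x) \<bullet> X x) * ((x /\<^sub>R norm x) \<bullet> Y x))"
        by (intro smooth_on_add smooth_on_mult S smooth_on_diff smooth_on_const R G smooth_on_inner u T sX)
      then have "smooth_on (- {0}) (\<lambda>x. warp_deform \<rho> a d g x (X x) (Y x))"
        by (rule smooth_on_cong)
           (simp add: warp_deform_nonzero warped_metric_def radial_metric_def to_polar_deriv_def
             to_polar_def interpolated_metric_convex divide_inverse power2_eq_square)
      then show ?thesis using False by (intro exI[of _ "- {0}"]) auto
    next
      case True
      obtain F G :: "real \<Rightarrow> real" where FG: "smooth_on UNIV F" "smooth_on UNIV G"
        "\<And>t. (sinh t)\<^sup>2 = t\<^sup>2 * F (t\<^sup>2)" "\<And>s. F s = 1 - s * G s"
        by (rule sinh_square_power_series) blast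
      have xx: "smooth_on S (\<lambda>x::'a. x \<bullet> x)" for S by (intro smooth_on_inner smooth_on_id)
      have "smooth_on (ball 0 a) (\<lambda>x. F (x \<bullet> x) * (X x \<bullet> Y x) + G (x \<bullet> x) * ((x \<bullet> X x) * (x \<bullet> Y x)))"
        by (intro smooth_on_add smooth_on_mult smooth_on_inner smooth_on_id sX
            smooth_on_compose[OF FG(1) xx] smooth_on_compose[OF FG(2) xx]) auto
      then have "smooth_on (ball 0 a) (\<lambda>x. warp_deform \<rho> a d g x (X x) (Y x))"
      proof (rule smooth_on_cong)
        fix x :: 'a assume x: "x \<in> ball 0 a"
        show "F (x \<bullet> x) * (X x \<bullet> Y x) + G (x \<bullet> x) * ((x \<bullet> X x) * (x \<bullet> Y x)) = warp_deform \<rho> a d g x (X x) (Y x)"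
        proof (cases "x = 0")
          case False
          define t where "t = norm x"
          have t: "t > 0" "t < a" using False x by (auto simp: t_def)
          have xx: "x \<bullet> x = t\<^sup>2" by (simp add: t_def dot_square_norm)
          have r: "\<rho> (2 * ((t - a) / d)) = 0" using t d by (intro \<rho>(2)) (simp add: field_simps)
          have "warp_deform \<rho> a d g x (X x) (Y x) = (sinh t)\<^sup>2 *
            ((tangent_part (x /\<^sub>R t) (X x) /\<^sub>R t) \<bullet> (tangent_part (x /\<^sub>R t) (Y x) /\<^sub>R t)) + ((x /\<^sub>R t) \<bullet> X x) * ((x /\<^sub>R t) \<bullet> Y x)"
            using False r by (simp add: warp_deform_nonzero warped_metric_def radial_metric_def to_polar_deriv_def
             to_polar_def interpolated_metric_convex flip: t_def)
          also have "(tangent_part (x /\<^sub>R t) (X x) /\<^sub>R t) \<bullet> (tangent_part (x /\<^sub>R t) (Y x) /\<^sub>R t)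
              = (X x \<bullet> Y x - (x \<bullet> X x) * (x \<bullet> Y x) / t\<^sup>2) / t\<^sup>2"
            using t by (simp add: tangent_part_def inner_diff_left inner_diff_right xx
                inner_commute[of "X x" x] inner_commute[of "Y x" x] field_simps power2_eq_square)
          also have "(sinh t)\<^sup>2 * \<dots> + ((x /\<^sub>R t) \<bullet> X x) * ((x /\<^sub>R t) \<bullet> Y x)
              = F (t\<^sup>2) * (X x \<bullet> Y x) + G (t\<^sup>2) * ((x \<bullet> X x) * (x \<bullet> Y x))"
            using t unfolding FG(3) FG(4) by (simp add: field_simps power2_eq_square)
          finally show ?thesis by (simp add: xx)
        qed (simp add: warp_deform_def FG(4))
      qed
      then show ?thesis using True a by (intro exI[of _ "ball 0 a"]) auto
    qed
  qed
  then show ?thesis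
    unfolding riemannian_metric_def using inner_product_on_warp_deform[OF g \<rho>(1)] by auto
qed

section \<open>Uniform bounds\<close>

text \<open>Derivatives are bounded as linear and bilinear maps rather than entry by entry, which
  behaves well under composition with linear maps. Leaving them existential lets each rule supply
  its own formula. Conversion from and to partial derivatives happens only at the beginning and the
  end of the estimates.\<close>

definition C2_bounded :: "real \<Rightarrow> ('a::real_normed_vector \<Rightarrow> real) \<Rightarrow> 'a set \<Rightarrow> bool"
  where "C2_bounded K f U \<longleftrightarrow> (\<exists>f' f''. \<forall>x\<in>U.
    (f has_derivative f' x) (at x) \<and> (\<forall>v. ((\<lambda>y. f' y v) has_derivative f'' x v) (at x)) \<and>
    \<bar>f x\<bar> \<le> K \<and> (\<forall>v. \<bar>f' x v\<bar> \<le> K * norm v) \<and> (\<forall>v w. \<bar>f'' x v w\<bar> \<le> K * norm v * norm w))"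

lemma C2_boundedI:
  assumes "\<And>x. x \<in> U \<Longrightarrow> (f has_derivative f' x) (at x)"
    and "\<And>x v. x \<in> U \<Longrightarrow> ((\<lambda>y. f' y v) has_derivative f'' x v) (at x)"
    and "\<And>x. x \<in> U \<Longrightarrow> \<bar>f x\<bar> \<le> K" "\<And>x v. x \<in> U \<Longrightarrow> \<bar>f' x v\<bar> \<le> K * norm v"
    and "\<And>x v w. x \<in> U \<Longrightarrow> \<bar>f'' x v w\<bar> \<le> K * norm v * norm w"
  shows "C2_bounded K f U"
  unfolding C2_bounded_def using assms by (intro exI[of _ f'] exI[of _ f'']) simp

lemma C2_boundedE:
  assumes "C2_bounded K f U"
  obtains f' f'' where "\<And>x. x \<in> U \<Longrightarrow> (f has_derivative f' x) (at x)"
    "\<And>x v. x \<in> U \<Longrightarrow> ((\<lambda>y. f' y v) has_derivative f'' x v) (at x)"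
    "\<And>x. x \<in> U \<Longrightarrow> \<bar>f x\<bar> \<le> K" "\<And>x v. x \<in> U \<Longrightarrow> \<bar>f' x v\<bar> \<le> K * norm v"
    "\<And>x v w. x \<in> U \<Longrightarrow> \<bar>f'' x v w\<bar> \<le> K * norm v * norm w"
proof -
  from assms obtain f' f'' where "\<forall>x\<in>U.
    (f has_derivative f' x) (at x) \<and> (\<forall>v. ((\<lambda>y. f' y v) has_derivative f'' x v) (at x)) \<and>
    \<bar>f x\<bar> \<le> K \<and> (\<forall>v. \<bar>f' x v\<bar> \<le> K * norm v) \<and> (\<forall>v w. \<bar>f'' x v w\<bar> \<le> K * norm v * norm w)"
    unfolding C2_bounded_def by (elim exE)
  then show ?thesis by (intro that[of f' f'']) simp_all
qed

lemma C2_bounded_subset: "C2_bounded K f U \<Longrightarrow> V \<subseteq> U \<Longrightarrow> C2_bounded K f V"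
  unfolding C2_bounded_def by (meson subset_iff)

lemma C2_bounded_mono:
  assumes "C2_bounded K f U" "K \<le> K'"
  shows "C2_bounded K' f U"
proof (rule C2_boundedE[OF assms(1)])
  fix f' f''
  assume *: "\<And>x. x \<in> U \<Longrightarrow> (f has_derivative f' x) (at x)"
    "\<And>x v. x \<in> U \<Longrightarrow> ((\<lambda>y. f' y v) has_derivative f'' x v) (at x)"
    "\<And>x. x \<in> U \<Longrightarrow> \<bar>f x\<bar> \<le> K" "\<And>x v. x \<in> U \<Longrightarrow> \<bar>f' x v\<bar> \<le> K * norm v"
    "\<And>x v w. x \<in> U \<Longrightarrow> \<bar>f'' x v w\<bar> \<le> K * norm v * norm w"
  show ?thesis
  proof (rule C2_boundedI[OF *(1,2)])
    fix x v w :: 'a assume x: "x \<in> U"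
    show "\<bar>f x\<bar> \<le> K'" using *(3)[OF x] assms(2) by simp
    have "K * norm v \<le> K' * norm v" using assms(2) by (intro mult_right_mono) auto
    then show "\<bar>f' x v\<bar> \<le> K' * norm v" using *(4)[OF x, of v] by linarith
    have "K * norm v * norm w \<le> K' * norm v * norm w" using assms(2) by (intro mult_right_mono) auto
    then show "\<bar>f'' x v w\<bar> \<le> K' * norm v * norm w" using *(5)[OF x, of v w] by linarith
  qed
qed

lemma C2_bounded_cong:
  assumes "C2_bounded K f U" "open U" "\<And>x. x \<in> U \<Longrightarrow> f x = g x"
  shows "C2_bounded K g U"
proof (rule C2_boundedE[OF assms(1)])
  fix f' f''
  assume *: "\<And>x. x \<in> U \<Longrightarrow> (f has_derivative f' x) (at x)"
    "\<And>x v. x \<in> U \<Longrightarrow> ((\<lambda>y. f' y v) has_derivative f'' x v) (at x)"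
    "\<And>x. x \<in> U \<Longrightarrow> \<bar>f x\<bar> \<le> K" "\<And>x v. x \<in> U \<Longrightarrow> \<bar>f' x v\<bar> \<le> K * norm v"
    "\<And>x v w. x \<in> U \<Longrightarrow> \<bar>f'' x v w\<bar> \<le> K * norm v * norm w"
  show ?thesis
  proof (rule C2_boundedI[OF has_derivative_transform_within_open[OF *(1) assms(2)] *(2)])
    show "\<bar>g x\<bar> \<le> K" if "x \<in> U" for x using *(3)[OF that] assms(3)[OF that] by simp
  qed (use * assms(3) in auto)
qed

lemma C2_bounded_const: "\<bar>c\<bar> \<le> K \<Longrightarrow> C2_bounded K (\<lambda>_. c) U"
  by (rule C2_boundedI[where f'="\<lambda>_ _. 0" and f''="\<lambda>_ _ _. 0"]) auto

lemma C2_bounded_add: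
  assumes "C2_bounded K f U" "C2_bounded M g U"
  shows "C2_bounded (K + M) (\<lambda>x. f x + g x) U"
proof (rule C2_boundedE[OF assms(1)], rule C2_boundedE[OF assms(2)])
  fix f' f'' g' g''
  assume f: "\<And>x. x \<in> U \<Longrightarrow> (f has_derivative f' x) (at x)"
    "\<And>x v. x \<in> U \<Longrightarrow> ((\<lambda>y. f' y v) has_derivative f'' x v) (at x)"
    "\<And>x. x \<in> U \<Longrightarrow> \<bar>f x\<bar> \<le> K" "\<And>x v. x \<in> U \<Longrightarrow> \<bar>f' x v\<bar> \<le> K * norm v"
    "\<And>x v w. x \<in> U \<Longrightarrow> \<bar>f'' x v w\<bar> \<le> K * norm v * norm w"
  assume g: "\<And>x. x \<in> U \<Longrightarrow> (g has_derivative g' x) (at x)"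
    "\<And>x v. x \<in> U \<Longrightarrow> ((\<lambda>y. g' y v) has_derivative g'' x v) (at x)"
    "\<And>x. x \<in> U \<Longrightarrow> \<bar>g x\<bar> \<le> M" "\<And>x v. x \<in> U \<Longrightarrow> \<bar>g' x v\<bar> \<le> M * norm v"
    "\<And>x v w. x \<in> U \<Longrightarrow> \<bar>g'' x v w\<bar> \<le> M * norm v * norm w"
  show ?thesis
  proof (rule C2_boundedI[OF has_derivative_add[OF f(1) g(1)] has_derivative_add[OF f(2) g(2)]])
    fix x v w assume x: "x \<in> U"
    show "\<bar>f x + g x\<bar> \<le> K + M" using f(3)[OF x] g(3)[OF x] by linarith
    show "\<bar>f' x v + g' x v\<bar> \<le> (K + M) * norm v"
      using f(4)[OF x, of v] g(4)[OF x, of v] unfolding distrib_right by linarith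
    show "\<bar>f'' x v w + g'' x v w\<bar> \<le> (K + M) * norm v * norm w"
      using f(5)[OF x, of v w] g(5)[OF x, of v w] unfolding distrib_right by linarith
  qed
qed

text \<open>The factor 4 counts the terms in the second derivative of a product, each at most
  \<open>K * M * norm v * norm w\<close>.\<close>

lemma C2_bounded_mult:
  assumes "C2_bounded K f U" "C2_bounded M g U"
  shows "C2_bounded (4 * K * M) (\<lambda>x. f x * g x) U"
proof (rule C2_boundedE[OF assms(1)], rule C2_boundedE[OF assms(2)])
  fix f' f'' g' g''
  assume f: "\<And>x. x \<in> U \<Longrightarrow> (f has_derivative f' x) (at x)"
    "\<And>x v. x \<in> U \<Longrightarrow> ((\<lambda>y. f' y v) has_derivative f'' x v) (at x)"
    "\<And>x. x \<in> U \<Longrightarrow> \<bar>f x\<bar> \<le> K" "\<And>x v. x \<in> U \<Longrightarrow> \<bar>f' x v\<bar> \<le> K * norm v"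
    "\<And>x v w. x \<in> U \<Longrightarrow> \<bar>f'' x v w\<bar> \<le> K * norm v * norm w"
  assume g: "\<And>x. x \<in> U \<Longrightarrow> (g has_derivative g' x) (at x)"
    "\<And>x v. x \<in> U \<Longrightarrow> ((\<lambda>y. g' y v) has_derivative g'' x v) (at x)"
    "\<And>x. x \<in> U \<Longrightarrow> \<bar>g x\<bar> \<le> M" "\<And>x v. x \<in> U \<Longrightarrow> \<bar>g' x v\<bar> \<le> M * norm v"
    "\<And>x v w. x \<in> U \<Longrightarrow> \<bar>g'' x v w\<bar> \<le> M * norm v * norm w"
  have m: "\<bar>a * b\<bar> \<le> A * B" if "\<bar>a\<bar> \<le> A" "\<bar>b\<bar> \<le> B" for a b A B :: real
    unfolding abs_mult using that by (intro mult_mono) auto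
  show ?thesis
  proof (rule C2_boundedI[where f'="\<lambda>x v. f x * g' x v + f' x v * g x"
        and f''="\<lambda>x v w. (f x * g'' x v w + f' x w * g' x v) + (f' x v * g' x w + f'' x v w * g x)"])
    fix x v w assume x: "x \<in> U"
    show "((\<lambda>x. f x * g x) has_derivative (\<lambda>v. f x * g' x v + f' x v * g x)) (at x)"
      by (intro has_derivative_mult f g x)
    show "((\<lambda>x. f x * g' x v + f' x v * g x) has_derivative
      (\<lambda>w. (f x * g'' x v w + f' x w * g' x v) + (f' x v * g' x w + f'' x v w * g x))) (at x)"
      by (intro has_derivative_add has_derivative_mult f g x)
    have KM: "0 \<le> K" "0 \<le> M" using f(3)[OF x] g(3)[OF x] by auto
    have "\<bar>f x * g x\<bar> \<le> K * M" by (intro m f g x)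
    moreover have "0 \<le> K * M" using KM by simp
    ultimately show "\<bar>f x * g x\<bar> \<le> 4 * K * M" by linarith
    have "\<bar>f x * g' x v\<bar> \<le> K * (M * norm v)" "\<bar>f' x v * g x\<bar> \<le> (K * norm v) * M"
      by (intro m f g x)+
    moreover have "0 \<le> K * (M * norm v)" using KM by simp
    ultimately show "\<bar>f x * g' x v + f' x v * g x\<bar> \<le> 4 * K * M * norm v"
      by (simp add: algebra_simps)
    have "\<bar>f x * g'' x v w\<bar> \<le> K * (M * norm v * norm w)" "\<bar>f' x w * g' x v\<bar> \<le> (K * norm w) * (M * norm v)"
      "\<bar>f' x v * g' x w\<bar> \<le> (K * norm v) * (M * norm w)" "\<bar>f'' x v w * g x\<bar> \<le> (K * norm v * norm w) * M"
      by (intro m f g x)+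
    then show "\<bar>(f x * g'' x v w + f' x w * g' x v) + (f' x v * g' x w + f'' x v w * g x)\<bar> \<le> 4 * K * M * norm v * norm w"
      by (simp add: algebra_simps)
  qed
qed

lemma C2_bounded_cmult:
  assumes "C2_bounded K f U" "\<bar>c\<bar> \<le> M"
  shows "C2_bounded (M * K) (\<lambda>x. c * f x) U"
proof (rule C2_boundedE[OF assms(1)])
  fix f' f''
  assume *: "\<And>x. x \<in> U \<Longrightarrow> (f has_derivative f' x) (at x)"
    "\<And>x v. x \<in> U \<Longrightarrow> ((\<lambda>y. f' y v) has_derivative f'' x v) (at x)"
    "\<And>x. x \<in> U \<Longrightarrow> \<bar>f x\<bar> \<le> K" "\<And>x v. x \<in> U \<Longrightarrow> \<bar>f' x v\<bar> \<le> K * norm v"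
    "\<And>x v w. x \<in> U \<Longrightarrow> \<bar>f'' x v w\<bar> \<le> K * norm v * norm w"
  have m: "\<bar>c * b\<bar> \<le> M * B" if "\<bar>b\<bar> \<le> B" for b B :: real
    unfolding abs_mult using that assms by (intro mult_mono) auto
  show ?thesis
    by (rule C2_boundedI[OF has_derivative_mult_right[OF *(1)] has_derivative_mult_right[OF *(2)]])
       (use m * in \<open>auto simp: mult.assoc\<close>)
qed

lemma C2_bounded_sum:
  assumes "\<And>i. i \<in> I \<Longrightarrow> C2_bounded (K i) (f i) U"
  shows "C2_bounded (\<Sum>i\<in>I. K i) (\<lambda>x. \<Sum>i\<in>I. f i x) U"
  using assms
  by (induction I rule: infinite_finite_induct) (auto intro: C2_bounded_add C2_bounded_const)

lemma C2_bounded_real: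
  fixes f :: "real \<Rightarrow> real"
  assumes "\<And>x. x \<in> U \<Longrightarrow> (f has_real_derivative f' x) (at x)"
    and "\<And>x. x \<in> U \<Longrightarrow> (f' has_real_derivative f'' x) (at x)"
    and "\<And>x. x \<in> U \<Longrightarrow> \<bar>f x\<bar> \<le> K" "\<And>x. x \<in> U \<Longrightarrow> \<bar>f' x\<bar> \<le> K" "\<And>x. x \<in> U \<Longrightarrow> \<bar>f'' x\<bar> \<le> K"
  shows "C2_bounded K f U"
proof (rule C2_boundedI[where f'="\<lambda>x v. f' x * v" and f''="\<lambda>x v w. f'' x * w * v"])
  fix x v w :: real assume x: "x \<in> U"
  show "(f has_derivative (\<lambda>v. f' x * v)) (at x)"
    using assms(1)[OF x] by (simp add: has_field_derivative_def)
  show "((\<lambda>x. f' x * v) has_derivative (\<lambda>w. f'' x * w * v)) (at x)"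
    using assms(2)[OF x] by (intro has_derivative_mult_left) (simp add: has_field_derivative_def)
  show "\<bar>f x\<bar> \<le> K" using assms(3)[OF x] .
  show "\<bar>f' x * v\<bar> \<le> K * norm v"
    unfolding abs_mult real_norm_def using assms(4)[OF x] by (intro mult_right_mono) auto
  have "\<bar>f'' x * w * v\<bar> = \<bar>f'' x\<bar> * norm v * norm w" by (simp add: abs_mult)
  also have "\<dots> \<le> K * norm v * norm w"
    using assms(5)[OF x] by (intro mult_right_mono) auto
  finally show "\<bar>f'' x * w * v\<bar> \<le> K * norm v * norm w" .
qed

text \<open>Every derivative of the composition produces a factor \<open>s\<close>. Once the value
  at the base point is subtracted, the function itself also has this factor, by the mean value
  inequality on a convex subset of the unit ball. The second claim is the source of the decay in
  \<open>exp (- t\<^sub>0)\<close>.\<close>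

lemma C2_bounded_affine:
  assumes "C2_bounded K f V" "bounded_linear L" "\<And>v. norm (L v) \<le> s * norm v" "s \<le> 1"
    and "\<And>y. y \<in> U \<Longrightarrow> p + L y \<in> V"
  shows "C2_bounded K (\<lambda>y. f (p + L y)) U"
    and "convex U \<Longrightarrow> U \<subseteq> ball 0 1 \<Longrightarrow> 0 \<in> U \<Longrightarrow> 0 \<le> s \<Longrightarrow> C2_bounded (K * s) (\<lambda>y. f (p + L y) - f p) U"
proof -
  obtain f' f'' where f: "\<And>x. x \<in> V \<Longrightarrow> (f has_derivative f' x) (at x)"
    "\<And>x v. x \<in> V \<Longrightarrow> ((\<lambda>y. f' y v) has_derivative f'' x v) (at x)"
    "\<And>x. x \<in> V \<Longrightarrow> \<bar>f x\<bar> \<le> K" "\<And>x v. x \<in> V \<Longrightarrow> \<bar>f' x v\<bar> \<le> K * norm v"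
    "\<And>x v w. x \<in> V \<Longrightarrow> \<bar>f'' x v w\<bar> \<le> K * norm v * norm w"
    by (rule C2_boundedE[OF assms(1)]) blast
  have dA: "((\<lambda>y. p + L y) has_derivative L) (at y)" for y
    using has_derivative_add[OF has_derivative_const bounded_linear_imp_has_derivative[OF assms(2)]]
    by simp
  have comp: "((\<lambda>y. h (p + L y)) has_derivative (\<lambda>v. h' (L v))) (at y)"
    if "(h has_derivative h') (at (p + L y))" for h h' y
    using diff_chain_at[OF dA that] by (simp add: o_def)
  have d1: "((\<lambda>y. f (p + L y)) has_derivative (\<lambda>v. f' (p + L y) (L v))) (at y)" if "y \<in> U" for y
    by (intro comp f assms that)
  have d2: "((\<lambda>y. f' (p + L y) (L v)) has_derivative (\<lambda>w. f'' (p + L y) (L v) (L w))) (at y)" if "y \<in> U" for y v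
    by (rule comp[of "\<lambda>y. f' y (L v)"]) (intro f assms that)
  have K: "K \<ge> 0" if "y \<in> U" for y using f(3)[OF assms(5)[OF that]] by linarith
  have b1: "\<bar>f' (p + L y) (L v)\<bar> \<le> K * s * norm v" if "y \<in> U" for y v
  proof -
    have "\<bar>f' (p + L y) (L v)\<bar> \<le> K * norm (L v)" by (intro f assms that)
    also have "\<dots> \<le> K * (s * norm v)" using K[OF that] assms(3) by (intro mult_left_mono)
    finally show ?thesis by simp
  qed
  have b2: "\<bar>f'' (p + L y) (L v) (L w)\<bar> \<le> K * s * norm v * norm w" if "y \<in> U" for y v w
  proof -
    have "\<bar>f'' (p + L y) (L v) (L w)\<bar> \<le> K * norm (L v) * norm (L w)" by (intro f assms that)
    \<comment> \<open>Only one of the two factors \<open>s\<close> is kept, so that all three bounds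
      share the constant \<open>K * s\<close>.\<close>
    also have "\<dots> \<le> K * (s * norm v) * (1 * norm w)"
    proof (intro mult_mono)
      show "norm (L w) \<le> 1 * norm w"
        using assms(3)[of w] assms(4) mult_right_mono[of s 1 "norm w"] by simp
      \<comment> \<open>The sign of \<open>s\<close> is not assumed at this point;
        \<open>s * norm v\<close> is nonnegative because it dominates
        \<open>norm (L v)\<close>.\<close>
      show "0 \<le> K * (s * norm v)"
        using K[OF that] assms(3)[of v] by (metis mult_nonneg_nonneg norm_ge_zero order_trans)
    qed (use K[OF that] assms(3) in auto)
    finally show ?thesis by (simp add: mult_ac)
  qed
  have le: "K * s * norm v \<le> K * norm v" if "y \<in> U" for y and v :: 'b
  proof -
    have "K * s \<le> K * 1" using K[OF that] assms(4) by (intro mult_left_mono)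
    then show ?thesis by (intro mult_right_mono) auto
  qed
  show "C2_bounded K (\<lambda>y. f (p + L y)) U"
  proof (rule C2_boundedI[OF d1 d2])
    fix y v w assume y: "y \<in> U"
    show "\<bar>f (p + L y)\<bar> \<le> K" by (intro f assms y)
    show "\<bar>f' (p + L y) (L v)\<bar> \<le> K * norm v" using b1[OF y, of v] le[OF y, of v] by linarith
    show "\<bar>f'' (p + L y) (L v) (L w)\<bar> \<le> K * norm v * norm w"
      using b2[OF y, of v w] mult_right_mono[OF le[OF y, of v], of "norm w"] by simp
  qed
  assume U: "convex U" "U \<subseteq> ball 0 1" "0 \<in> U" "0 \<le> s"
  have d1': "((\<lambda>y. f (p + L y) - f p) has_derivative (\<lambda>v. f' (p + L y) (L v))) (at y)" if "y \<in> U" for y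
    using has_derivative_diff[OF d1[OF that] has_derivative_const[of "f p"]] by simp
  show "C2_bounded (K * s) (\<lambda>y. f (p + L y) - f p) U"
  proof (rule C2_boundedI[OF d1' d2])
    fix y v w assume y: "y \<in> U"
    have "norm (f (p + L y) - f (p + L 0)) \<le> (K * s) * norm (y - 0)"
    proof (rule differentiable_bound[OF U(1) _ _ y U(3)])
      show "((\<lambda>y. f (p + L y)) has_derivative (\<lambda>v. f' (p + L z) (L v))) (at z within U)" if "z \<in> U" for z
        using d1[OF that] by (rule has_derivative_at_withinI)
      show "onorm (\<lambda>v. f' (p + L z) (L v)) \<le> K * s" if "z \<in> U" for z
        using b1[OF that] K[OF that] U(4) by (intro onorm_bound) auto
    qed
    also have "\<dots> \<le> (K * s) * 1"
      using y U K[OF y] by (intro mult_left_mono) (auto simp: subset_iff less_imp_le)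
    finally show "\<bar>f (p + L y) - f p\<bar> \<le> K * s"
      using bounded_linear.linear[OF assms(2), THEN linear_0] by simp
    show "\<bar>f' (p + L y) (L v)\<bar> \<le> K * s * norm v" by (rule b1[OF y])
    show "\<bar>f'' (p + L y) (L v) (L w)\<bar> \<le> K * s * norm v * norm w" by (rule b2[OF y])
  qed
qed

lemma C2_bounded_fst: "C2_bounded K f U \<Longrightarrow> C2_bounded K (\<lambda>z. f (fst z)) (U \<times> T)"
  using C2_bounded_affine(1)[OF _ bounded_linear_fst, of K f U 1 "U \<times> T" 0]
  by (auto simp: norm_fst_le)

lemma C2_bounded_snd: "C2_bounded K f T \<Longrightarrow> C2_bounded K (\<lambda>z. f (snd z)) (U \<times> T)"
  using C2_bounded_affine(1)[OF _ bounded_linear_snd, of K f T 1 "U \<times> T" 0]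
  by (auto simp: norm_snd_le)

section \<open>Comparison with partial derivatives\<close>

lemma iter_partial_le2_cases:
  assumes "length bs \<le> 2"
  obtains "bs = []" | b where "bs = [b]" | b b' where "bs = [b, b']"
  using assms by (cases bs; cases "tl bs") (auto simp: le_Suc_eq numeral_2_eq_2)

lemma C2_norm_le:
  fixes h :: "'a::euclidean_space \<Rightarrow> 'a \<Rightarrow> 'a \<Rightarrow> real"
  assumes "open U" and h: "\<And>i j. i \<in> Basis \<Longrightarrow> j \<in> Basis \<Longrightarrow> C2_bounded K (\<lambda>y. h y i j) U"
  shows "C2_norm U h \<le> ereal K"
  unfolding C2_norm_def
proof (rule SUP_least, clarify)
  fix i j x :: 'a and bs :: "'a list" assume ij: "i \<in> Basis" "j \<in> Basis" and bs: "set bs \<subseteq> Basis" "length bs \<le> 2" and x: "x \<in> U"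
  obtain f' f'' where f: "\<And>x. x \<in> U \<Longrightarrow> ((\<lambda>y. h y i j) has_derivative f' x) (at x)"
    "\<And>x v. x \<in> U \<Longrightarrow> ((\<lambda>y. f' y v) has_derivative f'' x v) (at x)"
    "\<And>x. x \<in> U \<Longrightarrow> \<bar>h x i j\<bar> \<le> K" "\<And>x v. x \<in> U \<Longrightarrow> \<bar>f' x v\<bar> \<le> K * norm v"
    "\<And>x v w. x \<in> U \<Longrightarrow> \<bar>f'' x v w\<bar> \<le> K * norm v * norm w"
    by (rule C2_boundedE[OF h[OF ij]]) blast
  have f': "frechet_derivative (\<lambda>y. h y i j) (at y) = f' y" if "y \<in> U" for y
    by (rule frechet_derivative_at[symmetric]) (rule f(1)[OF that])
  have f'': "frechet_derivative (\<lambda>y. frechet_derivative (\<lambda>y. h y i j) (at y) v) (at x) = f'' x v" for v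
    by (rule frechet_derivative_at[symmetric])
       (rule has_derivative_transform_within_open[OF f(2)[OF x] assms(1) x], simp add: f')
  show "ereal \<bar>iter_partial bs (\<lambda>y. h y i j) x\<bar> \<le> ereal K"
    using bs(2)
  proof (cases rule: iter_partial_le2_cases)
    case 1
    then show ?thesis using f(3)[OF x] by simp
  next
    case (2 b)
    then show ?thesis using f(4)[OF x, of b] bs f'[OF x] by simp
  next
    case (3 b b')
    \<comment> \<open>The head of the list is the outermost derivative, hence the reversed order of
      the two directions.\<close>
    then show ?thesis using f(5)[OF x, of b' b] bs f'' by simp
  qed
qed

text \<open>Each direction is expanded in the basis with coefficients at most its norm, which costs
  one factor of the dimension per derivative. The same expansion differentiates the first derivative
  in an arbitrary fixed direction.\<close>

lemma C2_bounded_of_partials: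
  fixes f :: "'a::euclidean_space \<Rightarrow> real"
  assumes U: "open U" and f: "smooth_on U f"
    and K: "\<And>bs x. set bs \<subseteq> Basis \<Longrightarrow> length bs \<le> 2 \<Longrightarrow> x \<in> U \<Longrightarrow> \<bar>iter_partial bs f x\<bar> \<le> K"
  shows "C2_bounded (K * (real DIM('a))\<^sup>2) f U"
proof -
  define D where "D = real DIM('a)"
  define f' where "f' x = frechet_derivative f (at x)" for x
  define g where "g b x = frechet_derivative (\<lambda>y. f' y b) (at x)" for b x
  have D: "D \<ge> 1" by (simp add: D_def Suc_leI)
  have d1: "(f has_derivative f' x) (at x)" if "x \<in> U" for x
    unfolding f'_def by (rule smooth_on_has_derivative[OF U f that])
  have d2: "((\<lambda>y. f' y b) has_derivative g b x) (at x)" if "x \<in> U" for x b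
    unfolding g_def f'_def
    by (rule smooth_on_has_derivative[OF U smooth_on_frechet_derivative[OF U f] that])
  have rep: "l v = (\<Sum>b\<in>Basis. (v \<bullet> b) * l b)" if "linear l" for l :: "'a \<Rightarrow> real" and v
    using linear_sum[OF that, of "\<lambda>b. (v \<bullet> b) *\<^sub>R b" Basis] linear_scale[OF that]
    by (simp add: euclidean_representation)
  have sum_le: "\<bar>\<Sum>b\<in>Basis. (v \<bullet> b) * l b\<bar> \<le> D * B * norm v"
    if "\<And>b. b \<in> Basis \<Longrightarrow> \<bar>l b\<bar> \<le> B" for l :: "'a \<Rightarrow> real" and v B
  proof -
    have "\<bar>\<Sum>b\<in>Basis. (v \<bullet> b) * l b\<bar> \<le> (\<Sum>b\<in>(Basis::'a set). norm v * B)"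
      unfolding abs_mult
      by (rule order_trans[OF sum_abs], rule sum_mono)
         (use that in \<open>auto simp: abs_mult Basis_le_norm intro!: mult_mono\<close>)
    then show ?thesis by (simp add: D_def mult_ac)
  qed
  have "C2_bounded (D * (D * K)) f U"
  proof (rule C2_boundedI[where f'=f' and f''="\<lambda>x v w. \<Sum>b\<in>Basis. (v \<bullet> b) * g b x w"])
    fix x v w assume x: "x \<in> U"
    have K0: "K \<ge> 0" using K[of "[]" x] x by simp
    show "(f has_derivative f' x) (at x)" by (rule d1[OF x])
    have "((\<lambda>y. \<Sum>b\<in>Basis. (v \<bullet> b) * f' y b) has_derivative (\<lambda>w. \<Sum>b\<in>Basis. (v \<bullet> b) * g b x w)) (at x)"
      by (intro has_derivative_sum has_derivative_mult_right d2 x)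
    then show "((\<lambda>y. f' y v) has_derivative (\<lambda>w. \<Sum>b\<in>Basis. (v \<bullet> b) * g b x w)) (at x)"
    proof (rule has_derivative_transform_within_open[OF _ U x])
      fix y assume "y \<in> U"
      from d1[OF this] show "(\<Sum>b\<in>Basis. (v \<bullet> b) * f' y b) = f' y v"
        by (intro rep[symmetric] has_derivative_linear)
    qed
    have KD: "K \<le> D * K" "D * K \<le> D * (D * K)"
      using D K0 mult_right_mono[of 1 D K] mult_right_mono[of 1 D "D * K"] by auto
    show "\<bar>f x\<bar> \<le> D * (D * K)" using K[of "[]" x] x KD by simp
    have "\<bar>f' x v\<bar> \<le> D * K * norm v"
      unfolding rep[OF has_derivative_linear[OF d1[OF x]], of v]
      by (rule sum_le) (use K[of "[b]" x for b] x in \<open>auto simp: f'_def\<close>)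
    also have "\<dots> \<le> D * (D * K) * norm v" using KD by (intro mult_right_mono) auto
    finally show "\<bar>f' x v\<bar> \<le> D * (D * K) * norm v" .
    have "\<bar>g b x w\<bar> \<le> D * K * norm w" if "b \<in> Basis" for b
      by (subst rep[OF has_derivative_linear[OF d2[OF x, of b]], of w], rule sum_le) (use K[of "[b', b]" x for b'] x that in \<open>auto simp: f'_def g_def\<close>)
    then have "\<bar>\<Sum>b\<in>Basis. (v \<bullet> b) * g b x w\<bar> \<le> D * (D * K * norm w) * norm v"
      by (rule sum_le)
    then show "\<bar>\<Sum>b\<in>Basis. (v \<bullet> b) * g b x w\<bar> \<le> D * (D * K) * norm v * norm w"
      by (simp add: mult_ac)
  qed
  then show ?thesis by (simp add: D_def power2_eq_square mult_ac)
qed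

lemma smooth_on_iter_partial:
  "open U \<Longrightarrow> smooth_on U f \<Longrightarrow> smooth_on U (iter_partial bs f)"
  by (induction bs) (auto intro: smooth_on_frechet_derivative)

text \<open>There are finitely many multi-indices of order at most 2, and each corresponding
  derivative is continuous, hence bounded, on \<open>C\<close>. The bound is stated on an open set
  inside \<open>C\<close>.\<close>

lemma C2_bounded_on_compact:
  fixes f :: "'a::euclidean_space \<Rightarrow> real"
  assumes "open U" "smooth_on U f" "compact C" "C \<subseteq> U" "open V" "V \<subseteq> C"
  shows "\<exists>K. C2_bounded K f V"
proof -
  let ?L = "{bs. set bs \<subseteq> (Basis :: 'a set) \<and> length bs \<le> 2}"
  have "\<exists>B. \<forall>x\<in>C. \<bar>iter_partial bs f x\<bar> \<le> B" for bs
  proof -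
    have "continuous_on C (iter_partial bs f)"
      using smooth_on_continuous_on[OF smooth_on_iter_partial[OF assms(1,2)]] assms(4)
      by (rule continuous_on_subset)
    then have "bounded (iter_partial bs f ` C)"
      by (intro compact_imp_bounded compact_continuous_image assms)
    then show ?thesis by (auto simp: bounded_iff)
  qed
  then obtain B where B: "\<And>bs x. x \<in> C \<Longrightarrow> \<bar>iter_partial bs f x\<bar> \<le> B bs" by metis
  have fin: "finite ?L" by (rule finite_lists_length_le) simp
  have "C2_bounded (Max (B ` ?L) * (real DIM('a))\<^sup>2) f V"
  proof (rule C2_bounded_of_partials[OF assms(5)])
    show "smooth_on V f" using assms by (auto intro: smooth_on_subset)
    fix bs :: "'a list" and x assume bs: "set bs \<subseteq> Basis" "length bs \<le> 2" and "x \<in> V"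
    then have "\<bar>iter_partial bs f x\<bar> \<le> B bs" using B assms(6) by blast
    also have "\<dots> \<le> Max (B ` ?L)" using fin bs by (intro Max_ge) auto
    finally show "\<bar>iter_partial bs f x\<bar> \<le> Max (B ` ?L)" .
  qed
  then show ?thesis ..
qed

text \<open>A positive semidefinite matrix that annihilates its own quadratic form at \<open>v \<noteq> 0\<close> is singular;
  compactness of the set of admissible matrices makes this quantitative.\<close>

lemma psd_matrix_lower_bound:
  assumes c: "c > 0"
  shows "\<exists>l>0. \<forall>M::real^'n^'n. (\<forall>i j. \<bar>M $ i $ j\<bar> \<le> c) \<and> (\<forall>i j. M $ i $ j = M $ j $ i) \<and>
      (\<forall>v. v \<bullet> (M *v v) \<ge> 0) \<and> \<bar>det M\<bar> \<ge> 1 / c \<longrightarrow> (\<forall>v. v \<bullet> (M *v v) \<ge> l * (norm v)\<^sup>2)"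
proof -
  \<comment> \<open>All conditions are non-strict inequalities or equations between polynomials in
    the entries, so the set is closed; the bound on the entries makes it compact.\<close>
  define S where "S = {M::real^'n^'n. (\<forall>i j. \<bar>M $ i $ j\<bar> \<le> c) \<and> (\<forall>i j. M $ i $ j = M $ j $ i) \<and>
      (\<forall>v. v \<bullet> (M *v v) \<ge> 0) \<and> \<bar>det M\<bar> \<ge> 1 / c}"
  have q: "v \<bullet> (M *v v) = (\<Sum>i\<in>UNIV. \<Sum>j\<in>UNIV. v $ i * (M $ i $ j * v $ j))" for M :: "real^'n^'n" and v
    by (simp add: inner_vec_def matrix_vector_mult_def sum_distrib_left)
  have "closed S"
    unfolding S_def q det_def
    by (intro closed_Collect_conj closed_Collect_all closed_Collect_le closed_Collect_eq continuous_intros)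
  moreover have "bounded S"
  proof (rule boundedI)
    fix M assume "M \<in> S"
    then have "\<bar>M $ i $ j\<bar> \<le> c" for i j by (simp add: S_def)
    then have "norm (M $ i) \<le> (\<Sum>j\<in>(UNIV::'n set). c)" for i
      by (intro order_trans[OF norm_le_l1_cart] sum_mono) auto
    then have "(\<Sum>i\<in>UNIV. norm (M $ i)) \<le> (\<Sum>i\<in>(UNIV::'n set). \<Sum>j\<in>(UNIV::'n set). c)"
      by (intro sum_mono)
    moreover have "norm M \<le> (\<Sum>i\<in>UNIV. norm (M $ i))" unfolding norm_vec_def by (rule L2_set_le_sum) auto
    ultimately show "norm M \<le> (\<Sum>i\<in>(UNIV::'n set). \<Sum>j\<in>(UNIV::'n set). c)" by linarith
  qed
  ultimately have comp: "compact (S \<times> sphere (0::real^'n) 1)"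
    by (intro compact_Times compact_sphere) (simp add: compact_eq_bounded_closed)
  have pos: "v \<bullet> (M *v v) > 0" if M: "M \<in> S" and v: "v \<noteq> 0" for M v
  proof (rule ccontr)
    assume "\<not> v \<bullet> (M *v v) > 0"
    then have z: "v \<bullet> (M *v v) = 0" using M by (auto simp: S_def not_less antisym)
    define w where "w = M *v v"
    define a where "a = w \<bullet> w"
    define b where "b = w \<bullet> (M *v w)"
    have b: "b \<ge> 0" using M by (simp add: S_def b_def)
    have "v \<bullet> (M *v w) = a"
    proof -
      have "transpose M = M" using M by (simp add: S_def transpose_def vec_eq_iff)
      then show ?thesis by (metis a_def dot_lmul_matrix transpose_matrix_vector w_def)
    qed
    \<comment> \<open>The quadratic form is evaluated at \<open>v + t *\<^sub>R (M *v v)\<close>, a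
      line through the supposed null vector. Nonnegativity for every \<open>t\<close> forces the
      linear coefficient \<open>a\<close>, the squared norm of \<open>M *v v\<close>, to
      vanish.\<close>
    then have quad: "2 * t * a + t\<^sup>2 * b \<ge> 0" for t
    proof -
      have "(v + t *\<^sub>R w) \<bullet> (M *v (v + t *\<^sub>R w)) \<ge> 0" using M by (simp add: S_def)
      then show ?thesis
        using z \<open>v \<bullet> (M *v w) = a\<close>
        by (simp add: matrix_vector_mult_add_rdistrib matrix_vector_mult_scaleR matrix_vector_right_distrib
            scaleR_matrix_vector_assoc[symmetric] vector_scaleR_matrix_ac
            inner_add_left inner_add_right a_def b_def w_def[symmetric] power2_eq_square algebra_simps)
    qed
    have "a = 0"
    proof (rule ccontr)
      assume "a \<noteq> 0"
      then have a: "a > 0" by (simp add: a_def)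
      \<comment> \<open>This negative \<open>t\<close> gives the form the value
        \<open>t * (a - t)\<close>, which is negative. The summand 1 makes the denominator positive
        also when \<open>b = 0\<close>.\<close>
      define t where "t = - a / (b + 1)"
      have t: "t * (b + 1) = - a" using b by (simp add: t_def)
      have "t < 0" using a b by (simp add: t_def divide_neg_pos)
      have "2 * t * a + t\<^sup>2 * b = t * (2 * a + t * b)" by (simp add: power2_eq_square algebra_simps)
      also have "2 * a + t * b = a - t" using t by (simp add: algebra_simps)
      also have "t * (a - t) < 0" using \<open>t < 0\<close> a by (simp add: mult_neg_pos)
      finally show False using quad[of t] by simp
    qed
    then have "M *v v = 0" by (simp add: a_def w_def)
    then have "\<not> invertible M"
      using v by (metis invertible_def matrix_left_invertible_ker)
    then have "det M = 0" by (simp add: invertible_det_nz)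
    then show False using M c by (simp add: S_def)
  qed
  show ?thesis
  proof (cases "S = {}")
    case True
    show ?thesis
    proof (intro exI[of _ 1] conjI allI impI, goal_cases)
      case (2 M v)
      then have "M \<in> S" by (simp add: S_def)
      then show ?case using True by simp
    qed simp
  next
    case False
    have "continuous_on (S \<times> sphere 0 1) (\<lambda>(M, v). v \<bullet> (M *v v))"
      unfolding q case_prod_beta by (intro continuous_intros)
    moreover have "S \<times> sphere (0::real^'n) 1 \<noteq> {}" using False by (simp)
    ultimately obtain z where z: "z \<in> S \<times> sphere 0 1" and
      min: "\<And>y. y \<in> S \<times> sphere 0 1 \<Longrightarrow> (case z of (M, v) \<Rightarrow> v \<bullet> (M *v v)) \<le> (case y of (M, v) \<Rightarrow> v \<bullet> (M *v v))"
      using continuous_attains_inf[OF comp] by blast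
    define l where "l = (case z of (M, v) \<Rightarrow> v \<bullet> (M *v v))"
    have "fst z \<in> S" "snd z \<noteq> 0" using z by auto
    then have "l > 0" using pos by (simp add: l_def case_prod_beta)
    moreover have "v \<bullet> (M *v v) \<ge> l * (norm v)\<^sup>2" if M: "M \<in> S" for M v
    proof (cases "v = 0")
      case False
      have "l \<le> (v /\<^sub>R norm v) \<bullet> (M *v (v /\<^sub>R norm v))"
        using min[of "(M, v /\<^sub>R norm v)"] M False by (simp add: l_def)
      also have "\<dots> = (v \<bullet> (M *v v)) / (norm v)\<^sup>2"
        by (simp add: matrix_vector_mult_scaleR power2_eq_square divide_inverse)
      finally show ?thesis using False by (simp add: field_simps)
    qed simp
    ultimately show ?thesis by (intro exI[of _ l]) (simp add: S_def)
  qed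
qed

text \<open>Gram-Schmidt for \<open>B\<close>, indexed by a growing set of standard basis vectors so
  that the result can be used directly as the image of the standard basis under a linear
  map.\<close>

lemma orthonormal_frame:
  fixes B :: "'a::euclidean_space \<Rightarrow> 'a \<Rightarrow> real"
  assumes B: "inner_product_on UNIV B" and "I \<subseteq> Basis"
  shows "\<exists>e :: 'a \<Rightarrow> 'a. \<forall>i\<in>I. \<forall>j\<in>I. B (e i) (e j) = (if i = j then 1 else 0)"
proof -
  have "finite I" using assms(2) finite_Basis finite_subset by blast
  then show ?thesis using assms(2)
  proof (induction I rule: finite_induct)
    case (insert b I)
    then obtain e :: "'a \<Rightarrow> 'a" where e: "\<And>i j. i \<in> I \<Longrightarrow> j \<in> I \<Longrightarrow> B (e i) (e j) = (if i = j then 1 else 0)"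
      by auto
    have lin: "B (r *\<^sub>R u + s *\<^sub>R v) w = r * B u w + s * B v w" and sym: "B v w = B w v" for r s u v w
      using inner_product_onD[OF B] by auto
    \<comment> \<open>The vectors found so far are fewer than the dimension, so some vector lies
      outside their span; subtracting its projection and normalising yields the next one.\<close>
    have "dim (e ` I) \<le> card I"
      using insert by (intro order_trans[OF dim_le_card' card_image_le]) auto
    also have "card I < card (insert b I)" using insert by simp
    also have "\<dots> \<le> DIM('a)" using insert.prems by (intro card_mono) auto
    finally have "span (e ` I) \<noteq> UNIV" by (metis dim_UNIV dim_span less_irrefl)
    then obtain v where v: "v \<notin> span (e ` I)" by auto
    define s where "s = (\<Sum>i\<in>I. B v (e i) *\<^sub>R e i)"
    define u where "u = v - s"
    have "s \<in> span (e ` I)" unfolding s_def by (intro span_sum span_scale span_base) auto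
    then have u0: "u \<noteq> 0" using v by (auto simp: u_def)
    have uj: "B u (e j) = 0" if "j \<in> I" for j
    proof -
      have "B s (e j) = (\<Sum>i\<in>I. B v (e i) * B (e i) (e j))"
        unfolding s_def by (rule inner_product_on_sum[OF B]) (auto simp: subspace_UNIV)
      also have "\<dots> = (\<Sum>i\<in>I. if i = j then B v (e i) else 0)"
        by (rule sum.cong) (use e that in auto)
      also have "\<dots> = B v (e j)" using insert that by simp
      finally show ?thesis using lin[of 1 v "-1" s "e j"] by (simp add: u_def)
    qed
    have pos: "B u u > 0" using inner_product_onD(3)[OF B UNIV_I UNIV_I UNIV_I u0] .
    define w where "w = u /\<^sub>R sqrt (B u u)"
    have w: "B w x = B u x / sqrt (B u u)" for x
      using lin[of "inverse (sqrt (B u u))" u 0 0 x] by (simp add: w_def divide_inverse mult.commute)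
    have wj: "B w (e j) = 0" if "j \<in> I" for j using uj[OF that] w by simp
    have ww: "B w w = 1"
    proof -
      have "B w w = B u u / sqrt (B u u) / sqrt (B u u)" using w[of w] w[of u] sym[of u w] by simp
      then show ?thesis using pos by simp
    qed
    have "\<forall>i\<in>insert b I. \<forall>j\<in>insert b I. B ((e(b := w)) i) ((e(b := w)) j) = (if i = j then 1 else 0)"
      using insert.hyps e wj ww sym by auto
    then show ?case by blast
  qed auto
qed

text \<open>\<open>L\<close> sends the standard basis to a \<open>B\<close>-orthonormal one. It is
  the linear part of the chart that flattens the metric at its centre.\<close>

lemma inner_product_isometry:
  fixes B :: "'a::euclidean_space \<Rightarrow> 'a \<Rightarrow> real"
  assumes B: "inner_product_on UNIV B"
  obtains L :: "'a \<Rightarrow> 'a" where "linear L" "\<And>u v. B (L u) (L v) = u \<bullet> v"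
proof -
  obtain e :: "'a \<Rightarrow> 'a" where e: "\<forall>i\<in>Basis. \<forall>j\<in>Basis. B (e i) (e j) = (if i = j then 1 else 0)"
    using orthonormal_frame[OF B subset_refl] by blast
  define L where "L v = (\<Sum>b\<in>Basis. (v \<bullet> b) *\<^sub>R e b)" for v
  have "linear L"
    by (rule linearI) (simp_all add: L_def inner_add_left scaleR_add_left sum.distrib scaleR_sum_right)
  moreover have "B (L u) (L v) = u \<bullet> v" for u v
  proof -
    have 1: "B (L u) x = (\<Sum>b\<in>Basis. (u \<bullet> b) * B (e b) x)" for u x
      unfolding L_def by (rule inner_product_on_sum[OF B]) (auto simp: subspace_UNIV)
    have 2: "B (e b) (L v) = v \<bullet> b" if b: "b \<in> Basis" for b
    proof -
      have "B (e b) (L v) = B (L v) (e b)" using inner_product_onD(2)[OF B] by auto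
      also have "\<dots> = (\<Sum>b'\<in>Basis. if b' = b then v \<bullet> b' else 0)"
        unfolding 1 by (rule sum.cong) (use e b in auto)
      also have "\<dots> = v \<bullet> b" using b by simp
      finally show ?thesis .
    qed
    have "B (L u) (L v) = (\<Sum>b\<in>Basis. (u \<bullet> b) * (v \<bullet> b))"
      unfolding 1 by (rule sum.cong) (use 2 in auto)
    then show ?thesis by (simp add: euclidean_inner[of u v])
  qed
  ultimately show ?thesis by (rule that)
qed

section \<open>Charts\<close>

text \<open>An injective linear self-map of a Euclidean space is invertible, so the domain can be
  transported back and forth by affine isomorphisms, and the inverse chart is the old inverse
  followed by an affine map.\<close>

lemma is_chart_compose_affine:
  fixes \<psi> :: "'a::euclidean_space \<Rightarrow> 'b::euclidean_space" and L :: "'a \<Rightarrow> 'a"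
  assumes ch: "is_chart M U \<psi>" and L: "linear L" "inj L" and V: "open V"
    and VU: "\<And>y. y \<in> V \<Longrightarrow> p + L y \<in> U"
  shows "is_chart M V (\<lambda>y. \<psi> (p + L y))"
proof -
  have U: "open U" "inj_on \<psi> U" "openin (top_of_set M) (\<psi> ` U)" "smooth_on U \<psi>"
    "smooth_on (\<psi> ` U) (inv_into U \<psi>)"
    using ch by (auto simp: is_chart_def)
  obtain L' where L': "linear L'" "\<And>x. L' (L x) = x"
    using linear_injective_left_inverse[OF L] by (auto simp: fun_eq_iff)
  have LL': "L (L' x) = x" for x
    using linear_injective_imp_surjective[OF L] L'(2) by (metis surjD)
  have bl: "bounded_linear L" "bounded_linear L'"
    using L(1) L'(1) linear_conv_bounded_linear by blast+
  define W where "W = (\<lambda>y. p + L y) ` V"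
  have W_eq: "W = (\<lambda>x. L' (x - p)) -` V"
  proof (intro set_eqI iffI)
    fix x assume "x \<in> (\<lambda>x. L' (x - p)) -` V"
    then show "x \<in> W" unfolding W_def by (intro image_eqI[of _ _ "L' (x - p)"]) (auto simp: LL')
  qed (auto simp: W_def L'(2))
  have "continuous_on UNIV (\<lambda>x. L' (x - p))"
    by (intro bounded_linear.continuous_on[OF bl(2)] continuous_intros)
  then have W: "open W" "W \<subseteq> U"
    subgoal unfolding W_eq by (rule open_vimage[OF V])
    subgoal using VU by (auto simp: W_def)
    done
  have img: "(\<lambda>y. \<psi> (p + L y)) ` V = \<psi> ` W" by (auto simp: W_def)
  have inj: "inj_on (\<lambda>y. \<psi> (p + L y)) V"
    by (rule inj_onI) (metis inj_onD[OF U(2)] VU add_left_cancel injD[OF L(2)])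
  have inv: "inv_into V (\<lambda>y. \<psi> (p + L y)) q = L' (inv_into U \<psi> q - p)" if q: "q \<in> \<psi> ` W" for q
  proof -
    obtain y where y: "y \<in> V" "q = \<psi> (p + L y)" using q by (auto simp: W_def)
    show ?thesis
      using y inv_into_f_f[OF inj y(1)] inv_into_f_f[OF U(2) VU[OF y(1)]] by (simp add: L'(2))
  qed
  \<comment> \<open>The new image is the preimage of \<open>W\<close> under the continuous inverse
    chart, hence open in the old image, which is itself open in \<open>M\<close>.\<close>
  have "openin (top_of_set (\<psi> ` U)) (\<psi> ` U \<inter> inv_into U \<psi> -` W)"
    by (rule continuous_openin_preimage_gen[OF smooth_on_continuous_on[OF U(5)] W(1)])
  moreover have "\<psi> ` U \<inter> inv_into U \<psi> -` W = \<psi> ` W"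
    using U(2) W(2) by (auto simp: inv_into_f_f)
  ultimately have "openin (top_of_set M) (\<psi> ` W)"
    using U(3) openin_trans by metis
  moreover have "smooth_on V (\<lambda>y. \<psi> (p + L y))"
    by (intro smooth_on_compose[OF U(4)] smooth_on_add smooth_on_const smooth_on_bounded_linear bl)
       (use VU in auto)
  moreover have "smooth_on (\<psi> ` W) (\<lambda>q. L' (inv_into U \<psi> q - p))"
    by (intro smooth_on_compose[OF smooth_on_bounded_linear[OF bl(2), of UNIV]]
        smooth_on_diff smooth_on_const smooth_on_subset[OF U(5)]) (use W in auto)
  then have "smooth_on (\<psi> ` W) (inv_into V (\<lambda>y. \<psi> (p + L y)))"
    by (rule smooth_on_cong) (simp add: inv)
  ultimately show ?thesis using V inj by (simp add: is_chart_def img)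
qed

text \<open>The condition \<open>t \<ge> 1\<close> keeps the interval of heights from
  \<open>t - 1\<close> to \<open>t + 1\<close> inside the positive reals.\<close>

lemma is_chart_cylinder:
  fixes \<phi> :: "real^'n \<Rightarrow> 'b::euclidean_space"
  assumes ch: "is_chart (sphere 0 1) (ball 0 1) \<phi>" and t: "t \<ge> 1"
  shows "is_chart cylinder model_domain (\<lambda>z. (\<phi> (fst z), snd z + t))"
proof -
  let ?f = "\<lambda>z. (\<phi> (fst z), snd z + t)"
  have U: "inj_on \<phi> (ball 0 1)" "openin (top_of_set (sphere 0 1)) (\<phi> ` ball 0 1)" "smooth_on (ball 0 1) \<phi>"
    "smooth_on (\<phi> ` ball 0 1) (inv_into (ball 0 1) \<phi>)"
    using ch by (auto simp: is_chart_def)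
  have img: "?f ` model_domain = \<phi> ` ball 0 1 \<times> {t - 1<..<t + 1}"
  proof (intro set_eqI iffI)
    fix q assume "q \<in> \<phi> ` ball 0 1 \<times> {t - 1<..<t + 1}"
    then obtain y where "y \<in> ball 0 1" "q = (\<phi> y, snd q)" "snd q \<in> {t - 1<..<t + 1}" by (cases q) auto
    then show "q \<in> ?f ` model_domain"
      by (intro image_eqI[of _ _ "(y, snd q - t)"]) (auto simp: model_domain_def)
  qed (auto simp: model_domain_def)
  have inj: "inj_on ?f model_domain"
    using U(1) by (auto simp: inj_on_def model_domain_def)
  have inv: "inv_into model_domain ?f q = (inv_into (ball 0 1) \<phi> (fst q), snd q - t)"
    if q: "q \<in> ?f ` model_domain" for q
  proof -
    obtain z where z: "z \<in> model_domain" "q = ?f z" using q by blast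
    then have "fst z \<in> ball 0 1" by (auto simp: model_domain_def)
    then have "inv_into (ball 0 1) \<phi> (\<phi> (fst z)) = fst z"
      by (rule inv_into_f_f[OF U(1)])
    then show ?thesis
      unfolding z(2) inv_into_f_f[OF inj z(1)] by simp
  qed
  have "openin (top_of_set (cylinder :: ('b \<times> real) set)) (\<phi> ` ball 0 1 \<times> {t - 1<..<t + 1})"
    unfolding cylinder_def using t
    by (intro openin_Times U(2)) (auto simp: openin_open_eq)
  moreover have "smooth_on model_domain ?f"
    by (intro smooth_on_Pair smooth_on_add smooth_on_const smooth_on_compose[OF U(3)]
        smooth_on_bounded_linear bounded_linear_fst bounded_linear_snd)
       (auto simp: model_domain_def)
  moreover have "smooth_on (?f ` model_domain) (inv_into model_domain ?f)"
  proof (rule smooth_on_cong[OF _ inv[symmetric]])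
    show "smooth_on (?f ` model_domain) (\<lambda>q. (inv_into (ball 0 1) \<phi> (fst q), snd q - t))"
      by (intro smooth_on_Pair smooth_on_diff smooth_on_const smooth_on_compose[OF U(4)]
        smooth_on_bounded_linear bounded_linear_fst bounded_linear_snd) (auto simp: model_domain_def)
  qed
  moreover have "open (model_domain :: ((real^'n) \<times> real) set)"
    by (auto simp: model_domain_def intro: open_Times)
  ultimately show ?thesis using inj by (simp add: is_chart_def img)
qed

lemma sphere_chart_facts:
  fixes \<psi> :: "'a::euclidean_space \<Rightarrow> 'b::euclidean_space"
  assumes ch: "is_chart (sphere 0 1) U \<psi>" and x: "x \<in> U"
  shows "norm (\<psi> x) = 1"
    and "(\<psi> has_derivative frechet_derivative \<psi> (at x)) (at x)"
    and "frechet_derivative \<psi> (at x) v \<in> sphere_tangent (\<psi> x)"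
    and "frechet_derivative \<psi> (at x) v = 0 \<Longrightarrow> v = 0"
proof -
  have U: "open U" "inj_on \<psi> U" "openin (top_of_set (sphere 0 1)) (\<psi> ` U)" "smooth_on U \<psi>"
    "smooth_on (\<psi> ` U) (inv_into U \<psi>)"
    using ch by (auto simp: is_chart_def)
  have n: "norm (\<psi> y) = 1" if "y \<in> U" for y
    using openin_imp_subset[OF U(3)] that by auto
  show "norm (\<psi> x) = 1" by (rule n[OF x])
  show D: "(\<psi> has_derivative frechet_derivative \<psi> (at x)) (at x)"
    by (rule smooth_on_has_derivative[OF U(1,4) x])
  let ?D = "frechet_derivative \<psi> (at x)"
  \<comment> \<open>Tangency comes from differentiating the constant function
    \<open>\<psi> y \<bullet> \<psi> y = 1\<close>.\<close>
  have "((\<lambda>y. \<psi> y \<bullet> \<psi> y) has_derivative (\<lambda>v. \<psi> x \<bullet> ?D v + ?D v \<bullet> \<psi> x)) (at x)"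
    by (intro has_derivative_inner D)
  moreover have "((\<lambda>y. \<psi> y \<bullet> \<psi> y) has_derivative (\<lambda>v. 0)) (at x)"
    by (rule has_derivative_transform_within_open[OF has_derivative_const[of 1] U(1) x])
       (simp add: n dot_square_norm)
  ultimately have "(\<lambda>v. \<psi> x \<bullet> ?D v + ?D v \<bullet> \<psi> x) = (\<lambda>v. 0)" by (rule has_derivative_unique)
  then have "\<psi> x \<bullet> ?D v + ?D v \<bullet> \<psi> x = 0" by (rule fun_cong)
  then show "?D v \<in> sphere_tangent (\<psi> x)" by (simp add: sphere_tangent_def inner_commute)
  assume v: "?D v = 0"
  \<comment> \<open>The inverse chart is defined only on the sphere and has no ambient derivative. A
    local smooth extension \<open>G\<close> has one, and since \<open>G\<close> composed with
    \<open>\<psi>\<close> is the identity near \<open>x\<close>, the derivative of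
    \<open>\<psi>\<close> is injective.\<close>
  obtain W G where W: "open W" "\<psi> x \<in> W" "\<And>k. Ck_on k G W" "\<And>q. q \<in> \<psi> ` U \<Longrightarrow> q \<in> W \<Longrightarrow> G q = inv_into U \<psi> q"
    by (rule smooth_onE[OF U(5), of "\<psi> x"]) (use x in auto)
  have "(G has_derivative frechet_derivative G (at (\<psi> x))) (at (\<psi> x))"
    by (rule Ck_on_has_derivative[OF W(3,2)])
  from diff_chain_at[OF D this]
  have 1: "((\<lambda>y. G (\<psi> y)) has_derivative (\<lambda>v. frechet_derivative G (at (\<psi> x)) (?D v))) (at x)"
    by (simp add: o_def)
  have o: "open (\<psi> -` W \<inter> U)"
    using smooth_on_continuous_on[OF U(4)] U(1) W(1) by (metis continuous_on_open_vimage)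
  have 2: "((\<lambda>y. G (\<psi> y)) has_derivative (\<lambda>v. v)) (at x)"
    by (rule has_derivative_transform_within_open[OF has_derivative_ident o])
       (use x W U(2) in auto)
  have "(\<lambda>v. frechet_derivative G (at (\<psi> x)) (?D v)) = (\<lambda>v. v)"
    by (rule has_derivative_unique[OF 1 2])
  then have "v = frechet_derivative G (at (\<psi> x)) 0" using v by (metis)
  also have "\<dots> = 0"
    using Ck_on_has_derivative[OF W(3,2)] has_derivative_linear linear_0 by blast
  finally show "v = 0" .
qed

section \<open>Metrics read in a chart\<close>

lemma inner_product_on_pullback:
  fixes \<psi> :: "'a::euclidean_space \<Rightarrow> 'b::euclidean_space"
  assumes ch: "is_chart (sphere 0 1) U \<psi>" and x: "x \<in> U" and h: "sphere_metric h"
  shows "inner_product_on UNIV (pullback \<psi> h x)"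
proof -
  note f = sphere_chart_facts[OF ch x]
  interpret linear "frechet_derivative \<psi> (at x)" by (rule has_derivative_linear[OF f(2)])
  note B = sphere_metric_inner_product[OF h f(1)]
  note B' = inner_product_onD[OF B f(3) f(3) f(3)]
  show ?thesis
    unfolding inner_product_on_def
  proof (intro conjI ballI allI impI)
    show "pullback \<psi> h x (r *\<^sub>R u + s *\<^sub>R v) w = r * pullback \<psi> h x u w + s * pullback \<psi> h x v w" for r s u v w
      by (simp add: pullback_def add scaleR B'(1))
    show "pullback \<psi> h x v w = pullback \<psi> h x w v" for v w by (simp add: pullback_def B'(2)[of v w])
    show "0 < pullback \<psi> h x v v" if "v \<noteq> 0" for v
      using B'(3)[of v] f(4)[of v] that by (auto simp: pullback_def)
  qed
qed

lemma smooth_on_pullback: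
  fixes \<psi> :: "'a::euclidean_space \<Rightarrow> 'b::euclidean_space"
  assumes ch: "is_chart (sphere 0 1) U \<psi>" and h: "sphere_metric h"
  shows "smooth_on U (\<lambda>x. pullback \<psi> h x v w)"
proof -
  have U: "open U" "smooth_on U \<psi>" using ch by (auto simp: is_chart_def)
  show ?thesis
    unfolding pullback_def
    by (intro smooth_on_sphere_metric[OF h U(2)] smooth_on_frechet_derivative U sphere_chart_facts[OF ch])
qed

lemma inner_product_on_expand:
  fixes B :: "'a::euclidean_space \<Rightarrow> 'a \<Rightarrow> real"
  assumes B: "inner_product_on UNIV B"
  shows "B v w = (\<Sum>b\<in>Basis. \<Sum>b'\<in>Basis. ((v \<bullet> b) * (w \<bullet> b')) * B b b')"
proof -
  have 1: "B v w = (\<Sum>b\<in>Basis. (v \<bullet> b) * B b w)" for v w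
    using inner_product_on_sum[OF B subspace_UNIV UNIV_I, of Basis "\<lambda>b. b" "\<lambda>b. v \<bullet> b" w]
    by (simp add: euclidean_representation)
  have s: "B v w = B w v" for v w using inner_product_onD(2)[OF B] by auto
  have 2: "B b w = (\<Sum>b'\<in>Basis. (w \<bullet> b') * B b b')" for b
    by (metis (no_types, lifting) 1 s sum.cong)
  show ?thesis
    unfolding 1[of v w] by (subst 2) (simp add: sum_distrib_left mult.assoc)
qed

lemma inner_product_on_scale:
  fixes B :: "'a::euclidean_space \<Rightarrow> 'a \<Rightarrow> real"
  assumes B: "inner_product_on UNIV B"
  shows "B (s *\<^sub>R v) (s *\<^sub>R w) = s\<^sup>2 * B v w"
  by (subst (1 2) inner_product_on_expand[OF B]) (simp add: sum_distrib_left power2_eq_square mult_ac)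

text \<open>After composition with \<open>L\<close> the matrix entries are values on the images of
  basis vectors under \<open>L\<close>, so bounds on the original entries are extended to arbitrary
  fixed vectors; the squared dimension counts the terms of the bilinear expansion.\<close>

lemma C2_bounded_pullback:
  fixes \<psi> :: "'a::euclidean_space \<Rightarrow> 'b::euclidean_space"
  assumes ch: "is_chart (sphere 0 1) U \<psi>" and h: "sphere_metric h" and V: "open V" "V \<subseteq> U" and K: "K \<ge> 0"
    and b: "\<And>i j. i \<in> Basis \<Longrightarrow> j \<in> Basis \<Longrightarrow> C2_bounded K (\<lambda>x. pullback \<psi> h x i j) V"
  shows "C2_bounded (K * (real DIM('a))\<^sup>2 * (norm v * norm w)) (\<lambda>x. pullback \<psi> h x v w) V"
proof -
  have "C2_bounded (\<Sum>b\<in>(Basis::'a set). \<Sum>b'\<in>(Basis::'a set). (norm v * norm w) * K)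
      (\<lambda>x. \<Sum>b\<in>Basis. \<Sum>b'\<in>Basis. ((v \<bullet> b) * (w \<bullet> b')) * pullback \<psi> h x b b') V"
    by (rule C2_bounded_sum, rule C2_bounded_sum, rule C2_bounded_cmult, rule b)
       (auto simp: abs_mult Basis_le_norm intro!: mult_mono)
  then have "C2_bounded (\<Sum>b\<in>(Basis::'a set). \<Sum>b'\<in>(Basis::'a set). (norm v * norm w) * K) (\<lambda>x. pullback \<psi> h x v w) V"
    by (rule C2_bounded_cong[OF _ V(1)])
       (use V(2) in \<open>auto intro!: inner_product_on_expand[symmetric] inner_product_on_pullback[OF ch _ h]\<close>)
  then show ?thesis by (simp add: power2_eq_square mult_ac)
qed

text \<open>The round metric is not assumed to be \<open>c\<close>-bounded, so its constants come
  from compactness. For bounded \<open>U\<close> and positive \<open>r\<close> the points at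
  distance at least \<open>r\<close> from the complement form a compact subset of \<open>U\<close>.
  The upper bounds are needed on a neighbourhood of the centres, hence 1/2; the lower bound only at
  the centres, hence 1.\<close>

lemma round_chart_constants:
  fixes \<psi> :: "'a::euclidean_space \<Rightarrow> 'b::euclidean_space"
  assumes ch: "is_chart (sphere 0 1) U \<psi>" and bd: "bounded U"
  obtains K l where "l > 0"
    "\<And>i j. i \<in> Basis \<Longrightarrow> j \<in> Basis \<Longrightarrow> C2_bounded K (\<lambda>x. pullback \<psi> round_metric x i j) {x. infdist x (- U) > 1/2}"
    "\<And>x v. infdist x (- U) \<ge> 1 \<Longrightarrow> pullback \<psi> round_metric x v v \<ge> l * (norm v)\<^sup>2"
proof -
  have U: "open U" "smooth_on U \<psi>" using ch by (auto simp: is_chart_def)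
  have in_U: "x \<in> U" if "infdist x (- U) > 0" for x using that by (cases "x \<in> U") auto
  have cl: "closed {x. infdist x (- U) \<ge> r}" for r
    by (intro closed_Collect_le continuous_intros)
  have comp: "compact {x. infdist x (- U) \<ge> r}" if "r > 0" for r
  proof -
    have "{x. infdist x (- U) \<ge> r} \<subseteq> U" using in_U that by fastforce
    then show ?thesis using cl[of r] bounded_subset[OF bd] by (simp add: compact_eq_bounded_closed)
  qed
  have op: "open {x. infdist x (- U) > 1/2}"
    by (intro open_Collect_less continuous_intros)
  have "\<exists>K. C2_bounded K (\<lambda>x. pullback \<psi> round_metric x i j) {x. infdist x (- U) > 1/2}" for i j
    by (rule C2_bounded_on_compact[OF U(1) smooth_on_pullback[OF ch sphere_metric_round] comp[of "1/2"] _ op])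
       (use in_U in auto)
  then obtain K where K: "\<And>i j. C2_bounded (K i j) (\<lambda>x. pullback \<psi> round_metric x i j) {x. infdist x (- U) > 1/2}"
    by metis
  define K' where "K' = Max ((\<lambda>(i, j). K i j) ` (Basis \<times> Basis))"
  have K': "C2_bounded K' (\<lambda>x. pullback \<psi> round_metric x i j) {x. infdist x (- U) > 1/2}"
    if "i \<in> Basis" "j \<in> Basis" for i j
    by (rule C2_bounded_mono[OF K]) (unfold K'_def, rule Max_ge, use that in auto)
  \<comment> \<open>Minimising over base points and unit vectors together gives one positive lower
    bound; scaling extends it to all vectors.\<close>
  define C where "C = {x. infdist x (- U) \<ge> 1} \<times> sphere (0::'a) 1"
  have "compact C" unfolding C_def by (intro compact_Times comp) auto
  define f where "f z = pullback \<psi> round_metric (fst z) (snd z) (snd z)" for z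
  have C_U: "fst z \<in> U" if "z \<in> C" for z using that in_U by (auto simp: C_def)
  have "continuous_on C (\<lambda>z. \<Sum>b\<in>Basis. \<Sum>b'\<in>Basis. ((snd z \<bullet> b) * (snd z \<bullet> b')) * pullback \<psi> round_metric (fst z) b b')"
  proof (intro continuous_intros)
    fix b b'
    show "continuous_on C (\<lambda>z. pullback \<psi> round_metric (fst z) b b')"
      by (rule continuous_on_compose2[OF smooth_on_continuous_on[OF smooth_on_pullback[OF ch sphere_metric_round]] continuous_on_fst[OF continuous_on_id]])
         (use C_U in auto)
  qed
  then have cont: "continuous_on C f"
    by (rule continuous_on_eq)
       (use C_U in \<open>auto simp: f_def intro!: inner_product_on_expand[symmetric] inner_product_on_pullback[OF ch _ sphere_metric_round]\<close>)
  have pos: "f z > 0" if "z \<in> C" for z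
  proof -
    have "snd z \<noteq> 0" using that by (auto simp: C_def)
    then show ?thesis
      using inner_product_onD(3)[OF inner_product_on_pullback[OF ch C_U[OF that] sphere_metric_round] UNIV_I UNIV_I UNIV_I]
      by (simp add: f_def)
  qed
  have "\<exists>l>0. \<forall>z\<in>C. l \<le> f z"
  proof (cases "C = {}")
    case True
    then show ?thesis by (auto intro: exI[of _ 1])
  next
    case False
    then show ?thesis using continuous_attains_inf[OF \<open>compact C\<close> False cont] pos by blast
  qed
  then obtain l where l: "l > 0" "\<And>z. z \<in> C \<Longrightarrow> l \<le> f z" by blast
  show ?thesis
  proof (rule that[OF l(1) K'])
    fix x v assume x: "infdist x (- U) \<ge> 1"
    then have B: "inner_product_on UNIV (pullback \<psi> round_metric x)"
      using inner_product_on_pullback[OF ch in_U sphere_metric_round] by auto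
    show "l * (norm v)\<^sup>2 \<le> pullback \<psi> round_metric x v v"
    proof (cases "v = 0")
      case True
      then show ?thesis using inner_product_on_scale[OF B, of 0 0 0] by simp
    next
      case False
      have "l \<le> pullback \<psi> round_metric x (v /\<^sub>R norm v) (v /\<^sub>R norm v)"
        using l(2)[of "(x, v /\<^sub>R norm v)"] x False by (simp add: C_def f_def)
      also have "\<dots> = pullback \<psi> round_metric x v v / (norm v)\<^sup>2"
        unfolding inner_product_on_scale[OF B] by (simp add: power2_eq_square divide_inverse)
      finally show ?thesis using False by (simp add: field_simps)
    qed
  qed
qed

text \<open>The constant is fixed before atlas, chart, metric and point, so it depends on
  \<open>c\<close> and the dimension alone. It is the constant of the matrix lemma, applied to the
  Gram matrix of the pulled back metric.\<close>

lemma c_bounded_chart_constants: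
  assumes c: "c > 1"
  obtains l where "l > 0"
    "\<And>A U \<psi> g x v. c_bounded A c g \<Longrightarrow> sphere_metric g \<Longrightarrow> (U, \<psi> :: real^'n \<Rightarrow> real^('n::finite option)) \<in> A \<Longrightarrow>
        is_chart (sphere 0 1) U \<psi> \<Longrightarrow> x \<in> U \<Longrightarrow> pullback \<psi> g x v v \<ge> l * (norm v)\<^sup>2"
proof -
  have "c > 0" using c by simp
  from psd_matrix_lower_bound[OF this, where 'n='n]
  obtain l where l: "l > 0" "\<And>(M::real^'n^'n) v. (\<forall>i j. \<bar>M $ i $ j\<bar> \<le> c) \<Longrightarrow> (\<forall>i j. M $ i $ j = M $ j $ i) \<Longrightarrow>
      (\<forall>v. v \<bullet> (M *v v) \<ge> 0) \<Longrightarrow> \<bar>det M\<bar> \<ge> 1 / c \<Longrightarrow> v \<bullet> (M *v v) \<ge> l * (norm v)\<^sup>2"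
    by metis
  show ?thesis
  proof (rule that[OF l(1)])
    fix A U g x v and \<psi> :: "real^'n \<Rightarrow> real^('n option)"
    assume cb: "c_bounded A c g" and g: "sphere_metric g" and UA: "(U, \<psi>) \<in> A"
      and ch: "is_chart (sphere 0 1) U \<psi>" and x: "x \<in> U"
    note B = inner_product_on_pullback[OF ch x g]
    define M :: "real^'n^'n" where "M = (\<chi> i j. pullback \<psi> g x (axis i 1) (axis j 1))"
    have quad: "v \<bullet> (M *v v) = pullback \<psi> g x v v" for v
    proof -
      have "pullback \<psi> g x v v = (\<Sum>i\<in>UNIV. \<Sum>j\<in>UNIV. (v $ i * v $ j) * pullback \<psi> g x (axis i 1) (axis j 1))"
        unfolding inner_product_on_expand[OF B, of v v] Basis_vec_def
        by (simp add: UNION_singleton_eq_range sum.reindex inj_on_def axis_eq_axis inner_axis)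
      also have "\<dots> = v \<bullet> (M *v v)"
        by (simp add: M_def inner_vec_def matrix_vector_mult_def sum_distrib_left mult_ac)
      finally show ?thesis by simp
    qed
    have N: "C2_norm U (pullback \<psi> g) < ereal c"
      and dt: "\<bar>det M\<bar> > 1 / c"
      using cb UA x by (auto simp: c_bounded_def M_def)
    have "\<bar>M $ i $ j\<bar> \<le> c" for i j
    proof -
      \<comment> \<open>The empty list of directions extracts the bound on the entries themselves
        from the norm.\<close>
      have "ereal \<bar>iter_partial [] (\<lambda>y. pullback \<psi> g y (axis i 1) (axis j 1)) x\<bar> \<le> C2_norm U (pullback \<psi> g)"
        unfolding C2_norm_def
        by (rule SUP_upper2[of "(axis i 1, axis j 1, [], x)"]) (use x in \<open>auto simp: axis_in_Basis_iff\<close>)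
      then have "ereal \<bar>iter_partial [] (\<lambda>y. pullback \<psi> g y (axis i 1) (axis j 1)) x\<bar> < ereal c"
        using N by (rule le_less_trans)
      then show ?thesis by (simp add: M_def)
    qed
    moreover have "M $ i $ j = M $ j $ i" for i j
      using inner_product_onD(2)[OF B] by (simp add: M_def)
    moreover have "v \<bullet> (M *v v) \<ge> 0" for v
      using inner_product_onD(3)[OF B UNIV_I UNIV_I UNIV_I, of v] inner_product_on_scale[OF B, of 0 v v]
      by (cases "v = 0") (auto simp: quad less_imp_le)
    ultimately have "v \<bullet> (M *v v) \<ge> l * (norm v)\<^sup>2"
      using dt by (intro l(2)) auto
    then show "pullback \<psi> g x v v \<ge> l * (norm v)\<^sup>2" by (simp add: quad)
  qed
qed

lemma C2_bounded_of_c_bounded: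
  fixes \<psi> :: "real^'n \<Rightarrow> real^('n::finite option)"
  assumes cb: "c_bounded A c g" and g: "sphere_metric g" and UA: "(U, \<psi>) \<in> A"
    and ch: "is_chart (sphere 0 1) U \<psi>" and ij: "i \<in> Basis" "j \<in> Basis"
  shows "C2_bounded (c * (real DIM(real^'n))\<^sup>2) (\<lambda>x. pullback \<psi> g x i j) U"
proof (rule C2_bounded_of_partials)
  show "open U" using ch by (simp add: is_chart_def)
  show "smooth_on U (\<lambda>x. pullback \<psi> g x i j)" by (rule smooth_on_pullback[OF ch g])
  fix bs x assume bs: "set bs \<subseteq> (Basis :: (real^'n) set)" "length bs \<le> 2" "x \<in> U"
  have "ereal \<bar>iter_partial bs (\<lambda>y. pullback \<psi> g y i j) x\<bar> \<le> C2_norm U (pullback \<psi> g)"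
    unfolding C2_norm_def
    by (rule SUP_upper2[of "(i, j, bs, x)"]) (use bs ij in auto)
  also have "\<dots> < ereal c" using cb UA by (auto simp: c_bounded_def)
  finally show "\<bar>iter_partial bs (\<lambda>y. pullback \<psi> g y i j) x\<bar> \<le> c" by simp
qed

section \<open>The factors depending on the height\<close>

lemma exp_minus_double_le: "t \<in> {-1<..<1} \<Longrightarrow> exp (- (2 * t)) \<le> (9::real)" "t \<in> {-1<..<1} \<Longrightarrow> exp (2 * t) \<le> (9::real)"
proof -
  have *: "exp (2 * u) \<le> (9::real)" if "u \<le> 1" for u
  proof -
    have "exp u \<le> 3" using that exp_le by (meson exp_le_cancel_iff order_trans)
    then have "exp u * exp u \<le> 3 * 3" by (intro mult_mono) auto
    then show ?thesis by (simp add: exp_add[symmetric])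
  qed
  show "t \<in> {-1<..<1} \<Longrightarrow> exp (- (2 * t)) \<le> (9::real)" using *[of "-t"] by simp
  show "t \<in> {-1<..<1} \<Longrightarrow> exp (2 * t) \<le> (9::real)" using *[of t] by simp
qed

text \<open>With \<open>q = exp (- (2 * t\<^sub>0))\<close> the rescaled factor is the square of
  \<open>exp t - q * exp (- t)\<close>; this is what remains of its expansion after
  \<open>exp (2 * t)\<close> is removed.\<close>

definition warp_error :: "real \<Rightarrow> real \<Rightarrow> real"
  where "warp_error q t = q\<^sup>2 * exp (- (2 * t)) - 2 * q"

lemma warp_error_eq:
  "(2 * exp (- t\<^sub>0))\<^sup>2 * (sinh (t + t\<^sub>0))\<^sup>2 = exp (2 * t) + warp_error (exp (- (2 * t\<^sub>0))) t"
proof -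
  have e: "exp (- (2 * t\<^sub>0)) = exp (- t\<^sub>0) * exp (- t\<^sub>0)" "exp (2 * t) = exp t * exp t" "exp (- (2 * t)) = exp (- t) * exp (- t)"
    by (simp_all flip: exp_add)
  have 1: "exp t * exp (- t) = 1" "exp t\<^sub>0 * exp (- t\<^sub>0) = 1" by (simp_all flip: exp_add)
  have "2 * exp (- t\<^sub>0) * sinh (t + t\<^sub>0) = exp (- t\<^sub>0) * (exp t * exp t\<^sub>0 - exp (- t) * exp (- t\<^sub>0))"
    by (simp add: sinh_def flip: exp_add)
  also have "\<dots> = exp t - exp (- t) * (exp (- t\<^sub>0) * exp (- t\<^sub>0))"
    using 1(2) by (simp add: algebra_simps)
  finally have "(2 * exp (- t\<^sub>0))\<^sup>2 * (sinh (t + t\<^sub>0))\<^sup>2 = (exp t - exp (- t) * (exp (- t\<^sub>0) * exp (- t\<^sub>0)))\<^sup>2"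
    by (metis power_mult_distrib)
  also have "\<dots> = exp t * exp t - 2 * (exp t * exp (- t)) * (exp (- t\<^sub>0) * exp (- t\<^sub>0))
      + (exp (- t) * exp (- t)) * (exp (- t\<^sub>0) * exp (- t\<^sub>0))\<^sup>2"
    by (simp add: power2_eq_square algebra_simps)
  finally show ?thesis unfolding 1 by (simp add: warp_error_def e)
qed

text \<open>On the interval \<open>exp (- (2 * t))\<close> is at most 9, two derivatives contribute
  the factor 4, and \<open>q\<^sup>2 \<le> q\<close> leaves one power of \<open>q\<close>.\<close>

lemma C2_bounded_warp_error:
  assumes "0 \<le> q" "q \<le> 1"
  shows "C2_bounded (36 * q) (warp_error q) {-1<..<1}"
proof (rule C2_bounded_real)
  fix t :: real assume t: "t \<in> {-1<..<1}"
  show "(warp_error q has_real_derivative (- 2 * q\<^sup>2) * exp (- (2 * t))) (at t)"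
    unfolding warp_error_def[abs_def] by (auto intro!: derivative_eq_intros)
  show "((\<lambda>t. (- 2 * q\<^sup>2) * exp (- (2 * t))) has_real_derivative (4 * q\<^sup>2) * exp (- (2 * t))) (at t)"
    by (auto intro!: derivative_eq_intros)
  define z where "z = q\<^sup>2 * exp (- (2 * t))"
  have z: "0 \<le> z" "z \<le> q * 9"
    unfolding z_def using exp_minus_double_le(1)[OF t] assms
    by (auto simp: power2_eq_square mult_left_le intro!: mult_mono)
  have "warp_error q t = z - 2 * q" "(- 2 * q\<^sup>2) * exp (- (2 * t)) = - 2 * z" "(4 * q\<^sup>2) * exp (- (2 * t)) = 4 * z"
    by (simp_all add: z_def warp_error_def)
  then show "\<bar>warp_error q t\<bar> \<le> 36 * q" "\<bar>(- 2 * q\<^sup>2) * exp (- (2 * t))\<bar> \<le> 36 * q"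
    "\<bar>(4 * q\<^sup>2) * exp (- (2 * t))\<bar> \<le> 36 * q"
    using z assms by linarith+
qed

lemma C2_bounded_exp_double: "C2_bounded 36 (\<lambda>t. exp (2 * t)) {-1<..<1::real}"
proof (rule C2_bounded_real)
  fix t :: real assume t: "t \<in> {-1<..<1}"
  show "((\<lambda>t. exp (2 * t)) has_real_derivative 2 * exp (2 * t)) (at t)"
    by (auto intro!: derivative_eq_intros)
  show "((\<lambda>t. 2 * exp (2 * t)) has_real_derivative 4 * exp (2 * t)) (at t)"
    by (auto intro!: derivative_eq_intros)
  show "\<bar>exp (2 * t)\<bar> \<le> 36" "\<bar>2 * exp (2 * t)\<bar> \<le> 36" "\<bar>4 * exp (2 * t)\<bar> \<le> 36"
    using exp_minus_double_le(2)[OF t] by (auto simp: abs_mult)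
qed

text \<open>The inner map has slope \<open>2 / d\<close>. The second derivative is the worst: 12
  times the square of the slope, which is at most \<open>48 / d\<close> because
  \<open>d \<ge> 1\<close>. The value at height 0 is subtracted so that the function itself is small
  too, by the mean value inequality.\<close>

lemma C2_bounded_cutoff:
  assumes c: "cutoff_function \<rho>" and d: "d \<ge> 1"
  shows "C2_bounded (48 / d) (\<lambda>t. \<rho> (2 * ((t + t\<^sub>0 - a) / d)) - \<rho> (2 * ((0 + t\<^sub>0 - a) / d))) {-1<..<1}"
proof -
  have \<rho>: "smooth_on UNIV \<rho>" "\<bar>deriv \<rho> t\<bar> < 3" "\<bar>deriv (deriv \<rho>) t\<bar> < 12" for t
    using c by (auto simp: cutoff_function_def)
  have D: "(f has_real_derivative deriv f t) (at t)" if "smooth_on UNIV f" for f :: "real \<Rightarrow> real" and t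
    using smooth_on_has_derivative[OF open_UNIV that UNIV_I, of t]
    by (auto simp: DERIV_deriv_iff_real_differentiable differentiable_def)
  have "deriv \<rho> t = frechet_derivative \<rho> (at t) 1" for t
    using frechet_derivative_at[OF D[OF \<rho>(1), of t, unfolded has_field_derivative_def]] by (metis mult.right_neutral)
  then have "smooth_on UNIV (deriv \<rho>)"
    using smooth_on_frechet_derivative[OF open_UNIV \<rho>(1), of 1] by presburger
  note D1 = D[OF \<rho>(1)] and D2 = D[OF this]
  define u where "u t = 2 * ((t + t\<^sub>0 - a) / d)" for t
  have du: "(u has_real_derivative 2 / d) (at t)" for t
    unfolding u_def[abs_def] using d by (auto intro!: derivative_eq_intros)
  have d1: "((\<lambda>t. \<rho> (u t) - \<rho> (u 0)) has_real_derivative deriv \<rho> (u t) * (2 / d)) (at t)" for t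
    using DERIV_diff[OF DERIV_chain2[OF D1 du] DERIV_const] by simp
  have d2: "((\<lambda>t. deriv \<rho> (u t) * (2 / d)) has_real_derivative (deriv (deriv \<rho>) (u t) * (2 / d)) * (2 / d)) (at t)" for t
    by (rule DERIV_cmult_right[OF DERIV_chain2[OF D2 du]])
  have b1: "\<bar>deriv \<rho> (u t) * (2 / d)\<bar> \<le> 6 / d" for t
  proof -
    have "\<bar>deriv \<rho> (u t)\<bar> * (2 / d) \<le> 3 * (2 / d)" using \<rho>(2)[of "u t"] d by (intro mult_right_mono) auto
    then show ?thesis using d by (simp add: abs_mult)
  qed
  have "C2_bounded (48 / d) (\<lambda>t. \<rho> (u t) - \<rho> (u 0)) {-1<..<1}"
  proof (rule C2_bounded_real[OF d1 d2])
    fix t :: real assume t: "t \<in> {-1<..<1}"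
    have "norm ((\<rho> (u t) - \<rho> (u 0)) - (\<rho> (u 0) - \<rho> (u 0))) \<le> (6 / d) * norm (t - 0)"
      by (rule field_differentiable_bound[OF convex_UNIV has_field_derivative_at_within[OF d1]])
         (use b1 in auto)
    also have "\<dots> \<le> (6 / d) * 1" using t d by (intro mult_left_mono) auto
    finally show "\<bar>\<rho> (u t) - \<rho> (u 0)\<bar> \<le> 48 / d" using d by (simp add: field_simps)
    show "\<bar>deriv \<rho> (u t) * (2 / d)\<bar> \<le> 48 / d" using b1[of t] d by (simp add: field_simps)
    have "\<bar>deriv (deriv \<rho>) (u t)\<bar> * (2 / d) * (2 / d) \<le> 12 * (2 / d) * (2 / 1)"
      using \<rho>(3)[of "u t"] d by (intro mult_mono mult_right_mono divide_left_mono) auto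
    then show "\<bar>deriv (deriv \<rho>) (u t) * (2 / d) * (2 / d)\<bar> \<le> 48 / d" using d by (simp add: abs_mult)
  qed
  then show ?thesis by (simp add: u_def)
qed

section \<open>Closeness to hyperbolic space\<close>

text \<open>The bound involves only \<open>K\<close>, \<open>l\<close>, \<open>d\<close> and
  \<open>t\<^sub>0\<close>, the last through \<open>s\<close>. The parameter \<open>a\<close> enters
  through a translation of the cutoff, to which the derivative bounds are insensitive. The three
  summands come from the cutoff, from the variation of the metrics on the sphere, and from replacing
  \<open>sinh\<close> by an exponential.\<close>

lemma radially_close_chart:
  fixes \<psi> :: "real^'n \<Rightarrow> real^('n::finite option)"
  assumes g: "sphere_metric g" and c: "cutoff_function \<rho>"
    and ch: "is_chart (sphere 0 1) U \<psi>" and p: "infdist p (- U) \<ge> 1"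
    and K: "K \<ge> 0"
      "\<And>h i j. h \<in> {round_metric, g} \<Longrightarrow> i \<in> Basis \<Longrightarrow> j \<in> Basis \<Longrightarrow>
        C2_bounded K (\<lambda>x. pullback \<psi> h x i j) {x. infdist x (- U) > 1/2}"
    and l: "l > 0" "\<And>h v. h \<in> {round_metric, g} \<Longrightarrow> pullback \<psi> h p v v \<ge> l * (norm v)\<^sup>2"
    and d: "d \<ge> 1" and t\<^sub>0: "t\<^sub>0 \<ge> 1"
    and s: "s = 2 * exp (- t\<^sub>0)" "s * (1 / sqrt l) \<le> 1/4" "s \<le> 1"
    and K': "K' = K * (real DIM(real^'n))\<^sup>2 * (1 / sqrt l)\<^sup>2"
  shows "\<exists>(\<phi> :: (real^'n) \<times> real \<Rightarrow> (real^('n option)) \<times> real) \<phi>\<^sub>1.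
    is_chart cylinder model_domain \<phi> \<and> \<phi> (0, 0) = (\<psi> p, t\<^sub>0) \<and>
    is_chart (sphere 0 1) (ball 0 1) \<phi>\<^sub>1 \<and>
    (\<forall>(x, t)\<in>model_domain. \<phi> (x, t) = (\<phi>\<^sub>1 x, t + t\<^sub>0)) \<and>
    C2_norm model_domain (\<lambda>y v w. pullback \<phi> (pullback from_polar (warp_deform \<rho> a d g)) y v w - model_metric y v w)
      \<le> ereal (288 * (384 * K' / d + 2 * (K' * (s * (1 / sqrt l)))) + 36 * s)"
proof -
  define \<Lambda> where "\<Lambda> = 1 / sqrt l"
  have \<Lambda>: "\<Lambda> > 0" using l by (simp add: \<Lambda>_def)
  have sp: "s > 0" by (simp add: s)
  define V where "V = {x. infdist x (- U) > 1/2}"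
  have U: "open U" "smooth_on U \<psi>" using ch by (auto simp: is_chart_def)
  have V: "open V" "V \<subseteq> U"
  proof -
    show "open V" unfolding V_def by (intro open_Collect_less continuous_intros)
    show "V \<subseteq> U"
    proof
      fix x assume "x \<in> V" then show "x \<in> U" by (cases "x \<in> U") (auto simp: V_def)
    qed
  qed
  have pU: "p \<in> U" using p by (cases "p \<in> U") auto
  have h: "sphere_metric h" if "h \<in> {round_metric, g}" for h
    using that g sphere_metric_round by auto
  have ip: "inner_product_on UNIV (pullback \<psi> h x)" if "h \<in> {round_metric, g}" "x \<in> U" for h x
    by (rule inner_product_on_pullback[OF ch that(2) h[OF that(1)]])
  define r where "r t = \<rho> (2 * ((t + t\<^sub>0 - a) / d))" for t
  have r: "0 \<le> r t" "r t \<le> 1" for t using c by (auto simp: r_def cutoff_function_def)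
  \<comment> \<open>The form to be flattened: the interpolated metric at the centre \<open>p\<close>
    and at the height \<open>t\<^sub>0\<close>, where the cutoff has the value
    \<open>r 0\<close>.\<close>
  define B where "B = (\<lambda>v w. (1 - r 0) * pullback \<psi> round_metric p v w + r 0 * pullback \<psi> g p v w)"
  have B: "inner_product_on UNIV B"
    unfolding B_def by (intro inner_product_on_convex ip r pU) auto
  obtain L :: "real^'n \<Rightarrow> real^'n" where L: "linear L" "\<And>u v. B (L u) (L v) = u \<bullet> v"
    by (rule inner_product_isometry[OF B]) blast
  \<comment> \<open>Both metrics are at least \<open>l\<close> at \<open>p\<close>, hence so is
    their convex combination \<open>B\<close>, and \<open>L\<close> turns \<open>B\<close> into the
    flat form.\<close>
  have L_norm: "norm (L v) \<le> \<Lambda> * norm v" for v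
  proof -
    have "l * (norm (L v))\<^sup>2 = (1 - r 0) * (l * (norm (L v))\<^sup>2) + r 0 * (l * (norm (L v))\<^sup>2)"
      by (simp add: algebra_simps)
    also have "\<dots> \<le> B (L v) (L v)"
      unfolding B_def using r by (intro add_mono mult_left_mono l) auto
    finally have "l * (norm (L v))\<^sup>2 \<le> (norm v)\<^sup>2" by (simp add: L dot_square_norm)
    then have "(norm (L v))\<^sup>2 \<le> (\<Lambda> * norm v)\<^sup>2"
      using l(1) by (simp add: \<Lambda>_def power_mult_distrib power_divide field_simps)
    then show ?thesis using \<Lambda> by (simp add: power2_le_iff_abs_le)
  qed
  have B0: "B 0 w = 0" for w using inner_product_onD(1)[OF B UNIV_I UNIV_I UNIV_I, of 0 0 0 0 w] by simp
  have L_inj: "v = 0" if "L v = 0" for v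
    using L(2)[of v v] B0[of "L v"] that by simp
  define L\<^sub>2 where "L\<^sub>2 v = s *\<^sub>R L v" for v
  have L2: "linear L\<^sub>2" unfolding L\<^sub>2_def using L(1) by (rule linear_compose_scale_right)
  have "inj L\<^sub>2" using L_inj sp by (simp add: linear_injective_0[OF L2] L\<^sub>2_def)
  have bl: "bounded_linear L\<^sub>2" using L2 linear_conv_bounded_linear by blast
  have L2_norm: "norm (L\<^sub>2 v) \<le> (s * \<Lambda>) * norm v" for v
    using L_norm[of v] sp by (simp add: L\<^sub>2_def)
  have s\<Lambda>: "0 \<le> s * \<Lambda>" "s * \<Lambda> \<le> 1/4" using sp \<Lambda> s by (auto simp: \<Lambda>_def)
  \<comment> \<open>The unit ball is mapped within distance 1/4 of \<open>p\<close>, so its image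
    stays at distance at least 3/4 from the complement of \<open>U\<close>, inside the region where
    the constant \<open>K\<close> is valid.\<close>
  have inV: "p + L\<^sub>2 y \<in> V" if "y \<in> ball 0 1" for y
  proof -
    have "norm (L\<^sub>2 y) \<le> (1/4) * 1"
      using that s\<Lambda> by (intro order_trans[OF L2_norm] mult_mono) auto
    moreover have "infdist p (- U) \<le> infdist (p + L\<^sub>2 y) (- U) + dist p (p + L\<^sub>2 y)"
      by (rule infdist_triangle)
    ultimately show ?thesis using p by (simp add: V_def dist_norm)
  qed
  define \<phi>\<^sub>1 where "\<phi>\<^sub>1 y = \<psi> (p + L\<^sub>2 y)" for y
  define \<phi> where "\<phi> z = (\<phi>\<^sub>1 (fst z), snd z + t\<^sub>0)" for z :: "(real^'n) \<times> real"
  have c1: "is_chart (sphere 0 1) (ball 0 1) \<phi>\<^sub>1"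
    unfolding \<phi>\<^sub>1_def using inV V \<open>inj L\<^sub>2\<close>
    by (intro is_chart_compose_affine[OF ch L2]) auto
  have c2: "is_chart cylinder model_domain \<phi>"
    unfolding \<phi>_def by (rule is_chart_cylinder[OF c1 t\<^sub>0])
  define q where "q = exp (- (2 * t\<^sub>0))"
  \<comment> \<open>The error of the \<open>sinh\<close> factor is of order \<open>q\<close>, the
    square of \<open>exp (- t\<^sub>0)\<close>; comparing it with \<open>s\<close> lets one
    smallness parameter control both errors.\<close>
  have q: "0 \<le> q" "q \<le> 1" "q \<le> s"
  proof -
    have "q = exp (- t\<^sub>0) * exp (- t\<^sub>0)" by (simp add: q_def flip: exp_add)
    moreover have "exp (- t\<^sub>0) * exp (- t\<^sub>0) \<le> exp (- t\<^sub>0) * 2"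
      using s sp by (intro mult_left_mono) auto
    ultimately show "q \<le> s" by (simp add: s)
    then show "q \<le> 1" using s by simp
  qed (simp add: q_def)
  have md: "open (model_domain :: ((real^'n) \<times> real) set)"
    by (auto simp: model_domain_def intro: open_Times)
  \<comment> \<open>The derivative of the chart puts \<open>s *\<^sub>R L\<close> into both slots,
    so \<open>s\<^sup>2\<close> comes out and combines with the square of \<open>sinh\<close> into
    the rescaled factor.\<close>
  have metric: "pullback \<phi> (pullback from_polar (warp_deform \<rho> a d g)) z X Y =
      (exp (2 * snd z) + warp_error q (snd z)) *
        ((1 - r (snd z)) * pullback \<psi> round_metric (p + L\<^sub>2 (fst z)) (L (fst X)) (L (fst Y))
          + r (snd z) * pullback \<psi> g (p + L\<^sub>2 (fst z)) (L (fst X)) (L (fst Y))) + snd X * snd Y"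
    if z: "z \<in> model_domain" for z X Y
  proof -
    define y where "y = p + L\<^sub>2 (fst z)"
    have yU: "y \<in> U" using inV[of "fst z"] z V by (auto simp: model_domain_def y_def)
    note f = sphere_chart_facts[OF ch yU]
    let ?D = "frechet_derivative \<psi> (at y)"
    have dA: "((\<lambda>z::(real^'n) \<times> real. p + L\<^sub>2 (fst z)) has_derivative (\<lambda>X. L\<^sub>2 (fst X))) (at z)"
      using has_derivative_add[OF has_derivative_const[of p]
          bounded_linear.has_derivative[OF bl has_derivative_fst[OF has_derivative_ident]]] by simp
    have "(\<phi> has_derivative (\<lambda>X. (?D (L\<^sub>2 (fst X)), snd X))) (at z)"
      unfolding \<phi>_def[abs_def] \<phi>\<^sub>1_def
      using has_derivative_Pair[OF diff_chain_at[OF dA f(2)[unfolded y_def]]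
          has_derivative_add[OF has_derivative_snd[OF has_derivative_ident] has_derivative_const[of t\<^sub>0]]]
      by (simp add: o_def y_def)
    then have D: "frechet_derivative \<phi> (at z) = (\<lambda>X. (?D (L\<^sub>2 (fst X)), snd X))"
      by (rule frechet_derivative_at[symmetric])
    have \<phi>z: "\<phi> z = (\<psi> y, snd z + t\<^sub>0)" by (simp add: \<phi>_def \<phi>\<^sub>1_def y_def)
    have cyl: "\<phi> z \<in> cylinder" using f(1) z t\<^sub>0 by (auto simp: \<phi>z cylinder_def model_domain_def)
    have tan: "(?D (L\<^sub>2 (fst X)), snd X) \<in> cylinder_tangent (\<phi> z)" for X :: "(real^'n) \<times> real"
      using f(3) by (simp add: \<phi>z cylinder_tangent_def)
    have scale: "h (\<psi> y) (?D (L\<^sub>2 u)) (?D (L\<^sub>2 v)) = s\<^sup>2 * pullback \<psi> h y (L u) (L v)"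
      if "h \<in> {round_metric, g}" for h u v
      using inner_product_on_scale[OF ip[OF that yU], of s "L u" "L v"]
      by (simp add: pullback_def L\<^sub>2_def)
    have "pullback \<phi> (pullback from_polar (warp_deform \<rho> a d g)) z X Y
        = warped_metric \<rho> a d g (\<phi> z) (?D (L\<^sub>2 (fst X)), snd X) (?D (L\<^sub>2 (fst Y)), snd Y)"
      using warp_deform_from_polar[OF cyl tan tan] unfolding pullback_def[of \<phi>] D by simp
    also have "\<dots> = (sinh (snd z + t\<^sub>0))\<^sup>2 * ((1 - r (snd z)) * round_metric (\<psi> y) (?D (L\<^sub>2 (fst X))) (?D (L\<^sub>2 (fst Y)))
          + r (snd z) * g (\<psi> y) (?D (L\<^sub>2 (fst X))) (?D (L\<^sub>2 (fst Y)))) + snd X * snd Y"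
      by (simp add: warped_metric_def radial_metric_def \<phi>z interpolated_metric_convex r_def round_metric_def)
    also have "\<dots> = (s\<^sup>2 * (sinh (snd z + t\<^sub>0))\<^sup>2) * ((1 - r (snd z)) * pullback \<psi> round_metric y (L (fst X)) (L (fst Y))
          + r (snd z) * pullback \<psi> g y (L (fst X)) (L (fst Y))) + snd X * snd Y"
      by (simp add: scale algebra_simps)
    also have "s\<^sup>2 * (sinh (snd z + t\<^sub>0))\<^sup>2 = exp (2 * snd z) + warp_error q (snd z)"
      unfolding s q_def by (rule warp_error_eq)
    finally show ?thesis by (simp add: y_def)
  qed
  have Kp: "K' \<ge> 0" using K by (simp add: K')
  have entry: "C2_bounded (288 * (384 * K' / d + 2 * (K' * (s * \<Lambda>))) + 36 * s)
      (\<lambda>z. pullback \<phi> (pullback from_polar (warp_deform \<rho> a d g)) z X Y - model_metric z X Y) model_domain"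
    if X: "X \<in> Basis" and Y: "Y \<in> Basis" for X Y :: "(real^'n) \<times> real"
  proof -
    \<comment> \<open>A basis vector of the product has one vanishing component, so its first
      component has norm 0 or 1; entries in the height direction are thereby treated together with
      the others.\<close>
    have n1: "norm (fst Z) \<le> 1" if "Z \<in> Basis" for Z :: "(real^'n) \<times> real"
      using norm_fst_le[of "fst Z" "snd Z"] that by simp
    define f where "f h x = pullback \<psi> h x (L (fst X)) (L (fst Y))" for h x
    have fV: "C2_bounded K' (f h) V" if "h \<in> {round_metric, g}" for h
    proof (rule C2_bounded_mono)
      show "C2_bounded (K * (real DIM(real^'n))\<^sup>2 * (norm (L (fst X)) * norm (L (fst Y)))) (f h) V"
        unfolding f_def[abs_def] using K(2)[OF that]
        by (intro C2_bounded_pullback[OF ch h[OF that] V K(1)]) (auto simp: V_def)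
      have "norm (L (fst Z)) \<le> \<Lambda>" if "Z \<in> Basis" for Z :: "(real^'n) \<times> real"
        using L_norm[of "fst Z"] mult_left_mono[OF n1[OF that] less_imp_le[OF \<Lambda>]] by linarith
      then have "norm (L (fst X)) * norm (L (fst Y)) \<le> \<Lambda> * \<Lambda>"
        using X Y \<Lambda> by (intro mult_mono) auto
      then show "K * (real DIM(real^'n))\<^sup>2 * (norm (L (fst X)) * norm (L (fst Y))) \<le> K'"
        unfolding K' \<Lambda>_def[symmetric] power2_eq_square[of \<Lambda>] using K(1)
        by (intro mult_left_mono) auto
    qed
    have f1: "C2_bounded K' (\<lambda>z. f h (p + L\<^sub>2 (fst z))) model_domain" if "h \<in> {round_metric, g}" for h
      unfolding model_domain_def
      by (rule C2_bounded_fst, rule C2_bounded_affine(1)[OF fV[OF that] bl L2_norm])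
         (use s\<Lambda> inV in auto)
    have f2: "C2_bounded (K' * (s * \<Lambda>)) (\<lambda>z. f h (p + L\<^sub>2 (fst z)) - f h p) model_domain" if "h \<in> {round_metric, g}" for h
      unfolding model_domain_def
      by (rule C2_bounded_fst[where f="\<lambda>y. f h (p + L\<^sub>2 y) - f h p"], rule C2_bounded_affine(2)[OF fV[OF that] bl L2_norm])
         (use s\<Lambda> inV in auto)
    \<comment> \<open>The difference of the interpolated form at \<open>z\<close> and at the centre,
      split so that each summand has a small factor: first the cutoff changes while the metrics are
      evaluated at the moved point, then the two metrics change with the weights frozen at the
      centre.\<close>
    define Q where "Q z = (r (snd z) - r 0) * (f g (p + L\<^sub>2 (fst z)) + (- 1) * f round_metric (p + L\<^sub>2 (fst z)))
      + ((1 - r 0) * (f round_metric (p + L\<^sub>2 (fst z)) - f round_metric p) + r 0 * (f g (p + L\<^sub>2 (fst z)) - f g p))"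
      for z :: "(real^'n) \<times> real"
    have Q: "C2_bounded (4 * (48 / d) * (K' + 1 * K') + (1 * (K' * (s * \<Lambda>)) + 1 * (K' * (s * \<Lambda>)))) Q model_domain"
      unfolding Q_def[abs_def]
    proof (intro C2_bounded_add C2_bounded_mult C2_bounded_cmult f1 f2)
      show "C2_bounded (48 / d) (\<lambda>z. r (snd z) - r 0) (model_domain :: ((real^'n) \<times> real) set)"
        unfolding model_domain_def r_def
        by (rule C2_bounded_snd[OF C2_bounded_cutoff[OF c d]])
    qed (use r[of 0] in auto)
    have F: "C2_bounded (36 + 36 * q) (\<lambda>z. exp (2 * snd z) + warp_error q (snd z)) (model_domain :: ((real^'n) \<times> real) set)"
      unfolding model_domain_def
      by (intro C2_bounded_add C2_bounded_snd[OF C2_bounded_exp_double] C2_bounded_snd[OF C2_bounded_warp_error] q)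
    have xy: "\<bar>fst X \<bullet> fst Y\<bar> \<le> 1"
      using Cauchy_Schwarz_ineq2[of "fst X" "fst Y"] mult_mono[OF n1[OF X] n1[OF Y]] by simp
    \<comment> \<open>Here 72 bounds the height factor \<open>36 + 36 * q\<close>, so 288 is 4 times
      72; 384 is 4 times 48 times 2, where the 2 comes from the difference of the two
      metrics.\<close>
    have tot: "C2_bounded (4 * 72 * (4 * (48 / d) * (K' + 1 * K') + (1 * (K' * (s * \<Lambda>)) + 1 * (K' * (s * \<Lambda>)))) + 1 * (36 * q))
      (\<lambda>z. (exp (2 * snd z) + warp_error q (snd z)) * Q z + (fst X \<bullet> fst Y) * warp_error q (snd z)) model_domain"
    proof (intro C2_bounded_add C2_bounded_mult C2_bounded_cmult xy Q)
      show "C2_bounded 72 (\<lambda>z. exp (2 * snd z) + warp_error q (snd z)) (model_domain :: ((real^'n) \<times> real) set)"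
        by (rule C2_bounded_mono[OF F]) (use q in simp)
      show "C2_bounded (36 * q) (\<lambda>z. warp_error q (snd z)) (model_domain :: ((real^'n) \<times> real) set)"
        unfolding model_domain_def by (intro C2_bounded_snd[OF C2_bounded_warp_error] q)
    qed
    have "C2_bounded (288 * (384 * K' / d + 2 * (K' * (s * \<Lambda>))) + 36 * s)
      (\<lambda>z. (exp (2 * snd z) + warp_error q (snd z)) * Q z + (fst X \<bullet> fst Y) * warp_error q (snd z)) model_domain"
      by (rule C2_bounded_mono[OF tot]) (use q d in \<open>simp add: field_simps\<close>)
    then show ?thesis
    proof (rule C2_bounded_cong[OF _ md])
      fix z :: "(real^'n) \<times> real" assume z: "z \<in> model_domain"
      have xy: "fst X \<bullet> fst Y = (1 - r 0) * f round_metric p + r 0 * f g p"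
        using L(2)[of "fst X" "fst Y"] by (simp add: B_def f_def)
      have QQ: "Q z + fst X \<bullet> fst Y = (1 - r (snd z)) * f round_metric (p + L\<^sub>2 (fst z)) + r (snd z) * f g (p + L\<^sub>2 (fst z))"
        unfolding Q_def xy by (simp add: algebra_simps)
      have "pullback \<phi> (pullback from_polar (warp_deform \<rho> a d g)) z X Y - model_metric z X Y
          = (exp (2 * snd z) + warp_error q (snd z)) * (Q z + fst X \<bullet> fst Y) - exp (2 * snd z) * (fst X \<bullet> fst Y)"
        unfolding metric[OF z] QQ by (simp add: f_def model_metric_def radial_metric_def)
      then show "(exp (2 * snd z) + warp_error q (snd z)) * Q z + (fst X \<bullet> fst Y) * warp_error q (snd z)
        = pullback \<phi> (pullback from_polar (warp_deform \<rho> a d g)) z X Y - model_metric z X Y"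
        by (simp add: algebra_simps)
    qed
  qed
  have "C2_norm model_domain (\<lambda>y v w. pullback \<phi> (pullback from_polar (warp_deform \<rho> a d g)) y v w - model_metric y v w)
      \<le> ereal (288 * (384 * K' / d + 2 * (K' * (s * \<Lambda>))) + 36 * s)"
    by (rule C2_norm_le[OF md entry])
  moreover have "\<phi> (0, 0) = (\<psi> p, t\<^sub>0)" by (simp add: \<phi>_def \<phi>\<^sub>1_def linear_0[OF L2])
  ultimately show ?thesis
    using c1 c2 unfolding \<Lambda>_def
    by (intro exI[of _ \<phi>] exI[of _ \<phi>\<^sub>1]) (simp add: \<phi>_def split_beta)
qed

text \<open>The constants of \<open>g\<close> depend on \<open>c\<close> and the dimension only,
  those of the round metric on the chart. Finiteness of the atlas allows a maximum and a minimum to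
  be taken before any metric \<open>g\<close> is chosen.\<close>

lemma admissible_atlas_constants:
  fixes A :: "'n::finite sphere_chart set"
  assumes A: "admissible_atlas A" and c: "c > 1"
  obtains K l where "K \<ge> 0" "l > 0"
    "\<And>g U \<psi> h i j. sphere_metric g \<Longrightarrow> c_bounded A c g \<Longrightarrow> (U, \<psi>) \<in> A \<Longrightarrow> h \<in> {round_metric, g} \<Longrightarrow>
      i \<in> Basis \<Longrightarrow> j \<in> Basis \<Longrightarrow> C2_bounded K (\<lambda>x. pullback \<psi> h x i j) {x. infdist x (- U) > 1/2}"
    "\<And>g U \<psi> h p v. sphere_metric g \<Longrightarrow> c_bounded A c g \<Longrightarrow> (U, \<psi>) \<in> A \<Longrightarrow> h \<in> {round_metric, g} \<Longrightarrow>
      infdist p (- U) \<ge> 1 \<Longrightarrow> pullback \<psi> h p v v \<ge> l * (norm v)\<^sup>2"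
proof -
  have fin: "finite A" and chart: "\<And>U \<psi>. (U, \<psi>) \<in> A \<Longrightarrow> is_chart (sphere 0 1) U \<psi>"
    and bdd: "\<And>U \<psi>. (U, \<psi>) \<in> A \<Longrightarrow> bounded U"
    using A unfolding admissible_atlas_def
    by (auto intro: bounded_subset[OF compact_imp_bounded closure_subset])
  have in_U: "x \<in> U" if "infdist x (- U) > 0" for x and U :: "(real^'n) set"
    using that by (cases "x \<in> U") auto
  define P where "P z K l \<longleftrightarrow> l > 0 \<and>
    (\<forall>i\<in>Basis. \<forall>j\<in>Basis. C2_bounded K (\<lambda>x. pullback (snd z) round_metric x i j) {x. infdist x (- fst z) > 1/2}) \<and>
    (\<forall>x v. infdist x (- fst z) \<ge> 1 \<longrightarrow> pullback (snd z) round_metric x v v \<ge> l * (norm v)\<^sup>2)"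
    for z :: "'n sphere_chart" and K l
  have "\<forall>z\<in>A. \<exists>K l. P z K l"
  proof
    fix z assume "z \<in> A"
    then have z: "(fst z, snd z) \<in> A" by simp
    from round_chart_constants[OF chart[OF z] bdd[OF z]] show "\<exists>K l. P z K l"
      unfolding P_def by metis
  qed
  then obtain K\<^sub>1 l\<^sub>1 where Kl: "\<And>z. z \<in> A \<Longrightarrow> P z (K\<^sub>1 z) (l\<^sub>1 z)" by metis
  obtain l\<^sub>2 where l2: "l\<^sub>2 > 0"
    "\<And>A U \<psi> g x v. c_bounded A c g \<Longrightarrow> sphere_metric g \<Longrightarrow> (U, \<psi> :: real^'n \<Rightarrow> real^('n option)) \<in> A \<Longrightarrow>
        is_chart (sphere 0 1) U \<psi> \<Longrightarrow> x \<in> U \<Longrightarrow> pullback \<psi> g x v v \<ge> l\<^sub>2 * (norm v)\<^sup>2"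
    using c_bounded_chart_constants[OF c, where 'n='n] by metis
  define K\<^sub>2 where "K\<^sub>2 = c * (real DIM(real^'n))\<^sup>2"
  define K where "K = Max (insert K\<^sub>2 (K\<^sub>1 ` A))"
  define l where "l = Min (insert l\<^sub>2 (l\<^sub>1 ` A))"
  have K: "K\<^sub>2 \<le> K" "\<And>z. z \<in> A \<Longrightarrow> K\<^sub>1 z \<le> K" using fin by (auto simp: K_def)
  have l: "l \<le> l\<^sub>2" "\<And>z. z \<in> A \<Longrightarrow> l \<le> l\<^sub>1 z" using fin by (auto simp: l_def)
  show ?thesis
  proof (rule that)
    show "K \<ge> 0" using K(1) c by (intro order_trans[OF _ K(1)]) (simp add: K\<^sub>2_def)
    show "l > 0" using fin l2(1) Kl by (auto simp: l_def P_def)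
    fix g U \<psi> h
    assume g: "sphere_metric g" "c_bounded A c g" and UA: "(U, \<psi>) \<in> A" and h: "h \<in> {round_metric, g}"
    note P = Kl[OF UA, unfolded P_def fst_conv snd_conv]
    show "C2_bounded K (\<lambda>x. pullback \<psi> h x i j) {x. infdist x (- U) > 1/2}"
      if ij: "i \<in> Basis" "j \<in> Basis" for i j
    proof (cases "h = round_metric")
      case True
      then show ?thesis using P ij C2_bounded_mono[OF _ K(2)[OF UA]] by blast
    next
      case False
      then have "h = g" using h by simp
      have "C2_bounded K\<^sub>2 (\<lambda>x. pullback \<psi> g x i j) U"
        unfolding K\<^sub>2_def by (rule C2_bounded_of_c_bounded[OF g(2,1) UA chart[OF UA] ij])
      then have "C2_bounded K (\<lambda>x. pullback \<psi> g x i j) U" using K(1) by (rule C2_bounded_mono)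
      then show ?thesis unfolding \<open>h = g\<close> by (rule C2_bounded_subset) (use in_U in fastforce)
    qed
    show "pullback \<psi> h p v v \<ge> l * (norm v)\<^sup>2" if p: "infdist p (- U) \<ge> 1" for p v
    proof (cases "h = round_metric")
      case True
      have "l * (norm v)\<^sup>2 \<le> l\<^sub>1 (U, \<psi>) * (norm v)\<^sup>2" using l(2)[OF UA] by (intro mult_right_mono) auto
      also have "\<dots> \<le> pullback \<psi> h p v v" using P p True by blast
      finally show ?thesis .
    next
      case False
      then have "h = g" using h by simp
      have "l * (norm v)\<^sup>2 \<le> l\<^sub>2 * (norm v)\<^sup>2" using l(1) by (intro mult_right_mono) auto
      also have "\<dots> \<le> pullback \<psi> h p v v"
        unfolding \<open>h = g\<close> by (rule l2(2)[OF g(2,1) UA chart[OF UA] in_U]) (use p in simp)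
      finally show ?thesis .
    qed
  qed
qed

theorem theorem2:
  fixes \<rho> :: "real \<Rightarrow> real"
    and A :: "'n::finite sphere_chart set"
    and c \<epsilon> :: real
  assumes "cutoff_function \<rho>"
    and "admissible_atlas A"
    and "c > 1"
    and "\<epsilon> > 0"
  shows "\<exists>a\<^sub>0>0. \<exists>d\<^sub>0>0. \<forall>g. sphere_metric g \<and> c_bounded A c g \<longrightarrow>
    (\<forall>a d. a > a\<^sub>0 \<and> d > d\<^sub>0 \<longrightarrow> close_to_hyperbolic a \<epsilon> (warp_deform \<rho> a d g))"
proof -
  obtain K l where K: "K \<ge> 0" and l: "l > 0"
    and KC: "\<And>g U \<psi> h i j. sphere_metric g \<Longrightarrow> c_bounded A c g \<Longrightarrow> (U, \<psi>) \<in> A \<Longrightarrow> h \<in> {round_metric, g} \<Longrightarrow>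
      i \<in> Basis \<Longrightarrow> j \<in> Basis \<Longrightarrow> C2_bounded K (\<lambda>x. pullback \<psi> h x i j) {x. infdist x (- U) > 1/2}"
    and lC: "\<And>g U \<psi> h p v. sphere_metric g \<Longrightarrow> c_bounded A c g \<Longrightarrow> (U, \<psi>) \<in> A \<Longrightarrow> h \<in> {round_metric, g} \<Longrightarrow>
      infdist p (- U) \<ge> 1 \<Longrightarrow> pullback \<psi> h p v v \<ge> l * (norm v)\<^sup>2"
    by (rule admissible_atlas_constants[OF assms(2,3)]) blast
  define \<Lambda> where "\<Lambda> = 1 / sqrt l"
  define K' where "K' = K * (real DIM(real^'n))\<^sup>2 * \<Lambda>\<^sup>2"
  \<comment> \<open>\<open>C\<^sub>1 - 1\<close> and \<open>C\<^sub>2\<close> are the coefficients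
    of \<open>1 / d\<close> and of \<open>s\<close> in the error bound; the summand 1 makes
    \<open>C\<^sub>1\<close> positive even if \<open>K'\<close> is 0.\<close>
  define C\<^sub>1 where "C\<^sub>1 = 288 * 384 * K' + 1"
  define C\<^sub>2 where "C\<^sub>2 = 576 * (K' * \<Lambda>) + 36"
  \<comment> \<open>An upper bound for the scale \<open>s\<close>: the first two entries are the
    size conditions on the chart, the third gives
    \<open>C\<^sub>2 * s \<le> \<epsilon> / 4\<close>.\<close>
  define \<sigma> where "\<sigma> = Min {1, 1 / (4 * \<Lambda>), \<epsilon> / (4 * C\<^sub>2)}"
  have \<Lambda>: "\<Lambda> > 0" using l by (simp add: \<Lambda>_def)
  have K': "K' \<ge> 0" using K by (simp add: K'_def)
  have C: "C\<^sub>1 > 0" "C\<^sub>2 > 0" using K' \<Lambda> by (auto simp: C\<^sub>1_def C\<^sub>2_def add_nonneg_pos)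
  have \<sigma>: "\<sigma> > 0" "\<sigma> \<le> 1" "\<sigma> \<le> 1 / (4 * \<Lambda>)" "\<sigma> \<le> \<epsilon> / (4 * C\<^sub>2)"
    using \<Lambda> C assms(4) by (auto simp: \<sigma>_def)
  \<comment> \<open>Outside the ball of radius \<open>a - 1\<close> the height exceeds
    \<open>1 + 2 / \<sigma>\<close>. One unit of the 2 pays for this shift, the other ensures
    \<open>t\<^sub>0 \<ge> 1\<close>. Since \<open>exp t\<^sub>0 \<ge> t\<^sub>0\<close>, the term
    \<open>2 / \<sigma>\<close> yields \<open>s \<le> \<sigma>\<close>.\<close>
  define a\<^sub>0 where "a\<^sub>0 = 2 + 2 / \<sigma>"
  \<comment> \<open>The summand 1 gives \<open>d \<ge> 1\<close> for the cutoff bounds, the other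
    one \<open>C\<^sub>1 / d \<le> \<epsilon> / 4\<close>; the total error is then at most half of
    \<open>\<epsilon>\<close>, which leaves room for the strict inequality.\<close>
  define d\<^sub>0 where "d\<^sub>0 = 1 + 4 * C\<^sub>1 / \<epsilon>"
  have pos: "a\<^sub>0 > 0" "d\<^sub>0 > 0" using \<sigma> C assms(4) by (auto simp: a\<^sub>0_def d\<^sub>0_def add_pos_pos)
  have "close_to_hyperbolic a \<epsilon> (warp_deform \<rho> a d g)"
    if g: "sphere_metric g" "c_bounded A c g" and a: "a > a\<^sub>0" and d: "d > d\<^sub>0" for g a d
  proof -
    have a0: "a > 0" "d > 0" using a d pos by auto
    have \<rho>0: "\<rho> t = 0" if "t \<le> 0" for t using that assms(1) by (auto simp: cutoff_function_def)
    have inner: "pullback from_polar (warp_deform \<rho> a d g) q X Y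
        = radial_metric (\<lambda>t p v w. (sinh t)\<^sup>2 * round_metric p v w) q X Y"
      if q: "q \<in> cylinder" "from_polar q \<in> ball 0 a" and XY: "X \<in> cylinder_tangent q" "Y \<in> cylinder_tangent q" for q X Y
    proof -
      have "norm (from_polar q) = snd q" using q(1) by (auto simp: cylinder_def from_polar_def)
      then have "2 * ((snd q - a) / d) \<le> 0" using q(2) a0 by (auto simp: divide_nonpos_pos)
      then show ?thesis
        by (simp add: warp_deform_from_polar[OF q(1) XY] warped_metric_def radial_metric_def
            interpolated_metric_def \<rho>0)
    qed
    have "radially_close_to_hyperbolic {q\<in>cylinder. from_polar q \<notin> ball 0 (a - 1)} \<epsilon>
      (pullback from_polar (warp_deform \<rho> a d g))"
      unfolding radially_close_to_hyperbolic_def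
    proof (intro conjI ballI)
      show "\<exists>g'. \<forall>q\<in>cylinder. \<forall>X\<in>cylinder_tangent q. \<forall>Y\<in>cylinder_tangent q.
          pullback from_polar (warp_deform \<rho> a d g) q X Y = radial_metric g' q X Y"
        by (intro exI ballI, subst warp_deform_from_polar) (auto simp: warped_metric_def)
      fix q :: "(real^('n option)) \<times> real" assume "q \<in> {q\<in>cylinder. from_polar q \<notin> ball 0 (a - 1)}"
      then obtain x t\<^sub>0 where q: "q = (x, t\<^sub>0)" "x \<in> sphere 0 1" "t\<^sub>0 > 0" "t\<^sub>0 \<ge> a - 1"
        by (cases q) (auto simp: cylinder_def from_polar_def)
      obtain U \<psi> p where UA: "(U, \<psi>) \<in> A" and p: "\<psi> p = x" "infdist p (- U) \<ge> 1"
        using assms(2) q(2) unfolding admissible_atlas_def by (smt (verit) case_prodE)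
      have ch: "is_chart (sphere 0 1) U \<psi>" using assms(2) UA by (auto simp: admissible_atlas_def)
      have t0: "t\<^sub>0 > 1 + 2 / \<sigma>" using q a by (simp add: a\<^sub>0_def)
      then have t1: "t\<^sub>0 \<ge> 1" using \<sigma> by (smt (verit) divide_pos_pos)
      define s where "s = 2 * exp (- t\<^sub>0)"
      have "s \<le> \<sigma>"
      proof -
        have "2 / \<sigma> \<le> t\<^sub>0" "t\<^sub>0 \<le> exp t\<^sub>0"
          using t0 exp_ge_add_one_self[of t\<^sub>0] by linarith+
        then have "2 \<le> \<sigma> * exp t\<^sub>0" using \<sigma> by (smt (verit) pos_divide_le_eq mult.commute)
        then show ?thesis by (simp add: s_def exp_minus field_simps)
      qed
      have s: "s * \<Lambda> \<le> 1/4" "s \<le> 1" "C\<^sub>2 * s \<le> \<epsilon> / 4"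
      proof -
        have "s * \<Lambda> \<le> 1 / (4 * \<Lambda>) * \<Lambda>" using \<open>s \<le> \<sigma>\<close> \<sigma>(3) \<Lambda> by (intro mult_right_mono) auto
        then show "s * \<Lambda> \<le> 1/4" using \<Lambda> by simp
        show "s \<le> 1" using \<open>s \<le> \<sigma>\<close> \<sigma>(2) by simp
        have "C\<^sub>2 * s \<le> C\<^sub>2 * (\<epsilon> / (4 * C\<^sub>2))" using \<open>s \<le> \<sigma>\<close> \<sigma>(4) C by (intro mult_left_mono) auto
        then show "C\<^sub>2 * s \<le> \<epsilon> / 4" using C by simp
      qed
      have d1: "d \<ge> 1" "C\<^sub>1 / d \<le> \<epsilon> / 4"
      proof -
        show "d \<ge> 1" using d C assms(4) by (smt (verit) d\<^sub>0_def divide_pos_pos)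
        have "4 * C\<^sub>1 / \<epsilon> \<le> d" using d by (simp add: d\<^sub>0_def)
        then show "C\<^sub>1 / d \<le> \<epsilon> / 4" using a0 assms(4) by (simp add: field_simps)
      qed
      have "288 * (384 * K' / d + 2 * (K' * (s * \<Lambda>))) + 36 * s = (C\<^sub>1 - 1) / d + C\<^sub>2 * s"
        by (simp add: C\<^sub>1_def C\<^sub>2_def algebra_simps)
      also have "\<dots> \<le> C\<^sub>1 / d + C\<^sub>2 * s" using d1 by (simp add: field_simps)
      also have "\<dots> < \<epsilon>" using s(3) d1(2) assms(4) by linarith
      finally have small: "ereal (288 * (384 * K' / d + 2 * (K' * (s * \<Lambda>))) + 36 * s) < ereal \<epsilon>" by simp
      have "\<exists>(\<phi> :: (real^'n) \<times> real \<Rightarrow> (real^('n option)) \<times> real) \<phi>\<^sub>1.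
        is_chart cylinder model_domain \<phi> \<and> \<phi> (0, 0) = (\<psi> p, t\<^sub>0) \<and>
        is_chart (sphere 0 1) (ball 0 1) \<phi>\<^sub>1 \<and> (\<forall>(x, t)\<in>model_domain. \<phi> (x, t) = (\<phi>\<^sub>1 x, t + t\<^sub>0)) \<and>
        C2_norm model_domain (\<lambda>y v w. pullback \<phi> (pullback from_polar (warp_deform \<rho> a d g)) y v w - model_metric y v w)
          \<le> ereal (288 * (384 * K' / d + 2 * (K' * (s * \<Lambda>))) + 36 * s)"
        unfolding \<Lambda>_def
        by (rule radially_close_chart[OF g(1) assms(1) ch p(2) K KC[OF g UA] l lC[OF g UA _ p(2)] d1(1) t1 s_def
            s(1)[unfolded \<Lambda>_def] s(2) K'_def[unfolded \<Lambda>_def]])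
      then obtain \<phi> :: "(real^'n) \<times> real \<Rightarrow> (real^('n option)) \<times> real" and \<phi>\<^sub>1 where \<phi>:
        "is_chart cylinder model_domain \<phi>" "\<phi> (0, 0) = (\<psi> p, t\<^sub>0)"
        "is_chart (sphere 0 1) (ball 0 1) \<phi>\<^sub>1" "\<forall>(x, t)\<in>model_domain. \<phi> (x, t) = (\<phi>\<^sub>1 x, t + t\<^sub>0)"
        "C2_norm model_domain (\<lambda>y v w. pullback \<phi> (pullback from_polar (warp_deform \<rho> a d g)) y v w - model_metric y v w)
          \<le> ereal (288 * (384 * K' / d + 2 * (K' * (s * \<Lambda>))) + 36 * s)"
        by (elim exE conjE)
      show "\<exists>(\<phi> :: (real^'n) \<times> real \<Rightarrow> (real^('n option)) \<times> real) \<phi>\<^sub>1 t\<^sub>0.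
          is_chart cylinder model_domain \<phi> \<and> \<phi> (0, 0) = q \<and>
          is_chart (sphere 0 1) (ball 0 1) \<phi>\<^sub>1 \<and>
          (\<forall>(x, t)\<in>model_domain. \<phi> (x, t) = (\<phi>\<^sub>1 x, t + t\<^sub>0)) \<and>
          C2_norm model_domain (\<lambda>y v w. pullback \<phi> (pullback from_polar (warp_deform \<rho> a d g)) y v w - model_metric y v w) < ereal \<epsilon>"
        using \<phi>(1,3,4) \<phi>(2)[unfolded p(1) q(1)[symmetric]] le_less_trans[OF \<phi>(5) small]
        by (intro exI[of _ \<phi>] exI[of _ \<phi>\<^sub>1] exI[of _ t\<^sub>0] conjI)
    qed
    then show ?thesis
      unfolding close_to_hyperbolic_def
      using riemannian_metric_warp_deform[OF g(1) assms(1) a0] inner by blast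
  qed
  then show ?thesis using pos by (intro exI[of _ a\<^sub>0] exI[of _ d\<^sub>0] conjI) auto
qed

end
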